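(* The unoriented Jones polynomial, defined for a virtual link $L$ by $$\widetilde J_L(q)=(-1)^{\left(\tilde\lambda-s_--\frac12 m\right)}\,q^{\left(s_+-2s_--\frac12 m\right)}\,\langle L\rangle,$$ is an unoriented virtual link invariant (it depends neither on the diagram of $L$ nor on the orientation used to compute $\tilde\lambda$). Moreover, $\widetilde J_L\in\mathbb Z[q^{-\frac12},q^{\frac12}]$.
   Context: **Virtual links.** Virtual links are equivalence classes of virtual link diagrams (with classical and virtual crossings) under classical and virtual Reidemeister moves. Let $D$ be a diagram of $L=K_1\cup\dots\cup K_\ell$. **Bracket.** $\langle L\rangle=\langle D\rangle$ is the Kauffman bracket determined by $\langle\text{crossing}\rangle=\langle A\text{-smoothing}\rangle-q\langle B\text{-smoothing}\rangle$ at each classical crossing, $\langle\bigcirc\cup D\rangle=(q^{-1}+q)\langle D\rangle$, $\langle\emptyset\rangle=1$, virtual crossings being ignored. The $A$-smoothing joins the two regions swept by rotating the over-strand counterclockwise (at a positive crossing it is the orientation-compatible smoothing); the $B$-smoothing is the other. **Crossing numbers.** $s_+$ and $s_-$ are the numbers of positive and negative self-crossings (classical crossings of a component with itself; their signs do not depend on orientation). $m$ is the number of mixed crossings, i.e. classical crossings between different components. **Parities.** $\pi(K_i,K_j)\in\{0,1\}$ is the number of mixed crossings between $K_i$ and $K_j$ modulo 2; $\pi(K_i)$ is the number of mixed crossings involving $K_i$ modulo 2. A component is odd if $\pi(K_i)=1$ and even otherwise; a link is even if all its components are even, and odd otherwise. **Core, mantle, multi-core decomposition.** Given a link, delete all its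 odd components, then delete all components that are odd in the remaining sub-link, and so on until an even (possibly empty) sub-link remains; this is the core. The mantle is its complement. Let $C_1$ be the core of $L$, $M_1=L\setminus C_1$, $C_2$ the core of $M_1$, $M_2=M_1\setminus C_2$, and so on, until $M_n$ is empty or has empty core. Then $L=C_1\cup\dots\cup C_n\cup M_n$ is the multi-core decomposition. Put $p(K_i,K_j)=0$ if $K_i,K_j\in C_r$ for some $r$, and $p(K_i,K_j)=1$ otherwise. **Modified linking number.** Choose an orientation of $L$. $Lk(K_i,K_j)\in\frac12\mathbb Z$ is half the sum of the signs of the mixed crossings between $K_i$ and $K_j$, and $$\widetilde{Lk}(K_i,K_j)=(-1)^{p(K_i,K_j)\left(Lk(K_i,K_j)+\frac12\pi(K_i,K_j)\right)}Lk(K_i,K_j),\qquad \tilde\lambda=\sum_{1\le i<j\le\ell}\widetilde{Lk}(K_i,K_j).$$ Convention: $(-1)^{1/2}=\mathrm i$. *)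

theory Defs
  imports "HOL-Analysis.Analysis" "HOL-Library.Poly_Mapping" "HOL-Library.Multiset"
begin

section \<open>Diagrams\<close>

text \<open>
  A virtual link diagram is a generic closed curve system in the plane, that is, a plane graph
  whose vertices are its crossings. It is recorded by the list of its vertices, each given by the
  labels of the edges at its ends, in counterclockwise order.

  \<^item> In a classical crossing \<open>Cross a b c d\<close> the under-strand has ends \<open>a, c\<close> and the over-strand
    has ends \<open>b, d\<close>.
  \<^item> A virtual crossing \<open>Virt a b c d\<close> has the strands \<open>a, c\<close> and \<open>b, d\<close>.
  \<^item> \<open>Joint a b\<close> is a marked point on a strand, with no geometric meaning. Joints serve to write
    arcs without crossings; a crossingless circle is \<open>Joint a a\<close>, up to further joints.
\<close>

datatype 'e node = Cross 'e 'e 'e 'e | Virt 'e 'e 'e 'e | Joint 'e 'e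

type_synonym diagram = "nat node list"

fun ends :: "'e node \<Rightarrow> 'e list" where
  "ends (Cross a b c d) = [a, b, c, d]"
| "ends (Virt a b c d) = [a, b, c, d]"
| "ends (Joint a b) = [a, b]"

fun strands :: "'e node \<Rightarrow> ('e \<times> 'e) set" where
  "strands (Cross a b c d) = {(a, c), (b, d)}"
| "strands (Virt a b c d) = {(a, c), (b, d)}"
| "strands (Joint a b) = {(a, b)}"

definition labels :: "diagram \<Rightarrow> nat set" where
  "labels D = (\<Union>n\<in>set D. set (ends n))"

definition every_edge_has_two_ends :: "diagram \<Rightarrow> bool" where
  "every_edge_has_two_ends D \<longleftrightarrow> (\<forall>x\<in>labels D. count_list (concat (map ends D)) x = 2)"

text \<open>Connected components of the graph with vertex set \<open>V\<close> and adjacency \<open>R \<subseteq> V \<times> V\<close>:\<close>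

definition connectivity :: "('a \<times> 'a) set \<Rightarrow> ('a \<times> 'a) set" where
  "connectivity R = (R \<union> R\<inverse>)\<^sup>*"

definition pieces :: "'a set \<Rightarrow> ('a \<times> 'a) set \<Rightarrow> 'a set set" where
  "pieces V R = V // connectivity R"

text \<open>A dart \<open>(i, s)\<close> is the end number \<open>s\<close> of the node number \<open>i\<close>.\<close>

definition darts :: "diagram \<Rightarrow> (nat \<times> nat) set" where
  "darts D = {(i, s). i < length D \<and> s < length (ends (D ! i))}"

definition label_at :: "diagram \<Rightarrow> nat \<times> nat \<Rightarrow> nat" where
  "label_at D = (\<lambda>(i, s). ends (D ! i) ! s)"

text \<open>
  Faces are traced by running along an edge from a dart to the opposite dart of that edge, and
  then turning to the next dart around the node reached. The diagram can be drawn on the sphere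
  (equivalently, in the plane) without further crossings if and only if each of its connected
  pieces has Euler characteristic 2. Diagrams with the same nodes differ only in the relative
  position of their connected pieces, which can be changed by virtual moves.
\<close>

definition face_steps :: "diagram \<Rightarrow> ((nat \<times> nat) \<times> (nat \<times> nat)) set" where
  "face_steps D = {((i, s), (j, (t + 1) mod length (ends (D ! j)))) | i s j t.
     (i, s) \<in> darts D \<and> (j, t) \<in> darts D \<and> (i, s) \<noteq> (j, t) \<and> label_at D (i, s) = label_at D (j, t)}"

definition planar :: "diagram \<Rightarrow> bool" where
  "planar D \<longleftrightarrow>
     length D + card (pieces (darts D) (face_steps D)) =
     card (labels D) + 2 * card (pieces (labels D) (\<Union>n\<in>set D. set (ends n) \<times> set (ends n)))"

definition virtual_link_diagram :: "diagram \<Rightarrow> bool" where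
  "virtual_link_diagram D \<longleftrightarrow> every_edge_has_two_ends D \<and> planar D"


section \<open>Virtual links\<close>

text \<open>
  The two classical crossings with diagonal strands, with ends listed as south-west, south-east,
  north-east, north-west (the order that \<open>Virt\<close> also uses below); the name tells which of the two
  strands is over.
\<close>

fun slash :: "'e \<Rightarrow> 'e \<Rightarrow> 'e \<Rightarrow> 'e \<Rightarrow> 'e node" where
  "slash sw se ne nw = Cross se ne nw sw"

fun backslash :: "'e \<Rightarrow> 'e \<Rightarrow> 'e \<Rightarrow> 'e \<Rightarrow> 'e node" where
  "backslash sw se ne nw = Cross sw se ne nw"

text \<open>
  The tangles in \<open>R2\<close> and \<open>R3\<close> are read upwards. In \<open>R3\<close> the strands run from \<open>a1, a2, a3\<close> to
  \<open>b3, b2, b1\<close>, and \<open>Xij\<close> is the type of the crossing of the strands \<open>i < j\<close>; the five triples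
  are the two classical moves (the remaining height orders are rotations of these two), the
  virtual move, and the mixed moves, where a virtual strand passes a classical crossing.
\<close>

inductive local_move :: "diagram \<Rightarrow> diagram \<Rightarrow> bool" where
  rotate_Cross: "local_move [Cross a b c d] [Cross c d a b]"
| rotate_Virt: "local_move [Virt a b c d] [Virt b c d a]"
| rotate_Joint: "local_move [Joint a b] [Joint b a]"
| R1: "local_move [Cross b b a c] [Joint a c]"
| R1': "local_move [Cross a b b c] [Joint a c]"
| virtual_R1: "local_move [Virt b b a c] [Joint a c]"
| R2: "local_move [slash a b e f, backslash f e d c] [Joint a c, Joint b d]"
| virtual_R2: "local_move [Virt a b e f, Virt f e d c] [Joint a c, Joint b d]"
| R3: "(X12, X13, X23) \<in> {(slash, slash, slash), (backslash, backslash, backslash),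
         (Virt, Virt, Virt), (slash, Virt, Virt), (backslash, Virt, Virt)} \<Longrightarrow>
       local_move [X12 a1 a2 x y, X13 x a3 b3 z, X23 y z b2 b1]
                  [X23 a2 a3 u v, X13 a1 v w b1, X12 w u b3 b2]"

inductive move :: "diagram \<Rightarrow> diagram \<Rightarrow> bool" where
  local: "local_move T T' \<Longrightarrow> move (T @ D) (T' @ D)"
| reorder: "mset D = mset D' \<Longrightarrow> move D D'"
| relabel: "inj_on f (labels D) \<Longrightarrow> move D (map (map_node f) D)"
| erase_joint: "a \<noteq> b \<Longrightarrow> move (Joint a b # D) (map (map_node (id(b := a))) D)"

text \<open>
  In a local move, internal edges of the tangles cannot occur elsewhere in the diagram, since
  every edge has just two ends.
\<close>

definition same_virtual_link :: "diagram \<Rightarrow> diagram \<Rightarrow> bool" where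
  "same_virtual_link =
     equivclp (\<lambda>D D'. virtual_link_diagram D \<and> virtual_link_diagram D' \<and> move D D')"


section \<open>The bracket\<close>

text \<open>Laurent polynomials in \<open>q\<^sup>1\<^sup>/\<^sup>2\<close>; the exponent of a monomial counts half powers of \<open>q\<close>.\<close>

type_synonym laurent = "int \<Rightarrow>\<^sub>0 complex"

definition q_half_powi :: "int \<Rightarrow> laurent" where
  "q_half_powi k = Poly_Mapping.single k 1"

definition q_powi :: "int \<Rightarrow> laurent" where
  "q_powi k = q_half_powi (2 * k)"

definition integer_laurent :: "laurent set" where
  "integer_laurent = {P. \<forall>k. Poly_Mapping.lookup P k \<in> \<int>}"

definition link_relation :: "diagram \<Rightarrow> (nat \<times> nat) set" where
  "link_relation D = (\<Union>n\<in>set D. strands n)"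

definition components :: "diagram \<Rightarrow> nat set set" where
  "components D = pieces (labels D) (link_relation D)"

text \<open>
  The first argument collects the nodes that have been treated. Rotating the over-strand \<open>b, d\<close>
  of \<open>Cross a b c d\<close> counterclockwise sweeps the regions between \<open>b, c\<close> and between \<open>d, a\<close>;
  the A-smoothing that joins them has the strands \<open>a, b\<close> and \<open>c, d\<close>.
\<close>

fun bracket_from :: "diagram \<Rightarrow> diagram \<Rightarrow> laurent" where
  "bracket_from S [] = (q_powi (-1) + q_powi 1) ^ card (components S)"
| "bracket_from S (Cross a b c d # D) =
     bracket_from (Joint c d # Joint a b # S) D
     - q_powi 1 * bracket_from (Joint b c # Joint a d # S) D"
| "bracket_from S (Virt a b c d # D) = bracket_from (Virt a b c d # S) D"
| "bracket_from S (Joint a b # D) = bracket_from (Joint a b # S) D"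

definition bracket :: "diagram \<Rightarrow> laurent" where
  "bracket D = bracket_from [] D"

lemma bracket_empty: "bracket [] = 1"
  by (simp add: bracket_def components_def pieces_def labels_def)

lemma bracket_skein:
  "bracket (Cross a b c d # D) =
     bracket (Joint a b # Joint c d # D) - q_powi 1 * bracket (Joint a d # Joint b c # D)"
  by (simp add: bracket_def)


section \<open>Orientations and crossing signs\<close>

text \<open>An orientation is given by the set of the darts along which the link runs into a node.\<close>

definition orientation :: "diagram \<Rightarrow> (nat \<times> nat) set \<Rightarrow> bool" where
  "orientation D I \<longleftrightarrow> I \<subseteq> darts D \<and>
     (\<forall>i < length D. \<forall>s < length (ends (D ! i)) div 2.
        (i, s) \<in> I \<longleftrightarrow> (i, s + length (ends (D ! i)) div 2) \<notin> I) \<and>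
     (\<forall>d\<in>darts D. \<forall>e\<in>darts D.
        d \<noteq> e \<and> label_at D d = label_at D e \<longrightarrow> (d \<in> I \<longleftrightarrow> e \<notin> I))"

definition classical :: "diagram \<Rightarrow> nat set" where
  "classical D = {i. i < length D \<and> (\<exists>a b c d. D ! i = Cross a b c d)}"

text \<open>
  A crossing is positive if a counterclockwise quarter turn takes the direction of the over-strand
  to that of the under-strand. So \<open>Cross a b c d\<close> is positive if it is entered at \<open>a, d\<close> or at
  \<open>c, b\<close>.
\<close>

definition crossing_sign :: "(nat \<times> nat) set \<Rightarrow> nat \<Rightarrow> int" where
  "crossing_sign I i = (if (i, 0) \<in> I \<longleftrightarrow> (i, 3) \<in> I then 1 else -1)"

definition component_of :: "diagram \<Rightarrow> nat \<Rightarrow> nat set" where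
  "component_of D x = connectivity (link_relation D) `` {x}"

text \<open>The components of the two strands of a crossing (a singleton for a self-crossing):\<close>

definition components_at :: "diagram \<Rightarrow> nat \<Rightarrow> nat set set" where
  "components_at D i = {component_of D (label_at D (i, 0)), component_of D (label_at D (i, 1))}"

definition self_crossings :: "diagram \<Rightarrow> nat set" where
  "self_crossings D = {i \<in> classical D. \<exists>K. components_at D i = {K}}"

definition mixed_crossings :: "diagram \<Rightarrow> nat set" where
  "mixed_crossings D = classical D - self_crossings D"

definition s_pos :: "diagram \<Rightarrow> (nat \<times> nat) set \<Rightarrow> nat" where
  "s_pos D I = card {i \<in> self_crossings D. crossing_sign I i = 1}"

definition s_neg :: "diagram \<Rightarrow> (nat \<times> nat) set \<Rightarrow> nat" where
  "s_neg D I = card {i \<in> self_crossings D. crossing_sign I i = -1}"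

definition mixed_between :: "diagram \<Rightarrow> nat set \<Rightarrow> nat set \<Rightarrow> nat set" where
  "mixed_between D K K' = {i \<in> mixed_crossings D. components_at D i = {K, K'}}"

definition pair_parity :: "diagram \<Rightarrow> nat set \<Rightarrow> nat set \<Rightarrow> nat" where
  "pair_parity D K K' = card (mixed_between D K K') mod 2"


section \<open>Multi-core decomposition\<close>

text \<open>Sub-links are sets \<open>S\<close> of components.\<close>

definition odd_in :: "diagram \<Rightarrow> nat set set \<Rightarrow> nat set \<Rightarrow> bool" where
  "odd_in D S K \<longleftrightarrow> odd (card (\<Union>K'\<in>S. mixed_between D K K'))"

definition delete_odd :: "diagram \<Rightarrow> nat set set \<Rightarrow> nat set set" where
  "delete_odd D S = {K \<in> S. \<not> odd_in D S K}"

text \<open>The iterated deletions decrease and become stationary, so the intersection is the end result.\<close>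

definition core :: "diagram \<Rightarrow> nat set set \<Rightarrow> nat set set" where
  "core D S = (\<Inter>n. (delete_odd D ^^ n) S)"

text \<open>
  \<open>mantle D r\<close> is \<open>M\<^sub>r\<close>, with \<open>M\<^sub>0 = L\<close>, and \<open>core D (mantle D r)\<close> is \<open>C\<^sub>r\<^sub>+\<^sub>1\<close>. The recursion need
  not be stopped: from the first empty core on, all cores are empty.
\<close>

fun mantle :: "diagram \<Rightarrow> nat \<Rightarrow> nat set set" where
  "mantle D 0 = components D"
| "mantle D (Suc r) = mantle D r - core D (mantle D r)"

definition core_separation :: "diagram \<Rightarrow> nat set \<Rightarrow> nat set \<Rightarrow> nat" where
  "core_separation D K K' =
     (if \<exists>r. K \<in> core D (mantle D r) \<and> K' \<in> core D (mantle D r) then 0 else 1)"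


section \<open>The unoriented Jones polynomial\<close>

text \<open>Half-integers are taken as complex numbers, and \<open>(-1) powr z\<close> is \<open>exp (\<i> * pi * z)\<close>.\<close>

lemma minus_one_powr_half: "(-1 :: complex) powr (1/2) = \<i>"
  using cis_conv_exp[of "pi / 2"] by (simp add: powr_def mult.commute)

definition lk :: "diagram \<Rightarrow> (nat \<times> nat) set \<Rightarrow> nat set \<Rightarrow> nat set \<Rightarrow> complex" where
  "lk D I K K' = of_int (\<Sum>i\<in>mixed_between D K K'. crossing_sign I i) / 2"

definition modified_lk :: "diagram \<Rightarrow> (nat \<times> nat) set \<Rightarrow> nat set \<Rightarrow> nat set \<Rightarrow> complex" where
  "modified_lk D I K K' =
     (-1) powr (of_nat (core_separation D K K') * (lk D I K K' + of_nat (pair_parity D K K') / 2))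
     * lk D I K K'"

text \<open>The sum over unordered pairs of components, as half of the sum over ordered pairs:\<close>

definition lambda_tilde :: "diagram \<Rightarrow> (nat \<times> nat) set \<Rightarrow> complex" where
  "lambda_tilde D I =
     (\<Sum>K\<in>components D. \<Sum>K'\<in>components D - {K}. modified_lk D I K K') / 2"

definition unoriented_jones :: "diagram \<Rightarrow> (nat \<times> nat) set \<Rightarrow> laurent" where
  "unoriented_jones D I =
     (let m = card (mixed_crossings D) in
      Poly_Mapping.single 0 ((-1) powr (lambda_tilde D I - of_nat (s_neg D I) - of_nat m / 2))
      * q_half_powi (2 * int (s_pos D I) - 4 * int (s_neg D I) - int m)
      * bracket D)"

end

theory Submission
  imports Defs
begin

text \<open>
  The exponents in the unoriented Jones polynomial only depend on the types of the crossings, that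
  is, on the components that meet there and on the signs. Up to a bijection of the components, a move
  leaves the types of the crossings unchanged, or removes a positive or a negative self-crossing, or
  two crossings of opposite signs between the same components; it divides the bracket by \<open>1\<close>,
  \<open>q\<^sup>-\<^sup>1\<close>, \<open>-q\<^sup>2\<close> or \<open>-q\<close>, respectively. Linking numbers and the parities that determine the
  multi-core decomposition stay the same.

  Twice a modified linking number is an integer with the parity of the number of the mixed crossings
  between the two components, so summing over ordered pairs gives \<open>4 * lambda_tilde\<close> as an integer
  congruent to \<open>2 * m\<close> modulo 4; hence the coefficients are integers. The reversal of some
  components changes this sum by a multiple of 8. For two components without a common core, the
  sign in the modified linking number is chosen such that each of the two terms changes by a multiple
  of 4; for components in the same core, this holds in total, because every component of a core has
  an even number of crossings with the rest of that core.
\<close>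

text \<open>Linear arithmetic would split every disequality between labels into two cases.\<close>

declare [[linarith_neq_limit = 0]]

section \<open>Connected components of graphs\<close>

text \<open>A chain of moves from \<open>D\<close> to \<open>D'\<close> passes through diagrams for
  which no orientation is given, and a move carries an orientation of the old diagram to one of the
  new diagram that need not be the prescribed one. So the invariance itself depends on the existence
  of orientations and on the independence of their choice. An orientation is a set of positions in
  the list of nodes, and moves shift positions. It is therefore encoded by two flags at each node;
  the condition at the edges then becomes an equation of multisets that is additive along the list,
  so a local move can be checked on its tangle alone. A move does not induce a bijection of edges,
  only one of components, which is why diagrams are compared by maps of edges that are inverse to
  each other up to connectivity. Multiples of 8 are needed in the change of orientation because
  \<open>(-1) powr z\<close> has period 2 in \<open>z\<close>, and the integer considered is four
  times \<open>lambda_tilde\<close>.\<close>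

lemma connectivity_refl [simp]: "(x, x) \<in> connectivity R"
  by (simp add: connectivity_def)

lemma connectivity_edge: "(x, y) \<in> R \<Longrightarrow> (x, y) \<in> connectivity R"
  by (auto simp: connectivity_def)

lemma connectivity_trans:
  "(x, y) \<in> connectivity R \<Longrightarrow> (y, z) \<in> connectivity R \<Longrightarrow> (x, z) \<in> connectivity R"
  by (auto simp: connectivity_def)

lemma connectivity_sym: "(x, y) \<in> connectivity R \<Longrightarrow> (y, x) \<in> connectivity R"
  unfolding connectivity_def using sym_rtrancl[OF sym_Un_converse[of R]] by (auto dest: symD)

lemma connectivity_mono: "R \<subseteq> R' \<Longrightarrow> connectivity R \<subseteq> connectivity R'"
  unfolding connectivity_def by (rule rtrancl_mono) auto

lemma connectivity_map:
  assumes "(x, y) \<in> connectivity R"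
    and "\<And>x y. (x, y) \<in> R \<Longrightarrow> (f x, f y) \<in> connectivity R'"
  shows "(f x, f y) \<in> connectivity R'"
  using assms(1) unfolding connectivity_def[of R]
proof (induction rule: rtrancl_induct)
  case (step y z)
  have "(f y, f z) \<in> connectivity R'"
    using step.hyps(2) assms(2) connectivity_sym by fastforce
  with step.IH show ?case
    by (rule connectivity_trans)
qed simp

lemma connectivity_Image_eq_iff:
  "connectivity R `` {x} = connectivity R `` {y} \<longleftrightarrow> (x, y) \<in> connectivity R"
  by (auto intro: connectivity_trans connectivity_sym)

lemma connectivity_invariant:
  assumes "(x, y) \<in> connectivity R" and "\<And>x y. (x, y) \<in> R \<Longrightarrow> P x = P y"
  shows "P x = P y"
  using assms(1) unfolding connectivity_def
  by (induction rule: rtrancl_induct) (auto simp: assms(2))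

text \<open>The discrete analogue of a homotopy equivalence: \<open>f\<close> and \<open>g\<close>
  need not be injective, they are only inverse to each other within components. This admits the
  contraction of arcs.\<close>

definition graph_equivalence ::
  "('a \<Rightarrow> 'b) \<Rightarrow> ('b \<Rightarrow> 'a) \<Rightarrow> 'a set \<Rightarrow> ('a \<times> 'a) set \<Rightarrow> 'b set \<Rightarrow> ('b \<times> 'b) set \<Rightarrow> bool" where
  "graph_equivalence f g V R V' R' \<longleftrightarrow>
     f ` V \<subseteq> V' \<and> g ` V' \<subseteq> V \<and>
     (\<forall>(x, y)\<in>R. (f x, f y) \<in> connectivity R') \<and>
     (\<forall>(x, y)\<in>R'. (g x, g y) \<in> connectivity R) \<and>
     (\<forall>x\<in>V. (g (f x), x) \<in> connectivity R) \<and>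
     (\<forall>y\<in>V'. (f (g y), y) \<in> connectivity R')"

text \<open>The image of a component under \<open>f\<close> may miss some of its edges in the new
  graph, so it has to be saturated; the saturation is the component of the image of any of its
  points.\<close>

lemma graph_equivalence_Image:
  assumes "graph_equivalence f g V R V' R'"
  shows "connectivity R' `` (f ` (connectivity R `` {x})) = connectivity R' `` {f x}"
proof -
  have "(f x, f y) \<in> connectivity R'" if "(x, y) \<in> connectivity R" for y
    by (rule connectivity_map[OF that]) (use assms in \<open>auto simp: graph_equivalence_def\<close>)
  then show ?thesis
    by (auto intro: connectivity_trans connectivity_sym)
qed

lemma graph_equivalence_bij_betw:
  assumes "graph_equivalence f g V R V' R'"
  shows "bij_betw (\<lambda>K. connectivity R' `` (f ` K)) (pieces V R) (pieces V' R')"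
  unfolding bij_betw_def
proof
  note eq = assms[unfolded graph_equivalence_def]
  show "inj_on (\<lambda>K. connectivity R' `` (f ` K)) (pieces V R)"
  proof (rule inj_onI)
    fix K L assume "K \<in> pieces V R" "L \<in> pieces V R"
      and KL: "connectivity R' `` (f ` K) = connectivity R' `` (f ` L)"
    then obtain x y where x: "x \<in> V" "K = connectivity R `` {x}"
      and y: "y \<in> V" "L = connectivity R `` {y}"
      by (auto simp: pieces_def quotient_def)
    have "(f x, f y) \<in> connectivity R'"
      using KL unfolding x y graph_equivalence_Image[OF assms] connectivity_Image_eq_iff .
    then have "(g (f x), g (f y)) \<in> connectivity R"
      by (rule connectivity_map) (use eq in auto)
    moreover have "(g (f x), x) \<in> connectivity R" "(g (f y), y) \<in> connectivity R"
      using eq x y by auto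
    ultimately have "(x, y) \<in> connectivity R"
      by (meson connectivity_sym connectivity_trans)
    then show "K = L"
      by (simp add: x y connectivity_Image_eq_iff)
  qed
  show "(\<lambda>K. connectivity R' `` (f ` K)) ` pieces V R = pieces V' R'"
  proof safe
    fix K assume "K \<in> pieces V R"
    then obtain x where "x \<in> V" "K = connectivity R `` {x}"
      by (auto simp: pieces_def quotient_def)
    moreover have "f x \<in> V'"
      using eq \<open>x \<in> V\<close> by auto
    ultimately show "connectivity R' `` (f ` K) \<in> pieces V' R'"
      unfolding pieces_def by (metis graph_equivalence_Image[OF assms] quotientI)
  next
    fix K assume "K \<in> pieces V' R'"
    then obtain y where y: "y \<in> V'" "K = connectivity R' `` {y}"
      by (auto simp: pieces_def quotient_def)
    have "K = connectivity R' `` {f (g y)}"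
      using eq y by (simp add: y(2) connectivity_Image_eq_iff connectivity_sym)
    also have "\<dots> = connectivity R' `` (f ` (connectivity R `` {g y}))"
      by (simp add: graph_equivalence_Image[OF assms])
    finally show "K \<in> (\<lambda>K. connectivity R' `` (f ` K)) ` pieces V R"
    proof (rule image_eqI)
      show "connectivity R `` {g y} \<in> pieces V R"
        using eq y(1) by (auto simp: pieces_def intro: quotientI)
    qed
  qed
qed

lemma card_pieces_eq:
  "graph_equivalence f g V R V' R' \<Longrightarrow> card (pieces V R) = card (pieces V' R')"
  by (rule bij_betw_same_card[OF graph_equivalence_bij_betw])

lemma connectivity_isolated:
  assumes "b \<notin> V" "R \<subseteq> V \<times> V"
  shows "connectivity (insert (b, b) R) = connectivity R"
  unfolding connectivity_def by (rule antisym; rule rtrancl_subset_rtrancl) auto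

lemma connectivity_closed:
  assumes "(x, y) \<in> connectivity R" "R \<subseteq> V \<times> V" "x \<noteq> y"
  shows "x \<in> V" "y \<in> V"
  using assms(1,3) unfolding connectivity_def
  by (induction rule: rtrancl_induct) (use assms(2) in blast)+

text \<open>This is the graph behind a crossingless circle: \<open>Joint b b\<close> contributes one
  vertex with a loop, hence one more component.\<close>

lemma card_pieces_isolated:
  assumes "b \<notin> V" "R \<subseteq> V \<times> V" "finite V"
  shows "card (pieces (insert b V) (insert (b, b) R)) = Suc (card (pieces V R))"
proof -
  have "connectivity R `` {b} = {b}"
    using connectivity_closed[OF _ assms(2)] assms(1) by auto
  then have "pieces (insert b V) (insert (b, b) R) = insert {b} (pieces V R)"
    by (auto simp: connectivity_isolated[OF assms(1,2)] pieces_def quotient_def)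
  moreover have "{b} \<notin> pieces V R"
    using assms(1) connectivity_refl[of _ R] by (auto simp: pieces_def quotient_def)
  moreover have "finite (pieces V R)"
    using assms(3) by (simp add: pieces_def quotient_def)
  ultimately show ?thesis by simp
qed

section \<open>The bracket\<close>

lemma labels_Nil [simp]: "labels [] = {}"
  and labels_Cons [simp]: "labels (n # D) = set (ends n) \<union> labels D"
  and labels_append [simp]: "labels (D @ D') = labels D \<union> labels D'"
  by (auto simp: labels_def)

lemma link_relation_Nil [simp]: "link_relation [] = {}"
  and link_relation_Cons [simp]: "link_relation (n # D) = strands n \<union> link_relation D"
  and link_relation_append [simp]: "link_relation (D @ D') = link_relation D \<union> link_relation D'"
  by (auto simp: link_relation_def)

lemma finite_labels [simp]: "finite (labels D)"
  by (simp add: labels_def)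

lemma strands_subset: "strands n \<subseteq> set (ends n) \<times> set (ends n)"
  by (cases n) auto

lemma link_relation_subset: "link_relation D \<subseteq> labels D \<times> labels D"
  using strands_subset by (fastforce simp: link_relation_def labels_def)

lemma ends_map_node: "ends (map_node f n) = map f (ends n)"
  by (cases n) auto

lemma strands_map_node: "strands (map_node f n) = map_prod f f ` strands n"
  by (cases n) auto

lemma labels_map_node: "labels (map (map_node f) D) = f ` labels D"
  by (auto simp: labels_def ends_map_node)

lemma link_relation_map_node: "link_relation (map (map_node f) D) = map_prod f f ` link_relation D"
  by (auto simp: link_relation_def strands_map_node)

lemma map_node_id: "set (ends n) \<subseteq> {x. f x = x} \<Longrightarrow> map_node f n = n"
  by (cases n) auto

lemma map_map_node_id: "(\<And>x. x \<in> labels D \<Longrightarrow> f x = x) \<Longrightarrow> map (map_node f) D = D"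
  by (rule map_idI, rule map_node_id) (auto simp: labels_def)

section \<open>Order of the nodes and direction of the joints\<close>

text \<open>The treated nodes matter only when all crossings are smoothed, and then only through the
  components they form, for which the direction of a strand is irrelevant.\<close>

lemma bracket_from_cong:
  assumes "labels S = labels S'"
    and "link_relation S \<union> (link_relation S)\<inverse> = link_relation S' \<union> (link_relation S')\<inverse>"
  shows "bracket_from S D = bracket_from S' D"
  using assms
proof (induction D arbitrary: S S')
  case Nil
  then show ?case by (simp add: components_def pieces_def connectivity_def)
next
  case (Cons n D)
  have converse: "link_relation (m # S) \<union> (link_relation (m # S))\<inverse>
      = strands m \<union> (strands m)\<inverse> \<union> (link_relation S \<union> (link_relation S)\<inverse>)" for m S
    by auto
  have IH: "bracket_from (m # S) D = bracket_from (m # S') D"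
    "bracket_from (m # m' # S) D = bracket_from (m # m' # S') D" for m m'
    by (rule Cons.IH; simp add: Cons.prems converse del: link_relation_Cons)+
  show ?case
    by (cases n) (simp_all add: IH)
qed

lemma bracket_from_set_eq: "set S = set S' \<Longrightarrow> bracket_from S D = bracket_from S' D"
  by (rule bracket_from_cong) (simp_all add: labels_def link_relation_def)

text \<open>Two crossings have the same four pairs of smoothings in either order, with the same
  weights; only the order in which the joints are collected differs.\<close>

lemma bracket_from_swap: "bracket_from S (m # n # D) = bracket_from S (n # m # D)"
proof -
  have *: "bracket_from (a # b # S) D = bracket_from (b # a # S) D"
    "bracket_from (a # b # c # S) D = bracket_from (b # c # a # S) D"
    "bracket_from (a # b # c # d # S) D = bracket_from (c # d # a # b # S) D"
    for a b c d
    by (rule bracket_from_set_eq; auto)+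
  show ?thesis
  proof (cases m)
    case (Cross a b c d)
    show ?thesis
    proof (cases n)
      fix a' b' c' d' assume "n = Cross a' b' c' d'"
      with Cross show ?thesis
        using *(3)[of "Joint c' d'" "Joint a' b'" "Joint c d" "Joint a b"]
          *(3)[of "Joint c' d'" "Joint a' b'" "Joint b c" "Joint a d"]
          *(3)[of "Joint b' c'" "Joint a' d'" "Joint c d" "Joint a b"]
          *(3)[of "Joint b' c'" "Joint a' d'" "Joint b c" "Joint a d"]
        by (simp add: algebra_simps)
    next
      fix a' b' c' d' assume "n = Virt a' b' c' d'"
      with Cross show ?thesis using *(2)[of n] by simp
    next
      fix a' b' assume "n = Joint a' b'"
      with Cross show ?thesis using *(2)[of n] by simp
    qed
  next
    case (Virt a b c d)
    then show ?thesis using *(1)[of n m] *(2)[of m] by (cases n) simp_all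
  next
    case (Joint a b)
    then show ?thesis using *(1)[of n m] *(2)[of m] by (cases n) simp_all
  qed
qed

lemma bracket_from_move: "bracket_from S (D @ n # D') = bracket_from S (n # D @ D')"
proof (induction D arbitrary: S)
  case (Cons m D)
  have "bracket_from S (m # D @ n # D') = bracket_from S (m # n # D @ D')"
    by (cases m) (simp_all only: bracket_from.simps Cons.IH)
  then show ?case
    by (simp add: bracket_from_swap[of S m n])
qed simp

lemma bracket_from_reorder: "mset D = mset D' \<Longrightarrow> bracket_from S D = bracket_from S D'"
proof (induction D arbitrary: S D')
  case (Cons n D)
  then have "n \<in> set D'"
    by (metis list.set_intros(1) mset_eq_setD)
  then obtain D1 D2 where D': "D' = D1 @ n # D2"
    by (meson split_list)
  then have "mset D = mset (D1 @ D2)"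
    using Cons.prems by simp
  then have "bracket_from S (n # D) = bracket_from S (n # D1 @ D2)"
    by (cases n) (simp_all only: bracket_from.simps Cons.IH)
  then show ?case
    by (simp add: D' bracket_from_move)
qed simp

lemma bracket_reorder: "mset D = mset D' \<Longrightarrow> bracket D = bracket D'"
  unfolding bracket_def by (rule bracket_from_reorder)

text \<open>Joints become unordered pairs while crossings stay as they are. A single equation of
  multisets, decided by rewriting, then covers any permutation of the nodes together with any
  reversal of joints.\<close>

fun undirected :: "nat node \<Rightarrow> nat set + nat node" where
  "undirected (Joint a b) = Inl {a, b}"
| "undirected n = Inr n"

definition sort_Joint :: "nat node \<Rightarrow> nat node" where
  "sort_Joint n = (case undirected n of Inl e \<Rightarrow> Joint (Min e) (Max e) | Inr n \<Rightarrow> n)"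

lemma sort_Joint_simps [simp]:
  "sort_Joint (Joint a b) = Joint (min a b) (max a b)"
  "sort_Joint (Cross a b c d) = Cross a b c d"
  "sort_Joint (Virt a b c d) = Virt a b c d"
  by (auto simp: sort_Joint_def min_def max_def)

lemma bracket_sort_Joint: "bracket (map sort_Joint D) = bracket D"
proof -
  have "bracket_from S (map sort_Joint D) = bracket_from S D" for S
  proof (induction D arbitrary: S)
    case (Cons n D)
    show ?case
    proof (cases n)
      case (Joint a b)
      have "bracket_from (sort_Joint n # S) D = bracket_from (n # S) D"
        by (rule bracket_from_cong) (auto simp: Joint min_def max_def)
      with Joint show ?thesis by (simp add: Cons.IH)
    qed (simp_all add: Cons.IH)
  qed simp
  then show ?thesis
    by (simp add: bracket_def)
qed

text \<open>\<open>sort_Joint\<close> factors through \<open>undirected\<close>, so diagrams with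
  the same undirected nodes have the same sorted nodes up to order, and sorting does not change the
  bracket.\<close>

lemma bracket_rearrange:
  assumes "mset (map undirected D) = mset (map undirected D')"
  shows "bracket D = bracket D'"
proof -
  have "map sort_Joint D = map (case_sum (\<lambda>e. Joint (Min e) (Max e)) (\<lambda>n. n)) (map undirected D)" for D
    by (simp add: sort_Joint_def[abs_def] case_sum_def)
  then have "mset (map sort_Joint D) = mset (map sort_Joint D')"
    using assms by (simp only: mset_map)
  then have "bracket (map sort_Joint D) = bracket (map sort_Joint D')"
    by (rule bracket_reorder)
  then show ?thesis
    by (simp only: bracket_sort_Joint)
qed

lemma bracket_Cross_rotate: "bracket (Cross a b c d # D) = bracket (Cross c d a b # D)"
proof -
  have "bracket (Joint c d # Joint a b # D) = bracket (Joint a b # Joint c d # D)"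
    by (rule bracket_rearrange) simp
  moreover have "bracket (Joint c b # Joint d a # D) = bracket (Joint a d # Joint b c # D)"
    by (rule bracket_rearrange) (simp add: insert_commute)
  ultimately show ?thesis
    by (simp only: bracket_skein)
qed

text \<open>A virtual crossing has the same strands as two arcs that do not meet. This reduces the
  virtual moves to the shortening of arcs.\<close>

lemma bracket_Virt: "bracket (Virt a b c d # D) = bracket (Joint a c # Joint b d # D)"
proof -
  have "bracket_from [Virt a b c d] D = bracket_from [Joint b d, Joint a c] D"
    by (rule bracket_from_cong) auto
  then show ?thesis
    by (simp add: bracket_def)
qed

section \<open>Contraction of arcs, relabelling and removal of circles\<close>

text \<open>The last hypothesis keeps the contracted point in the graph: an arc that meets nothing
  else would disappear, and a component with it.\<close>

lemma graph_equivalence_contract: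
  assumes h: "h = id(b := a)" and "a \<noteq> b"
    and S: "labels S = {a, b} \<union> labels S'" "link_relation S = insert (a, b) (link_relation S')"
    and "a \<in> labels S' \<or> b \<in> labels S'"
  shows "graph_equivalence h id (labels S) (link_relation S)
    (labels (map (map_node h) S')) (link_relation (map (map_node h) S'))"
  unfolding graph_equivalence_def
proof (intro conjI ballI; (unfold split_paired_all case_prod_conv)?)
  have ab: "(a, b) \<in> connectivity (link_relation S)"
    by (simp add: S connectivity_edge)
  have hx: "(h x, x) \<in> connectivity (link_relation S)" for x
    using ab by (simp add: h)
  show "h ` labels S \<subseteq> labels (map (map_node h) S')"
    using assms(5) by (auto simp: S labels_map_node h)
  show "id ` labels (map (map_node h) S') \<subseteq> labels S"
    by (auto simp: S labels_map_node h)
  show "(h x, h y) \<in> connectivity (link_relation (map (map_node h) S'))"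
    if "(x, y) \<in> link_relation S" for x y
    using that by (force simp: S link_relation_map_node h intro: connectivity_edge)
  show "(id x, id y) \<in> connectivity (link_relation S)"
    if "(x, y) \<in> link_relation (map (map_node h) S')" for x y
  proof -
    obtain x' y' where "x = h x'" "y = h y'" "(x', y') \<in> link_relation S"
      using \<open>(x, y) \<in> link_relation (map (map_node h) S')\<close> by (auto simp: S link_relation_map_node)
    then show ?thesis
      by (metis connectivity_edge connectivity_sym connectivity_trans hx id_apply)
  qed
  show "(id (h x), x) \<in> connectivity (link_relation S)" if "x \<in> labels S" for x
    using hx by simp
  show "(h (id y), y) \<in> connectivity (link_relation (map (map_node h) S'))"
    if "y \<in> labels (map (map_node h) S')" for y
    using that assms(2) by (auto simp: labels_map_node h)
qed

text \<open>During the recursion the joint sinks below the newly collected nodes. Hence it is only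
  required to be somewhere in \<open>S\<close>, and the labels of treated and untreated nodes are
  considered together.\<close>

lemma bracket_from_contract:
  assumes h: "h = id(b := a)" and "a \<noteq> b" "set S = insert (Joint a b) (set S')" "a \<in> labels (S' @ D) \<or> b \<in> labels (S' @ D)"
  shows "bracket_from S D
    = bracket_from (map (map_node h) S') (map (map_node h) D)"
  using assms(3,4)
proof (induction D arbitrary: S S')
  case Nil
  have "labels S = {a, b} \<union> labels S'" "link_relation S = insert (a, b) (link_relation S')"
    using Nil(1) by (auto simp: labels_def link_relation_def)
  moreover have "a \<in> labels S' \<or> b \<in> labels S'"
    using Nil(2) by simp
  ultimately show ?case
    using card_pieces_eq[OF graph_equivalence_contract[OF h assms(2)]]
    by (simp only: bracket_from.simps components_def list.map)
next
  case (Cons n D)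
  have IH: "bracket_from (m # S) D = bracket_from (map_node h m
      # map (map_node h) S') (map (map_node h) D)"
    if "set (ends m) = set (ends n)" for m
    by (subst Cons.IH[of _ "m # S'"]) (use Cons.prems that in auto)
  have IH2: "bracket_from (m # m' # S) D = bracket_from (map_node h m
      # map_node h m' # map (map_node h) S') (map (map_node h) D)"
    if "set (ends m) \<union> set (ends m') = set (ends n)" for m m'
    by (subst Cons.IH[of _ "m # m' # S'"]) (use Cons.prems that in auto)
  show ?case
  proof (cases n)
    case (Cross x y z t)
    then show ?thesis
      using IH2[of "Joint z t" "Joint x y"] IH2[of "Joint y z" "Joint x t"]
      by (simp add: insert_commute)
  qed (use IH[of n] in simp_all)
qed

lemma bracket_contract:
  assumes "a \<noteq> b" "a \<in> labels D \<or> b \<in> labels D"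
  shows "bracket (Joint a b # D) = bracket (map (map_node (id(b := a))) D)"
  unfolding bracket_def bracket_from.simps
  by (subst bracket_from_contract[OF refl assms(1), of _ "[]"]) (use assms(2) in auto)

lemma graph_equivalence_relabel:
  assumes "inj_on f (labels S)"
  shows "graph_equivalence f (inv_into (labels S) f) (labels S) (link_relation S)
    (labels (map (map_node f) S)) (link_relation (map (map_node f) S))"
proof -
  have inv: "inv_into (labels S) f (f x) = x" if "x \<in> labels S" for x
    using assms that by simp
  then show ?thesis
    unfolding graph_equivalence_def labels_map_node link_relation_map_node
    using link_relation_subset[of S]
    by (auto simp: inv subset_iff intro!: connectivity_edge)
qed

lemma bracket_from_relabel:
  assumes "inj_on f (labels (S @ D))"
  shows "bracket_from (map (map_node f) S) (map (map_node f) D) = bracket_from S D"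
  using assms
proof (induction D arbitrary: S)
  case Nil
  then show ?case
    using card_pieces_eq[OF graph_equivalence_relabel[of f S]] by (simp add: components_def)
next
  case (Cons n D)
  have IH: "bracket_from (map_node f m # map (map_node f) S) (map (map_node f) D)
      = bracket_from (m # S) D" if "set (ends m) = set (ends n)" for m
    using Cons.IH[of "m # S"] Cons.prems that by (simp add: Un_left_commute Un_commute)
  have IH2: "bracket_from (map_node f m # map_node f m' # map (map_node f) S) (map (map_node f) D)
      = bracket_from (m # m' # S) D" if "set (ends m) \<union> set (ends m') = set (ends n)" for m m'
    using Cons.IH[of "m # m' # S"] Cons.prems that
    by (simp add: Un_assoc[symmetric]) (simp add: Un_left_commute Un_commute)
  show ?case
  proof (cases n)
    case (Cross x y z t)
    then show ?thesis
      using IH2[of "Joint z t" "Joint x y"] IH2[of "Joint y z" "Joint x t"]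
      by (simp add: insert_commute)
  qed (use IH[of n] in simp_all)
qed

lemma bracket_relabel: "inj_on f (labels D) \<Longrightarrow> bracket (map (map_node f) D) = bracket D"
  using bracket_from_relabel[of f "[]" D] by (simp add: bracket_def)

lemma bracket_from_loop:
  assumes "set S = insert (Joint b b) (set S')" "b \<notin> labels (S' @ D)"
  shows "bracket_from S D = (q_powi (-1) + q_powi 1) * bracket_from S' D"
  using assms
proof (induction D arbitrary: S S')
  case Nil
  then have S: "labels S = insert b (labels S')" "link_relation S = insert (b, b) (link_relation S')"
    by (auto simp: labels_def link_relation_def)
  have "card (components S) = Suc (card (components S'))"
    using Nil(2) link_relation_subset[of S']
    by (simp add: components_def S card_pieces_isolated)
  then show ?case by simp
next
  case (Cons n D)
  have IH: "bracket_from (m # S) D = (q_powi (-1) + q_powi 1) * bracket_from (m # S') D"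
    if "set (ends m) = set (ends n)" for m
    by (rule Cons.IH) (use Cons.prems that in auto)
  have IH2: "bracket_from (m # m' # S) D
      = (q_powi (-1) + q_powi 1) * bracket_from (m # m' # S') D"
    if "set (ends m) \<union> set (ends m') = set (ends n)" for m m'
    by (rule Cons.IH) (use Cons.prems that in auto)
  show ?case
  proof (cases n)
    case (Cross x y z t)
    then show ?thesis
      using IH2[of "Joint z t" "Joint x y"] IH2[of "Joint y z" "Joint x t"]
      by (simp add: insert_commute algebra_simps)
  qed (use IH[of n] in simp_all)
qed

lemma bracket_loop:
  "b \<notin> labels D \<Longrightarrow> bracket (Joint b b # D) = (q_powi (-1) + q_powi 1) * bracket D"
  using bracket_from_loop[of "[Joint b b]" b "[]" D] by (simp add: bracket_def)

lemma bracket_join: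
  assumes "y \<notin> labels D" "y \<noteq> x" "y \<noteq> z"
  shows "bracket (Joint x y # Joint y z # D) = bracket (Joint x z # D)"
proof -
  have "map (map_node (id(y := x))) D = D"
    by (rule map_map_node_id) (use assms in auto)
  then show ?thesis
    by (subst bracket_contract) (use assms in auto)
qed

section \<open>The bracket under the Reidemeister moves\<close>

text \<open>The A-smoothing splits off a circle and the B-smoothing leaves the arc, which gives the
  factor \<open>(q^-1 + q) - q = q^-1\<close>.\<close>

lemma bracket_R1:
  assumes "b \<notin> labels D" "b \<noteq> a" "b \<noteq> c"
  shows "bracket (Cross b b a c # D) = q_powi (-1) * bracket (Joint a c # D)"
proof -
  have "bracket (Joint b b # Joint a c # D) = (q_powi (-1) + q_powi 1) * bracket (Joint a c # D)"
    by (rule bracket_loop) (use assms in auto)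
  moreover have "bracket (Joint b c # Joint b a # D) = bracket (Joint a b # Joint b c # D)"
    by (rule bracket_rearrange) (simp add: insert_commute)
  moreover have "bracket (Joint a b # Joint b c # D) = bracket (Joint a c # D)"
    using assms by (rule bracket_join)
  ultimately show ?thesis
    by (simp add: bracket_skein algebra_simps)
qed

lemma q_powi_mult: "q_powi j * q_powi k = q_powi (j + k)"
  by (simp add: q_powi_def q_half_powi_def mult_single algebra_simps)

lemma q_powi_0: "q_powi 0 = 1"
  by (simp add: q_powi_def q_half_powi_def)

text \<open>Here the circle comes from the B-smoothing, which gives the factor
  \<open>1 - q (q^-1 + q) = -q^2\<close>.\<close>

lemma bracket_R1':
  assumes "b \<notin> labels D" "b \<noteq> a" "b \<noteq> c"
  shows "bracket (Cross a b b c # D) = - q_powi 2 * bracket (Joint a c # D)"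
proof -
  have "bracket (Joint b b # Joint a c # D) = (q_powi (-1) + q_powi 1) * bracket (Joint a c # D)"
    by (rule bracket_loop) (use assms in auto)
  moreover have "bracket (Joint a b # Joint b c # D) = bracket (Joint a c # D)"
    using assms by (rule bracket_join)
  moreover have "bracket (Joint a c # Joint b b # D) = bracket (Joint b b # Joint a c # D)"
    by (rule bracket_rearrange) simp
  moreover have "q_powi 1 * ((q_powi (-1) + q_powi 1) * P) = P + q_powi 2 * P" for P
    by (simp add: mult.assoc[symmetric] distrib_left distrib_right q_powi_mult q_powi_0)
  ultimately show ?thesis
    by (simp add: bracket_skein)
qed

lemma bracket_virtual_R1:
  assumes "b \<notin> labels D" "b \<noteq> a" "b \<noteq> c"
  shows "bracket (Virt b b a c # D) = bracket (Joint a c # D)"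
proof -
  have "bracket (Joint b a # Joint b c # D) = bracket (Joint a b # Joint b c # D)"
    by (rule bracket_rearrange) (simp add: insert_commute)
  with bracket_join[OF assms] show ?thesis
    by (simp add: bracket_Virt)
qed

lemma bracket_R2:
  assumes "e \<noteq> f" "{e, f} \<inter> ({a, b, c, d} \<union> labels D) = {}"
  shows "bracket (Cross b e f a # Cross f e d c # D) = - q_powi 1 * bracket (Joint a c # Joint b d # D)"
proof -
  \<comment> \<open>The letters name the smoothings of the first and of the second crossing.
    \<open>AB\<close> has the two strands running through; the other three states connect
    \<open>a\<close> with \<open>b\<close> and \<open>c\<close> with \<open>d\<close>, and
    \<open>BA\<close> has a circle in addition.\<close>
  define AA AB BA BB where
    "AA = bracket (Joint f e # Joint d c # Joint b e # Joint f a # D)" and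
    "AB = bracket (Joint f c # Joint e d # Joint b e # Joint f a # D)" and
    "BA = bracket (Joint f e # Joint d c # Joint b a # Joint e f # D)" and
    "BB = bracket (Joint f c # Joint e d # Joint b a # Joint e f # D)"
  have expand: "bracket (Cross b e f a # Cross f e d c # D) = AA - q_powi 1 * AB - q_powi 1 * (BA - q_powi 1 * BB)"
  proof -
    have "bracket (J # J' # Cross f e d c # D) = bracket (Cross f e d c # J # J' # D)" for J J'
      by (rule bracket_reorder) simp
    then show ?thesis
      by (simp add: bracket_skein AA_def AB_def BA_def BB_def)
  qed
  have "AA = bracket (Joint a f # Joint f e # Joint b e # Joint c d # D)"
    unfolding AA_def by (rule bracket_rearrange) (simp add: insert_commute)
  also have "\<dots> = bracket (Joint a e # Joint b e # Joint c d # D)"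
    by (rule bracket_join) (use assms in auto)
  also have "\<dots> = bracket (Joint a e # Joint e b # Joint c d # D)"
    by (rule bracket_rearrange) (simp add: insert_commute)
  also have "\<dots> = bracket (Joint a b # Joint c d # D)"
    by (rule bracket_join) (use assms in auto)
  finally have AA: "AA = bracket (Joint a b # Joint c d # D)" .
  have "AB = bracket (Joint a f # Joint f c # Joint b e # Joint e d # D)"
    unfolding AB_def by (rule bracket_rearrange) (simp add: insert_commute)
  also have "\<dots> = bracket (Joint a c # Joint b e # Joint e d # D)"
    by (rule bracket_join) (use assms in auto)
  also have "\<dots> = bracket (Joint b e # Joint e d # Joint a c # D)"
    by (rule bracket_reorder) simp
  also have "\<dots> = bracket (Joint b d # Joint a c # D)"
    by (rule bracket_join) (use assms in auto)
  also have "\<dots> = bracket (Joint a c # Joint b d # D)"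
    by (rule bracket_reorder) simp
  finally have AB: "AB = bracket (Joint a c # Joint b d # D)" .
  have "BA = bracket (Joint e f # Joint f e # Joint a b # Joint c d # D)"
    unfolding BA_def by (rule bracket_rearrange) (simp add: insert_commute)
  also have "\<dots> = bracket (Joint e e # Joint a b # Joint c d # D)"
    by (rule bracket_join) (use assms in auto)
  also have "\<dots> = (q_powi (-1) + q_powi 1) * AA"
    unfolding AA by (rule bracket_loop) (use assms in auto)
  finally have BA: "BA = (q_powi (-1) + q_powi 1) * AA" .
  have "BB = bracket (Joint c f # Joint f e # Joint e d # Joint a b # D)"
    unfolding BB_def by (rule bracket_rearrange) (simp add: insert_commute)
  also have "\<dots> = bracket (Joint c e # Joint e d # Joint a b # D)"
    by (rule bracket_join) (use assms in auto)
  also have "\<dots> = bracket (Joint c d # Joint a b # D)"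
    by (rule bracket_join) (use assms in auto)
  also have "\<dots> = AA"
    unfolding AA by (rule bracket_reorder) simp
  finally have BB: "BB = AA" .
  \<comment> \<open>The circle value is just such that the three turned-back states cancel:
    \<open>1 - q (q^-1 + q) + q^2 = 0\<close>.\<close>
  have "q_powi 1 * ((q_powi (-1) + q_powi 1) * AA) = AA + q_powi 1 * (q_powi 1 * AA)"
    by (simp add: mult.assoc[symmetric] distrib_left distrib_right q_powi_mult q_powi_0)
  then show ?thesis
    unfolding expand by (simp add: AB BA BB right_diff_distrib)
qed

lemma bracket_virtual_R2:
  assumes "e \<noteq> f" "{e, f} \<inter> ({a, b, c, d} \<union> labels D) = {}"
  shows "bracket (Virt a b e f # Virt f e d c # D) = bracket (Joint a c # Joint b d # D)"
proof -
  have "bracket (Virt a b e f # Virt f e d c # D)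
      = bracket (Virt f e d c # Joint a e # Joint b f # D)"
    by (subst bracket_Virt, rule bracket_reorder) simp
  also have "\<dots> = bracket (Joint a e # Joint e c # Joint b f # Joint f d # D)"
    unfolding bracket_Virt by (rule bracket_rearrange) (simp add: insert_commute)
  also have "\<dots> = bracket (Joint a c # Joint b f # Joint f d # D)"
    by (rule bracket_join) (use assms in auto)
  also have "\<dots> = bracket (Joint b f # Joint f d # Joint a c # D)"
    by (rule bracket_reorder) simp
  also have "\<dots> = bracket (Joint b d # Joint a c # D)"
    by (rule bracket_join) (use assms in auto)
  also have "\<dots> = bracket (Joint a c # Joint b d # D)"
    by (rule bracket_reorder) simp
  finally show ?thesis .
qed

lemma bracket_rename:
  assumes "x \<notin> labels D" "y \<notin> labels D"
    "set (ends n) \<union> set (ends m) \<subseteq> insert x (- {x, y})" "f = id(x := y)"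
  shows "bracket (n # m # D) = bracket (map_node f n # map_node f m # D)"
proof -
  have "inj_on f (labels (n # m # D))"
    using assms by (auto simp: inj_on_def)
  moreover have "map (map_node f) D = D"
    by (rule map_map_node_id) (use assms in auto)
  ultimately show ?thesis
    using bracket_relabel[of f "n # m # D"] by simp
qed

lemma bracket_contract_fresh:
  assumes "b \<notin> labels D" "a \<noteq> b" "b \<in> set (ends n) \<union> set (ends m)" "f = id(b := a)"
  shows "bracket (Joint a b # n # m # D) = bracket (map_node f n # map_node f m # D)"
proof -
  have "map (map_node f) D = D"
    by (rule map_map_node_id) (use assms in auto)
  moreover have "bracket (Joint a b # n # m # D) = bracket (map (map_node f) (n # m # D))"
    unfolding assms(4) by (rule bracket_contract) (use assms(2,3) in auto)
  ultimately show ?thesis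
    by simp
qed

text \<open>
  Smoothing the crossing of the strands 1 and 2 leaves either a tangle in which strand 3 passes
  both ends of the move in the same way, or a second Reidemeister move.
\<close>

lemma bracket_R3_slash:
  assumes xyz: "distinct [x, y, z]" "{x, y, z} \<inter> ({a1, a2, a3, b1, b2, b3} \<union> labels D) = {}"
    and uvw: "distinct [u, v, w]" "{u, v, w} \<inter> ({a1, a2, a3, b1, b2, b3} \<union> labels D) = {}"
  shows "bracket (slash a1 a2 x y # slash x a3 b3 z # slash y z b2 b1 # D)
    = bracket (slash a2 a3 u v # slash a1 v w b1 # slash w u b3 b2 # D)"
proof -
  \<comment> \<open>\<open>?cup\<close> is the outcome of the second Reidemeister move, including
    its factor. In \<open>?A\<close> the strands 1 and 2 no longer meet and strand 3 crosses both,
    with one internal edge between its crossings.\<close>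
  let ?cup = "- q_powi 1 * bracket (Joint a1 a2 # Joint a3 b1 # Joint b2 b3 # D)"
  let ?A = "\<lambda>z. bracket (Cross a3 b3 z a2 # Cross z b2 b1 a1 # D)"
  have "bracket (Joint a2 x # Joint y a1 # Cross a3 b3 z x # Cross z b2 b1 y # D)
      = bracket (Joint a2 x # Cross a3 b3 z x # Cross z b2 b1 y # Joint a1 y # D)"
    by (rule bracket_rearrange) (simp add: insert_commute)
  also have "\<dots> = bracket (Cross a3 b3 z a2 # Cross z b2 b1 y # Joint a1 y # D)"
    by (subst bracket_contract_fresh[where f = "id(x := a2)"]) (use xyz in auto)
  also have "\<dots> = bracket (Joint a1 y # Cross a3 b3 z a2 # Cross z b2 b1 y # D)"
    by (rule bracket_reorder) simp
  also have "\<dots> = ?A z"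
    by (subst bracket_contract_fresh[where f = "id(y := a1)"]) (use xyz in auto)
  finally have 1: "bracket (Joint a2 x # Joint y a1 # Cross a3 b3 z x # Cross z b2 b1 y # D) = ?A z" .
  have "bracket (Joint a2 a1 # Joint x y # Cross a3 b3 z x # Cross z b2 b1 y # D)
      = bracket (Joint x y # Cross a3 b3 z x # Cross z b2 b1 y # Joint a2 a1 # D)"
    by (rule bracket_reorder) simp
  also have "\<dots> = bracket (Cross a3 b3 z x # Cross z b2 b1 x # Joint a2 a1 # D)"
    by (subst bracket_contract_fresh[where f = "id(y := x)"]) (use xyz in auto)
  also have "\<dots> = bracket (Cross z x a3 b3 # Cross z b2 b1 x # Joint a2 a1 # D)"
    by (rule bracket_Cross_rotate)
  also have "\<dots> = bracket (Cross z b2 b1 x # Cross z x a3 b3 # Joint a2 a1 # D)"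
    by (rule bracket_reorder) simp
  also have "\<dots> = bracket (Cross b1 x z b2 # Cross z x a3 b3 # Joint a2 a1 # D)"
    by (rule bracket_Cross_rotate)
  also have "\<dots> = - q_powi 1 * bracket (Joint b2 b3 # Joint b1 a3 # Joint a2 a1 # D)"
    by (rule bracket_R2) (use xyz in auto)
  also have "\<dots> = ?cup"
    by (intro arg_cong2[of _ _ _ _ "(*)"] bracket_rearrange refl) (simp add: insert_commute)
  finally have 2: "bracket (Joint a2 a1 # Joint x y # Cross a3 b3 z x # Cross z b2 b1 y # D) = ?cup" .
  have "bracket (Joint u b3 # Joint b2 w # Cross a3 u v a2 # Cross v w b1 a1 # D)
      = bracket (Joint b3 u # Cross a3 u v a2 # Cross v w b1 a1 # Joint b2 w # D)"
    by (rule bracket_rearrange) (simp add: insert_commute)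
  also have "\<dots> = bracket (Cross a3 b3 v a2 # Cross v w b1 a1 # Joint b2 w # D)"
    by (subst bracket_contract_fresh[where f = "id(u := b3)"]) (use uvw in auto)
  also have "\<dots> = bracket (Joint b2 w # Cross a3 b3 v a2 # Cross v w b1 a1 # D)"
    by (rule bracket_reorder) simp
  also have "\<dots> = ?A v"
    by (subst bracket_contract_fresh[where f = "id(w := b2)"]) (use uvw in auto)
  \<comment> \<open>The two sides differ only in the name of the remaining internal edge.\<close>
  also have "\<dots> = ?A z"
    by (subst bracket_rename[where f = "id(v := z)" and x = v and y = z]) (use xyz uvw in auto)
  finally have 3: "bracket (Joint u b3 # Joint b2 w # Cross a3 u v a2 # Cross v w b1 a1 # D) = ?A z" .
  have "bracket (Joint u w # Joint b3 b2 # Cross a3 u v a2 # Cross v w b1 a1 # D)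
      = bracket (Joint u w # Cross a3 u v a2 # Cross v w b1 a1 # Joint b3 b2 # D)"
    by (rule bracket_reorder) simp
  also have "\<dots> = bracket (Cross a3 u v a2 # Cross v u b1 a1 # Joint b3 b2 # D)"
    by (subst bracket_contract_fresh[where f = "id(w := u)"]) (use uvw in auto)
  also have "\<dots> = - q_powi 1 * bracket (Joint a2 a1 # Joint a3 b1 # Joint b3 b2 # D)"
    by (rule bracket_R2) (use uvw in auto)
  also have "\<dots> = ?cup"
    by (intro arg_cong2[of _ _ _ _ "(*)"] bracket_rearrange refl) (simp add: insert_commute)
  finally have 4: "bracket (Joint u w # Joint b3 b2 # Cross a3 u v a2 # Cross v w b1 a1 # D) = ?cup" .
  have "bracket (slash a2 a3 u v # slash a1 v w b1 # slash w u b3 b2 # D)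
      = bracket (slash w u b3 b2 # slash a2 a3 u v # slash a1 v w b1 # D)"
    by (rule bracket_reorder) simp
  with 1 2 3 4 show ?thesis
    by (simp add: bracket_skein)
qed

text \<open>Compared with \<open>bracket_R3_slash\<close> the smoothings of the crossing of the
  strands 1 and 2 exchange their roles: now the A-smoothing leads to the second Reidemeister
  move.\<close>

lemma bracket_R3_backslash:
  assumes xyz: "distinct [x, y, z]" "{x, y, z} \<inter> ({a1, a2, a3, b1, b2, b3} \<union> labels D) = {}"
    and uvw: "distinct [u, v, w]" "{u, v, w} \<inter> ({a1, a2, a3, b1, b2, b3} \<union> labels D) = {}"
  shows "bracket (backslash a1 a2 x y # backslash x a3 b3 z # backslash y z b2 b1 # D)
    = bracket (backslash a2 a3 u v # backslash a1 v w b1 # backslash w u b3 b2 # D)"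
proof -
  let ?cup = "- q_powi 1 * bracket (Joint a1 a2 # Joint a3 b1 # Joint b2 b3 # D)"
  let ?A = "\<lambda>z. bracket (Cross a2 a3 b3 z # Cross a1 z b2 b1 # D)"
  have "bracket (Joint a1 y # Joint a2 x # Cross x a3 b3 z # Cross y z b2 b1 # D)
      = bracket (Joint a2 x # Cross x a3 b3 z # Cross y z b2 b1 # Joint a1 y # D)"
    by (rule bracket_reorder) simp
  also have "\<dots> = bracket (Cross a2 a3 b3 z # Cross y z b2 b1 # Joint a1 y # D)"
    by (subst bracket_contract_fresh[where f = "id(x := a2)"]) (use xyz in auto)
  also have "\<dots> = bracket (Joint a1 y # Cross a2 a3 b3 z # Cross y z b2 b1 # D)"
    by (rule bracket_reorder) simp
  also have "\<dots> = ?A z"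
    by (subst bracket_contract_fresh[where f = "id(y := a1)"]) (use xyz in auto)
  finally have 1: "bracket (Joint a1 y # Joint a2 x # Cross x a3 b3 z # Cross y z b2 b1 # D) = ?A z" .
  have "bracket (Joint a1 a2 # Joint x y # Cross x a3 b3 z # Cross y z b2 b1 # D)
      = bracket (Joint x y # Cross x a3 b3 z # Cross y z b2 b1 # Joint a1 a2 # D)"
    by (rule bracket_reorder) simp
  also have "\<dots> = bracket (Cross x a3 b3 z # Cross x z b2 b1 # Joint a1 a2 # D)"
    by (subst bracket_contract_fresh[where f = "id(y := x)"]) (use xyz in auto)
  also have "\<dots> = bracket (Cross b3 z x a3 # Cross x z b2 b1 # Joint a1 a2 # D)"
    by (rule bracket_Cross_rotate)
  also have "\<dots> = - q_powi 1 * bracket (Joint a3 b1 # Joint b3 b2 # Joint a1 a2 # D)"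
    by (rule bracket_R2) (use xyz in auto)
  also have "\<dots> = ?cup"
    by (intro arg_cong2[of _ _ _ _ "(*)"] bracket_rearrange refl) (simp add: insert_commute)
  finally have 2: "bracket (Joint a1 a2 # Joint x y # Cross x a3 b3 z # Cross y z b2 b1 # D) = ?cup" .
  have "bracket (Joint w b2 # Joint u b3 # Cross a2 a3 u v # Cross a1 v w b1 # D)
      = bracket (Joint b3 u # Cross a2 a3 u v # Cross a1 v w b1 # Joint b2 w # D)"
    by (rule bracket_rearrange) (simp add: insert_commute)
  also have "\<dots> = bracket (Cross a2 a3 b3 v # Cross a1 v w b1 # Joint b2 w # D)"
    by (subst bracket_contract_fresh[where f = "id(u := b3)"]) (use uvw in auto)
  also have "\<dots> = bracket (Joint b2 w # Cross a2 a3 b3 v # Cross a1 v w b1 # D)"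
    by (rule bracket_reorder) simp
  also have "\<dots> = ?A v"
    by (subst bracket_contract_fresh[where f = "id(w := b2)"]) (use uvw in auto)
  also have "\<dots> = ?A z"
    by (subst bracket_rename[where f = "id(v := z)" and x = v and y = z]) (use xyz uvw in auto)
  finally have 3: "bracket (Joint w b2 # Joint u b3 # Cross a2 a3 u v # Cross a1 v w b1 # D) = ?A z" .
  have "bracket (Joint w u # Joint b3 b2 # Cross a2 a3 u v # Cross a1 v w b1 # D)
      = bracket (Joint u w # Cross a2 a3 u v # Cross a1 v w b1 # Joint b3 b2 # D)"
    by (rule bracket_rearrange) (simp add: insert_commute)
  also have "\<dots> = bracket (Cross a2 a3 u v # Cross a1 v u b1 # Joint b3 b2 # D)"
    by (subst bracket_contract_fresh[where f = "id(w := u)"]) (use uvw in auto)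
  also have "\<dots> = bracket (Cross u v a2 a3 # Cross a1 v u b1 # Joint b3 b2 # D)"
    by (rule bracket_Cross_rotate)
  also have "\<dots> = bracket (Cross a1 v u b1 # Cross u v a2 a3 # Joint b3 b2 # D)"
    by (rule bracket_reorder) simp
  also have "\<dots> = - q_powi 1 * bracket (Joint b1 a3 # Joint a1 a2 # Joint b3 b2 # D)"
    by (rule bracket_R2) (use uvw in auto)
  also have "\<dots> = ?cup"
    by (intro arg_cong2[of _ _ _ _ "(*)"] bracket_rearrange refl) (simp add: insert_commute)
  finally have 4: "bracket (Joint w u # Joint b3 b2 # Cross a2 a3 u v # Cross a1 v w b1 # D) = ?cup" .
  have "bracket (backslash a2 a3 u v # backslash a1 v w b1 # backslash w u b3 b2 # D)
      = bracket (backslash w u b3 b2 # backslash a2 a3 u v # backslash a1 v w b1 # D)"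
    by (rule bracket_reorder) simp
  with 1 2 3 4 show ?thesis
    by (simp add: bracket_skein)
qed

section \<open>Orientations\<close>

text \<open>
  An oriented node is a node together with two flags that tell whether its first and its second
  strand run in at their first ends; a joint ignores the second flag.
\<close>

type_synonym 'e oriented_node = "'e node \<times> bool \<times> bool"

fun ins :: "'e oriented_node \<Rightarrow> 'e multiset" where
  "ins (Cross a b c d, u, v) = {#if u then a else c, if v then b else d#}"
| "ins (Virt a b c d, u, v) = {#if u then a else c, if v then b else d#}"
| "ins (Joint a b, u, v) = {#if u then a else b#}"

fun reverse_node :: "'e oriented_node \<Rightarrow> 'e oriented_node" where
  "reverse_node (n, u, v) = (n, \<not> u, \<not> v)"

definition outs :: "'e oriented_node \<Rightarrow> 'e multiset" where
  "outs e = ins (reverse_node e)"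

lemma outs_simps [simp]:
  "outs (Cross a b c d, u, v) = {#if u then c else a, if v then d else b#}"
  "outs (Virt a b c d, u, v) = {#if u then c else a, if v then d else b#}"
  "outs (Joint a b, u, v) = {#if u then b else a#}"
  by (auto simp: outs_def)

text \<open>The conservation law of a flow: each edge runs into nodes as often as it runs out of
  nodes. Both sides are sums over the nodes, so positions in the list do not matter.\<close>

definition balanced :: "'e oriented_node list \<Rightarrow> bool" where
  "balanced E \<longleftrightarrow> sum_list (map ins E) = sum_list (map outs E)"

fun enters :: "'e oriented_node \<Rightarrow> nat \<Rightarrow> bool" where
  "enters (Joint a b, u, v) s \<longleftrightarrow> (s = 0 \<longleftrightarrow> u)"
| "enters (n, u, v) s \<longleftrightarrow> (if s = 0 then u else if s = 1 then v else if s = 2 then \<not> u else \<not> v)"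

definition in_darts :: "nat oriented_node list \<Rightarrow> (nat \<times> nat) set" where
  "in_darts E = {(i, s). i < length E \<and> s < length (ends (fst (E ! i))) \<and> enters (E ! i) s}"

lemma enters_reverse_node:
  "s < length (ends (fst e)) \<Longrightarrow> enters (reverse_node e) s \<longleftrightarrow> \<not> enters e s"
  by (cases e rule: ins.cases) auto

lemma fst_reverse_node [simp]: "fst (reverse_node e) = fst e"
  by (cases e) simp

lemma in_darts_reverse: "in_darts (map reverse_node E) = darts (map fst E) - in_darts E"
  by (auto simp: in_darts_def darts_def enters_reverse_node)

lemma in_darts_subset: "in_darts E \<subseteq> darts (map fst E)"
  by (auto simp: in_darts_def darts_def)

lemma finite_darts [simp]: "finite (darts D)"
proof -
  have "darts D = (SIGMA i:{..<length D}. {..<length (ends (D ! i))})"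
    by (auto simp: darts_def)
  then show ?thesis by simp
qed

lemma finite_in_darts [simp]: "finite (in_darts E)"
  by (rule finite_subset[OF in_darts_subset]) simp

lemma less_2_cases_nat: "s < 2 \<longleftrightarrow> s = 0 \<or> s = (1 :: nat)"
  by (auto simp: less_Suc_eq numeral_2_eq_2)

lemma less_4_cases_nat: "s < 4 \<longleftrightarrow> s = 0 \<or> s = 1 \<or> s = 2 \<or> s = (3 :: nat)"
  by (auto simp: less_Suc_eq eval_nat_numeral)

lemma ins_eq_image:
  "ins e = image_mset (\<lambda>s. ends (fst e) ! s) (mset_set {s. s < length (ends (fst e)) \<and> enters e s})"
  using [[linarith_neq_limit = 9]]
proof (cases e rule: ins.cases)
  case (1 a b c d u v)
  then have "{s. s < length (ends (fst e)) \<and> enters e s} = {if u then 0 else 2, if v then 1 else 3}"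
    by (auto simp: less_4_cases_nat)
  then show ?thesis
    by (simp add: 1 eval_nat_numeral add_mset_commute)
next
  case (2 a b c d u v)
  then have "{s. s < length (ends (fst e)) \<and> enters e s} = {if u then 0 else 2, if v then 1 else 3}"
    by (auto simp: less_4_cases_nat)
  then show ?thesis
    by (simp add: 2 eval_nat_numeral add_mset_commute)
next
  case (3 a b u v)
  then have "{s. s < length (ends (fst e)) \<and> enters e s} = {if u then 0 else 1}"
    by (auto simp: less_Suc_eq)
  then show ?thesis
    by (simp add: 3)
qed

lemma in_darts_Cons:
  "in_darts (e # E) = Pair 0 ` {s. s < length (ends (fst e)) \<and> enters e s} \<union> map_prod Suc id ` in_darts E"
proof -
  have "(i, s) \<in> in_darts (e # E) \<longleftrightarrow> (i, s) \<in> Pair 0 ` {s. s < length (ends (fst e)) \<and> enters e s} \<union> map_prod Suc id ` in_darts E"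
    for i s
    by (cases i) (force simp: in_darts_def)+
  then show ?thesis by auto
qed

text \<open>This passes from positions to labels: the labels at the incoming darts, with
  multiplicity, are collected node by node.\<close>

lemma image_mset_in_darts:
  "image_mset (label_at (map fst E)) (mset_set (in_darts E)) = sum_list (map ins E)"
proof (induction E)
  case Nil
  then show ?case by (simp add: in_darts_def)
next
  case (Cons e E)
  let ?A = "{s. s < length (ends (fst e)) \<and> enters e s}"
  have "image_mset (label_at (map fst (e # E))) (mset_set (in_darts (e # E)))
      = image_mset (label_at (map fst (e # E))) (mset_set (Pair 0 ` ?A))
        + image_mset (label_at (map fst (e # E))) (mset_set (map_prod Suc id ` in_darts E))"
    unfolding in_darts_Cons by (subst mset_set_Union) auto
  also have "mset_set (Pair 0 ` ?A) = image_mset (Pair (0::nat)) (mset_set ?A)"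
    by (rule image_mset_mset_set[symmetric]) (simp add: inj_on_def)
  also have "mset_set (map_prod Suc id ` in_darts E) = image_mset (map_prod Suc id) (mset_set (in_darts E))"
    by (rule image_mset_mset_set[symmetric]) (auto simp: inj_on_def)
  also have "image_mset (label_at (map fst (e # E))) (image_mset (Pair 0) (mset_set ?A)) = ins e"
    unfolding ins_eq_image by (simp add: image_mset.compositionality comp_def label_at_def)
  also have "image_mset (label_at (map fst (e # E))) (image_mset (map_prod Suc id) (mset_set (in_darts E)))
      = image_mset (label_at (map fst E)) (mset_set (in_darts E))"
  proof -
    have "label_at (map fst (e # E)) (map_prod Suc id d) = label_at (map fst E) d" for d
      by (cases d) (simp add: label_at_def)
    then show ?thesis
      by (simp add: image_mset.compositionality comp_def)
  qed
  finally show ?case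
    by (simp add: Cons.IH)
qed

lemma image_mset_out_darts:
  "image_mset (label_at (map fst E)) (mset_set (darts (map fst E) - in_darts E)) = sum_list (map outs E)"
proof -
  have "map ins (map reverse_node E) = map outs E" "map fst (map reverse_node E) = map fst E"
    by (auto simp: outs_def)
  then show ?thesis
    using image_mset_in_darts[of "map reverse_node E"] unfolding in_darts_reverse by metis
qed

lemma mset_ends: "mset (ends (fst e)) = ins e + outs e"
  by (cases e rule: ins.cases) (auto simp: add_mset_commute)

lemma mset_concat_ends:
  "mset (concat (map ends (map fst E))) = sum_list (map ins E) + sum_list (map outs E)"
  by (induction E) (simp_all add: mset_ends)

lemma count_image_mset_set:
  "finite A \<Longrightarrow> count (image_mset f (mset_set A)) x = card {a \<in> A. f a = x}"
  by (simp add: count_image_mset' filter_mset_mset_set eq_commute[of x])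

lemma label_at_in_labels: "d \<in> darts D \<Longrightarrow> label_at D d \<in> labels D"
  unfolding darts_def label_at_def labels_def by (force simp: in_set_conv_nth)

text \<open>Each label lies at no dart or at exactly two, and exactly one of two darts is incoming
  if and only if as many are incoming as outgoing. The condition at the opposite ends of a strand is
  built into the flags.\<close>

lemma orientation_in_darts_iff:
  assumes "every_edge_has_two_ends (map fst E)"
  shows "orientation (map fst E) (in_darts E) \<longleftrightarrow> balanced E"
proof -
  let ?D = "map fst E" and ?I = "in_darts E"
  let ?X = "\<lambda>x. {d \<in> darts ?D. label_at ?D d = x}"
  have ins: "count (sum_list (map ins E)) x = card (?X x \<inter> ?I)" for x
  proof -
    have "{d \<in> ?I. label_at ?D d = x} = ?X x \<inter> ?I"
      using in_darts_subset[of E] by auto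
    then show ?thesis
      by (simp add: image_mset_in_darts[symmetric] count_image_mset_set)
  qed
  have outs: "count (sum_list (map outs E)) x = card (?X x - ?I)" for x
  proof -
    have "{d \<in> darts ?D - ?I. label_at ?D d = x} = ?X x - ?I"
      by auto
    then show ?thesis
      by (simp add: image_mset_out_darts[symmetric] count_image_mset_set)
  qed
  have "count_list (concat (map ends ?D)) x = card (?X x)" for x
  proof -
    have "count_list (concat (map ends ?D)) x = card (?X x \<inter> ?I) + card (?X x - ?I)"
      using arg_cong[OF mset_concat_ends[of E], of "\<lambda>M. count M x"]
      by (simp add: ins outs count_mset del: map_map)
    also have "\<dots> = card (?X x)"
      by (subst card_Un_disjoint[symmetric]) (auto intro: arg_cong[where f = card])
    finally show ?thesis .
  qed
  moreover have "?X x = {}" if "x \<notin> labels ?D" for x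
    using that label_at_in_labels by blast
  ultimately have X: "?X x = {} \<or> card (?X x) = 2" for x
    using assms unfolding every_edge_has_two_ends_def by (cases "x \<in> labels ?D") simp_all
  have "(\<forall>d\<in>darts ?D. \<forall>e\<in>darts ?D. d \<noteq> e \<and> label_at ?D d = label_at ?D e \<longrightarrow> (d \<in> ?I \<longleftrightarrow> e \<notin> ?I))
      \<longleftrightarrow> (\<forall>x. \<forall>d\<in>?X x. \<forall>e\<in>?X x. d \<noteq> e \<longrightarrow> (d \<in> ?I \<longleftrightarrow> e \<notin> ?I))"
    by auto
  also have "\<dots> \<longleftrightarrow> (\<forall>x. card (?X x \<inter> ?I) = card (?X x - ?I))"
  proof (rule all_cong1)
    fix x
    consider "?X x = {}" | d e where "?X x = {d, e}" "d \<noteq> e"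
      using X[of x] by (auto simp: card_2_iff)
    then show "(\<forall>d\<in>?X x. \<forall>e\<in>?X x. d \<noteq> e \<longrightarrow> (d \<in> ?I \<longleftrightarrow> e \<notin> ?I))
      \<longleftrightarrow> card (?X x \<inter> ?I) = card (?X x - ?I)"
    proof cases
      case 1
      then show ?thesis by (simp only: 1) simp
    next
      case 2
      show ?thesis
        unfolding 2(1) using 2(2) by (cases "d \<in> ?I"; cases "e \<in> ?I") (auto simp: insert_Diff_if)
    qed
  qed
  also have "\<dots> \<longleftrightarrow> balanced E"
    by (simp add: balanced_def multiset_eq_iff ins outs)
  finally have edges: "(\<forall>d\<in>darts ?D. \<forall>e\<in>darts ?D.
      d \<noteq> e \<and> label_at ?D d = label_at ?D e \<longrightarrow> (d \<in> ?I \<longleftrightarrow> e \<notin> ?I)) \<longleftrightarrow> balanced E" .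
  have "\<forall>i<length ?D. \<forall>s<length (ends (?D ! i)) div 2.
      (i, s) \<in> ?I \<longleftrightarrow> (i, s + length (ends (?D ! i)) div 2) \<notin> ?I"
  proof (intro allI impI)
    fix i s assume i: "i < length ?D" and s: "s < length (ends (?D ! i)) div 2"
    then show "(i, s) \<in> ?I \<longleftrightarrow> (i, s + length (ends (?D ! i)) div 2) \<notin> ?I"
      by (cases "E ! i" rule: ins.cases) (auto simp: in_darts_def less_Suc_eq)
  qed
  then show ?thesis
    using edges in_darts_subset[of E] by (simp add: orientation_def)
qed

text \<open>The flags are read off at the ends 0 and 1; the ends opposite to them are then
  determined. At a joint the second flag has an arbitrary value that is ignored.\<close>

lemma orientation_eq_in_darts:
  assumes "orientation D I"
  obtains E where "map fst E = D" "I = in_darts E"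
proof
  let ?E = "map (\<lambda>i. (D ! i, (i, 0) \<in> I, (i, 1) \<in> I)) [0..<length D]"
  show "map fst ?E = D"
    by (simp add: comp_def map_nth)
  have "(i, s) \<in> I \<longleftrightarrow> enters (D ! i, (i, 0) \<in> I, (i, 1) \<in> I) s"
    if "i < length D" "s < length (ends (D ! i))" for i s
  proof -
    have flip: "(i, t) \<in> I \<longleftrightarrow> (i, t + length (ends (D ! i)) div 2) \<notin> I"
      if "t < length (ends (D ! i)) div 2" for t
      using assms that \<open>i < length D\<close> unfolding orientation_def by blast
    have four: "(i, s) \<in> I \<longleftrightarrow> (if s = 0 then (i, 0) \<in> I else if s = 1 then (i, 1) \<in> I
        else if s = 2 then (i, 0) \<notin> I else (i, 1) \<notin> I)" if "length (ends (D ! i)) = 4" "s < 4" for s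
    proof -
      have half: "length (ends (D ! i)) div 2 = 2"
        using that(1) by simp
      have "(i, 0) \<in> I \<longleftrightarrow> (i, 2) \<notin> I" "(i, 1) \<in> I \<longleftrightarrow> (i, 3) \<notin> I"
        using flip[of 0, unfolded half] flip[of 1, unfolded half]
        by (simp_all add: numeral_2_eq_2 numeral_3_eq_3)
      then show ?thesis
        using that(2) unfolding less_4_cases_nat by auto
    qed
    have two: "(i, s) \<in> I \<longleftrightarrow> (if s = 0 then (i, 0) \<in> I else (i, 0) \<notin> I)"
      if "length (ends (D ! i)) = 2" "s < 2" for s
    proof -
      have "(i, 0) \<in> I \<longleftrightarrow> (i, 1) \<notin> I"
        using flip[of 0] that(1) by simp
      then show ?thesis
        using that(2) unfolding less_2_cases_nat by auto
    qed
    show ?thesis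
    proof (cases "D ! i")
      case (Cross a b c d)
      then have "length (ends (D ! i)) = 4" by simp
      with that(2) four[of s] Cross show ?thesis by simp
    next
      case (Virt a b c d)
      then have "length (ends (D ! i)) = 4" by simp
      with that(2) four[of s] Virt show ?thesis by simp
    next
      case (Joint a b)
      then have "length (ends (D ! i)) = 2" by simp
      with that(2) two[of s] Joint show ?thesis by auto
    qed
  qed
  moreover have "I \<subseteq> darts D"
    using assms by (simp add: orientation_def)
  ultimately show "I = in_darts ?E"
    by (auto simp: in_darts_def darts_def)
qed

section \<open>Existence of orientations\<close>

text \<open>Two arcs that share an end can be merged to one, so Eulerian orientations exist.\<close>

lemma eulerian_orientation:
  assumes "\<And>x. even (count (mset (map fst ps) + mset (map snd ps)) x)"
  shows "\<exists>qs. list_all2 (\<lambda>p q. q = p \<or> q = prod.swap p) ps qs \<and> mset (map fst qs) = mset (map snd qs)"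
  using assms
proof (induction "length ps" arbitrary: ps rule: less_induct)
  case less
  show ?case
  proof (cases ps)
    case Nil
    then show ?thesis by simp
  next
    case (Cons p ps')
    obtain a b where p: "p = (a, b)" by fastforce
    show ?thesis
    proof (cases "a = b")
      case True
      then have "even (count (mset (map fst ps') + mset (map snd ps')) x)" for x
        using less.prems[of x] by (auto simp: Cons p split: if_splits)
      then obtain qs where "list_all2 (\<lambda>p q. q = p \<or> q = prod.swap p) ps' qs"
        "mset (map fst qs) = mset (map snd qs)"
        using less.hyps[of ps'] by (auto simp: Cons)
      then show ?thesis
        using True by (intro exI[of _ "(a, b) # qs"]) (simp add: Cons p)
    next
      case False
      define M where "M = mset (map fst ps') + mset (map snd ps')"
      have "mset (map fst ps) + mset (map snd ps) = add_mset a (add_mset b M)"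
        by (simp add: Cons p M_def)
      then have "odd (count M b)"
        using less.prems[of b] False by (simp del: mset_map)
      then have "b \<in># M"
        by (metis even_zero not_in_iff)
      then obtain q where q: "q \<in> set ps'" "fst q = b \<or> snd q = b"
        by (auto simp: M_def)
      then obtain ps1 ps2 where ps': "ps' = ps1 @ q # ps2"
        by (meson split_list)
      obtain c where c: "q = (b, c) \<or> q = (c, b)"
        using q(2) by (cases q) auto
      \<comment> \<open>The arcs between \<open>a\<close> and \<open>b\<close> and between
        \<open>b\<close> and \<open>c\<close> are merged to one arc between \<open>a\<close> and
        \<open>c\<close>; this lowers the number of ends at \<open>b\<close> by two and keeps all
        others.\<close>
      let ?ps = "(a, c) # ps1 @ ps2"
      have "even (count (mset (map fst ?ps) + mset (map snd ?ps)) x)" for x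
      proof -
        define R where "R = mset (map fst (ps1 @ ps2)) + mset (map snd (ps1 @ ps2))"
        have "mset (map fst ps) + mset (map snd ps) = {#b, b#} + (add_mset a (add_mset c R))"
          using c by (elim disjE) (simp_all add: Cons p ps' R_def add_mset_commute)
        moreover have "mset (map fst ?ps) + mset (map snd ?ps) = add_mset a (add_mset c R)"
          by (simp add: R_def)
        moreover have "even (count ({#b, b#} + N) x) \<longleftrightarrow> even (count N x)" for N
          by simp
        ultimately show ?thesis
          using less.prems[of x] by metis
      qed
      moreover have "length ?ps < length ps"
        by (simp add: Cons ps')
      ultimately obtain qs where qs: "list_all2 (\<lambda>p q. q = p \<or> q = prod.swap p) ?ps qs"
        "mset (map fst qs) = mset (map snd qs)"
        using less.hyps[of ?ps] by blast
      then obtain r qs1 qs2 where r: "qs = r # qs1 @ qs2" "r = (a, c) \<or> r = (c, a)"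
        "list_all2 (\<lambda>p q. q = p \<or> q = prod.swap p) ps1 qs1"
        "list_all2 (\<lambda>p q. q = p \<or> q = prod.swap p) ps2 qs2"
        by (auto simp: list_all2_Cons1 list_all2_append1)
      \<comment> \<open>The merged arc is cut at \<open>b\<close> again, and both halves inherit its
        direction, so \<open>b\<close> is entered once and left once.\<close>
      define r1 r2 where "r1 = (if r = (a, c) then (a, b) else (b, a))"
        and "r2 = (if r = (a, c) then (b, c) else (c, b))"
      have "list_all2 (\<lambda>p q. q = p \<or> q = prod.swap p) ps (r1 # qs1 @ r2 # qs2)"
        using r(3,4) c by (auto simp: Cons p ps' r1_def r2_def intro!: list_all2_appendI)
      moreover have "mset (map fst (r1 # qs1 @ r2 # qs2)) = mset (map snd (r1 # qs1 @ r2 # qs2))"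
        using qs(2) r(1,2) by (auto simp: r1_def r2_def add_mset_commute)
      ultimately show ?thesis by blast
    qed
  qed
qed

text \<open>A list in place of the set \<open>strands\<close>, since the two strands of a node can
  be the same pair of labels and still count twice.\<close>

fun arcs :: "'e node \<Rightarrow> ('e \<times> 'e) list" where
  "arcs (Cross a b c d) = [(a, c), (b, d)]"
| "arcs (Virt a b c d) = [(a, c), (b, d)]"
| "arcs (Joint a b) = [(a, b)]"

lemma orient_arcs:
  assumes "list_all2 (\<lambda>p q. q = p \<or> q = prod.swap p) (concat (map arcs D)) qs"
  shows "\<exists>E. map fst E = D \<and> sum_list (map ins E) = mset (map fst qs)
    \<and> sum_list (map outs E) = mset (map snd qs)"
  using assms
proof (induction D arbitrary: qs)
  case (Cons n D)
  then obtain rs qs' where qs: "qs = rs @ qs'"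
    and rs: "list_all2 (\<lambda>p q. q = p \<or> q = prod.swap p) (arcs n) rs"
    and "list_all2 (\<lambda>p q. q = p \<or> q = prod.swap p) (concat (map arcs D)) qs'"
    by (auto simp: list_all2_append1)
  with Cons.IH obtain E where E: "map fst E = D" "sum_list (map ins E) = mset (map fst qs')"
    "sum_list (map outs E) = mset (map snd qs')"
    by blast
  have "\<exists>e. fst e = n \<and> ins e = mset (map fst rs) \<and> outs e = mset (map snd rs)"
  proof (cases n)
    case (Cross a b c d)
    with rs obtain p q where rs: "rs = [p, q]" "p = (a, c) \<or> p = (c, a)" "q = (b, d) \<or> q = (d, b)"
      by (auto simp: list_all2_Cons1)
    show ?thesis
      using rs(2,3) by (intro exI[of _ "(n, p = (a, c), q = (b, d))"]) (auto simp: Cross rs(1))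
  next
    case (Virt a b c d)
    with rs obtain p q where rs: "rs = [p, q]" "p = (a, c) \<or> p = (c, a)" "q = (b, d) \<or> q = (d, b)"
      by (auto simp: list_all2_Cons1)
    show ?thesis
      using rs(2,3) by (intro exI[of _ "(n, p = (a, c), q = (b, d))"]) (auto simp: Virt rs(1))
  next
    case (Joint a b)
    with rs obtain p where rs: "rs = [p]" "p = (a, b) \<or> p = (b, a)"
      by (auto simp: list_all2_Cons1)
    show ?thesis
      using rs(2) by (intro exI[of _ "(n, p = (a, b), True)"]) (auto simp: Joint rs(1))
  qed
  then obtain e where "fst e = n" "ins e = mset (map fst rs)" "outs e = mset (map snd rs)"
    by blast
  then show ?case
    using E by (intro exI[of _ "e # E"]) (simp add: qs)
qed simp

lemma balanced_exists:
  assumes "every_edge_has_two_ends D"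
  obtains E where "map fst E = D" "balanced E"
proof -
  have arcs: "mset (ends n) = mset (map fst (arcs n)) + mset (map snd (arcs n))" for n :: "nat node"
    by (cases n) auto
  have ends: "mset (concat (map ends D)) = mset (map fst (concat (map arcs D))) + mset (map snd (concat (map arcs D)))"
    by (induction D) (simp_all add: arcs)
  have "even (count (mset (map fst (concat (map arcs D))) + mset (map snd (concat (map arcs D)))) x)" for x
  proof (cases "x \<in> labels D")
    case True
    then show ?thesis
      using assms unfolding ends[symmetric] by (simp add: every_edge_has_two_ends_def count_mset)
  next
    case False
    then have "x \<notin># mset (concat (map ends D))"
      by (simp add: labels_def)
    then show ?thesis
      unfolding ends[symmetric] by (simp only: not_in_iff even_zero)
  qed
  then obtain qs where "list_all2 (\<lambda>p q. q = p \<or> q = prod.swap p) (concat (map arcs D)) qs"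
    "mset (map fst qs) = mset (map snd qs)"
    using eulerian_orientation by blast
  with orient_arcs[of D qs] that show ?thesis
    by (auto simp: balanced_def)
qed

section \<open>Crossing types\<close>

text \<open>End 3 is entered if and only if the second flag is false, so equal flags mean a negative
  crossing. The colouring stands for \<open>component_of\<close>; it is a parameter because
  components of a diagram cannot be seen in a tangle alone.\<close>

fun crossing_type :: "('e \<Rightarrow> 'c) \<Rightarrow> 'e oriented_node \<Rightarrow> ('c set \<times> int) multiset" where
  "crossing_type c (Cross x y z t, u, v) = {#({c x, c y}, if u = v then -1 else 1)#}"
| "crossing_type c _ = {#}"

definition crossing_types :: "diagram \<Rightarrow> (nat \<times> nat) set \<Rightarrow> (nat set set \<times> int) multiset" where
  "crossing_types D I = image_mset (\<lambda>i. (components_at D i, crossing_sign I i)) (mset_set (classical D))"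

lemma classical_Cons:
  "classical (n # D) = (if \<exists>a b c d. n = Cross a b c d then {0} else {}) \<union> Suc ` classical D"
proof -
  have "i \<in> classical (n # D)
      \<longleftrightarrow> i \<in> (if \<exists>a b c d. n = Cross a b c d then {0} else {}) \<union> Suc ` classical D" for i
    by (cases i) (auto simp: classical_def)
  then show ?thesis by blast
qed

lemma finite_classical [simp]: "finite (classical D)"
  by (simp add: classical_def)

lemma sum_list_crossing_type:
  "image_mset (\<lambda>i. (c ` {label_at (map fst E) (i, 0), label_at (map fst E) (i, 1)},
      crossing_sign (in_darts E) i)) (mset_set (classical (map fst E)))
    = sum_list (map (crossing_type c) E)"
proof (induction E)
  case Nil
  then show ?case by (simp add: classical_def)
next
  case (Cons e E)
  let ?f = "\<lambda>E i. (c ` {label_at (map fst E) (i, 0), label_at (map fst E) (i, 1)},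
      crossing_sign (in_darts E) i)"
  let ?A = "if \<exists>a b c d. fst e = Cross a b c d then {0} else {}"
  have "image_mset (?f (e # E)) (mset_set (classical (map fst (e # E))))
      = image_mset (?f (e # E)) (mset_set ?A) + image_mset (?f (e # E)) (mset_set (Suc ` classical (map fst E)))"
    unfolding list.map classical_Cons by (subst mset_set_Union) auto
  also have "mset_set (Suc ` classical (map fst E)) = image_mset Suc (mset_set (classical (map fst E)))"
    by (rule image_mset_mset_set[symmetric]) simp
  also have "image_mset (?f (e # E)) (image_mset Suc (mset_set (classical (map fst E))))
      = image_mset (?f E) (mset_set (classical (map fst E)))"
  proof -
    have "(Suc i, s) \<in> in_darts (e # E) \<longleftrightarrow> (i, s) \<in> in_darts E" for i s
      by (simp add: in_darts_def)
    then have "?f (e # E) (Suc i) = ?f E i" for i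
      by (simp add: label_at_def crossing_sign_def)
    then show ?thesis
      by (simp add: image_mset.compositionality comp_def)
  qed
  also have "image_mset (?f (e # E)) (mset_set ?A) = crossing_type c e"
    by (cases e rule: ins.cases) (auto simp: label_at_def crossing_sign_def in_darts_def)
  finally show ?case
    by (simp only: Cons.IH list.map sum_list.Cons)
qed

lemma crossing_types_in_darts:
  "crossing_types (map fst E) (in_darts E)
    = sum_list (map (crossing_type (component_of (map fst E))) E)"
  unfolding sum_list_crossing_type[symmetric] crossing_types_def components_at_def by simp

section \<open>Reidemeister moves\<close>

text \<open>Strand 3 has only virtual crossings and dissolves into arcs. Both sides become the node
  \<open>N a1 a2 b3 b2\<close> together with an arc from \<open>a3\<close> to \<open>b1\<close>,
  whatever kind of crossing \<open>N\<close> is.\<close>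

lemma bracket_R3_virtual:
  fixes N :: "nat \<Rightarrow> nat \<Rightarrow> nat \<Rightarrow> nat \<Rightarrow> nat node"
  assumes N: "\<And>f a b c d. map_node f (N a b c d) = N (f a) (f b) (f c) (f d)"
    "\<And>a b c d. set (ends (N a b c d)) = {a, b, c, d}"
    and xyz: "distinct [x, y, z]" "{x, y, z} \<inter> ({a1, a2, a3, b1, b2, b3} \<union> labels D) = {}"
    and uvw: "distinct [u, v, w]" "{u, v, w} \<inter> ({a1, a2, a3, b1, b2, b3} \<union> labels D) = {}"
  shows "bracket (N a1 a2 x y # Virt x a3 b3 z # Virt y z b2 b1 # D)
    = bracket (Virt a2 a3 u v # Virt a1 v w b1 # N w u b3 b2 # D)"
proof -
  have "bracket (N a1 a2 x y # Virt x a3 b3 z # Virt y z b2 b1 # D)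
      = bracket (Virt y z b2 b1 # Virt x a3 b3 z # N a1 a2 x y # D)"
    by (rule bracket_reorder) simp
  also have "\<dots> = bracket (Virt x a3 b3 z # Joint y b2 # Joint z b1 # N a1 a2 x y # D)"
    by (subst bracket_Virt, rule bracket_reorder) simp
  also have "\<dots> = bracket (Joint x b3 # Joint a3 z # Joint y b2 # Joint z b1 # N a1 a2 x y # D)"
    by (rule bracket_Virt)
  also have "\<dots> = bracket (Joint a3 z # Joint z b1 # Joint x b3 # Joint y b2 # N a1 a2 x y # D)"
    by (rule bracket_reorder) simp
  also have "\<dots> = bracket (Joint a3 b1 # Joint x b3 # Joint y b2 # N a1 a2 x y # D)"
    by (rule bracket_join) (use xyz N in auto)
  also have "\<dots> = bracket (Joint b3 x # Joint y b2 # N a1 a2 x y # Joint a3 b1 # D)"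
    by (rule bracket_rearrange) (simp add: insert_commute)
  also have "\<dots> = bracket (Joint y b2 # N a1 a2 b3 y # Joint a3 b1 # D)"
    by (subst bracket_contract_fresh[where f = "id(x := b3)"]) (use xyz N in auto)
  also have "\<dots> = bracket (Joint b2 y # N a1 a2 b3 y # Joint a3 b1 # D)"
    by (rule bracket_rearrange) (simp add: insert_commute)
  also have "\<dots> = bracket (N a1 a2 b3 b2 # Joint a3 b1 # D)"
    by (subst bracket_contract_fresh[where f = "id(y := b2)"]) (use xyz N in auto)
  finally have left: "bracket (N a1 a2 x y # Virt x a3 b3 z # Virt y z b2 b1 # D)
      = bracket (N a1 a2 b3 b2 # Joint a3 b1 # D)" .
  have "bracket (Virt a2 a3 u v # Virt a1 v w b1 # N w u b3 b2 # D)
      = bracket (Virt a1 v w b1 # Joint a2 u # Joint a3 v # N w u b3 b2 # D)"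
    by (subst bracket_Virt, rule bracket_reorder) simp
  also have "\<dots> = bracket (Joint a1 w # Joint v b1 # Joint a2 u # Joint a3 v # N w u b3 b2 # D)"
    by (rule bracket_Virt)
  also have "\<dots> = bracket (Joint a3 v # Joint v b1 # Joint a1 w # Joint a2 u # N w u b3 b2 # D)"
    by (rule bracket_reorder) simp
  also have "\<dots> = bracket (Joint a3 b1 # Joint a1 w # Joint a2 u # N w u b3 b2 # D)"
    by (rule bracket_join) (use uvw N in auto)
  also have "\<dots> = bracket (Joint a1 w # Joint a2 u # N w u b3 b2 # Joint a3 b1 # D)"
    by (rule bracket_reorder) simp
  also have "\<dots> = bracket (Joint a2 u # N a1 u b3 b2 # Joint a3 b1 # D)"
    by (subst bracket_contract_fresh[where f = "id(w := a1)"]) (use uvw N in auto)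
  also have "\<dots> = bracket (N a1 a2 b3 b2 # Joint a3 b1 # D)"
    by (subst bracket_contract_fresh[where f = "id(u := a2)"]) (use uvw N in auto)
  finally show ?thesis
    by (simp only: left)
qed

lemma bracket_R3:
  assumes X: "(X12, X13, X23) \<in> {(slash, slash, slash), (backslash, backslash, backslash),
      (Virt, Virt, Virt), (slash, Virt, Virt), (backslash, Virt, Virt)}"
    and xyz: "distinct [x, y, z]" "{x, y, z} \<inter> ({a1, a2, a3, b1, b2, b3} \<union> labels D) = {}"
    and uvw: "distinct [u, v, w]" "{u, v, w} \<inter> ({a1, a2, a3, b1, b2, b3} \<union> labels D) = {}"
  shows "bracket (X12 a1 a2 x y # X13 x a3 b3 z # X23 y z b2 b1 # D)
    = bracket (X23 a2 a3 u v # X13 a1 v w b1 # X12 w u b3 b2 # D)"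
proof -
  have "bracket (N a1 a2 x y # Virt x a3 b3 z # Virt y z b2 b1 # D)
      = bracket (Virt a2 a3 u v # Virt a1 v w b1 # N w u b3 b2 # D)"
    if "N \<in> {slash, backslash, Virt}" for N :: "nat \<Rightarrow> nat \<Rightarrow> nat \<Rightarrow> nat \<Rightarrow> nat node"
    by (rule bracket_R3_virtual[OF _ _ xyz uvw]) (use that in auto)
  then show ?thesis
    using X bracket_R3_slash[OF xyz uvw] bracket_R3_backslash[OF xyz uvw] by fastforce
qed

section \<open>Equivalences of the graphs of tangles\<close>

lemma connectivity_sym_cong: "R \<union> R\<inverse> = S \<union> S\<inverse> \<Longrightarrow> connectivity R = connectivity S"
  by (simp add: connectivity_def)

lemma connectivity_edge_sym_cong:
  "R \<union> R\<inverse> = S \<union> S\<inverse> \<Longrightarrow> (x, y) \<in> R \<Longrightarrow> (x, y) \<in> S \<or> (y, x) \<in> S"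
  by auto

lemma graph_equivalence_sym_cong:
  assumes "graph_equivalence f g V R V' R'" "R \<union> R\<inverse> = S \<union> S\<inverse>" "R' \<union> R'\<inverse> = S' \<union> S'\<inverse>"
  shows "graph_equivalence f g V S V' S'"
proof -
  have "(f x, f y) \<in> connectivity R'" if "(x, y) \<in> S" for x y
    using connectivity_edge_sym_cong[OF assms(2)[symmetric] that] assms(1) connectivity_sym
    unfolding graph_equivalence_def by fast
  moreover have "(g x, g y) \<in> connectivity R" if "(x, y) \<in> S'" for x y
    using connectivity_edge_sym_cong[OF assms(3)[symmetric] that] assms(1) connectivity_sym
    unfolding graph_equivalence_def by fast
  ultimately show ?thesis
    using assms(1) unfolding graph_equivalence_def
      connectivity_sym_cong[OF assms(2)] connectivity_sym_cong[OF assms(3)]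
    by blast
qed

lemma graph_equivalence_id:
  assumes "R \<union> R\<inverse> = S \<union> S\<inverse>"
  shows "graph_equivalence id id V R V S"
proof (rule graph_equivalence_sym_cong[OF _ refl assms])
  show "graph_equivalence id id V R V R"
    by (auto simp: graph_equivalence_def connectivity_edge)
qed

text \<open>Both maps move internal labels only, so an equivalence of tangles extends by the
  identity over the rest of the diagram.\<close>

lemma graph_equivalence_append:
  assumes "graph_equivalence f g (labels T) (link_relation T) (labels T') (link_relation T')"
    and "\<And>x. x \<in> labels D \<Longrightarrow> f x = x \<and> g x = x"
  shows "graph_equivalence f g (labels (T @ D)) (link_relation (T @ D))
    (labels (T' @ D)) (link_relation (T' @ D))"
proof -
  have mono: "connectivity (link_relation S) \<subseteq> connectivity (link_relation (S @ D))" for S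
    by (rule connectivity_mono) auto
  have edge: "(x, y) \<in> connectivity (link_relation (S @ D)) \<and> f x = x \<and> f y = y \<and> g x = x \<and> g y = y"
    if "(x, y) \<in> link_relation D" for x y S
    using that link_relation_subset[of D] assms(2) by (auto intro: connectivity_edge)
  show ?thesis
    using assms mono[of T] mono[of T'] edge[of _ _ T] edge[of _ _ T']
    unfolding graph_equivalence_def labels_append link_relation_append by fastforce
qed

section \<open>Transport of flags and crossing types along local moves\<close>

text \<open>The factors are those of \<open>bracket_R1\<close>, \<open>bracket_R1'\<close> and
  \<open>bracket_R2\<close>. In \<open>remove_pair\<close> the two components may coincide, so that
  the second move is treated alike within one component and between two.\<close>

inductive reidemeister_change ::
  "('c set \<times> int) multiset \<Rightarrow> laurent \<Rightarrow> ('c set \<times> int) multiset \<Rightarrow> laurent \<Rightarrow> bool" where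
  no_change: "reidemeister_change X P X P"
| remove_positive: "reidemeister_change (add_mset ({k}, 1) X) (q_powi (-1) * P) X P"
| remove_negative: "reidemeister_change (add_mset ({k}, -1) X) (- (q_powi 2 * P)) X P"
| remove_pair: "reidemeister_change (add_mset ({k, k'}, 1) (add_mset ({k, k'}, -1) X)) (- (q_powi 1 * P)) X P"

lemma reidemeister_change_add:
  "reidemeister_change X P Y Q \<Longrightarrow> reidemeister_change (X + Z) P (Y + Z) Q"
  by (induction rule: reidemeister_change.induct) (auto intro: reidemeister_change.intros)

definition crossing_types_by :: "('e \<Rightarrow> 'c) \<Rightarrow> 'e oriented_node list \<Rightarrow> ('c set \<times> int) multiset" where
  "crossing_types_by c E = sum_list (map (crossing_type c) E)"

text \<open>
  Colourings that are constant on the components of the new diagram are pulled back along the map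
  of the edges, so crossing types can be compared although internal edges have changed.
\<close>

definition transported ::
  "(nat \<Rightarrow> nat) \<Rightarrow> nat oriented_node list \<Rightarrow> laurent \<Rightarrow> nat oriented_node list \<Rightarrow> laurent \<Rightarrow> bool" where
  "transported f E P E' P' \<longleftrightarrow>
     (\<forall>c :: nat \<Rightarrow> nat set. (\<forall>(x, y)\<in>link_relation (map fst E'). c x = c y) \<longrightarrow>
       reidemeister_change (crossing_types_by (c \<circ> f) E) P (crossing_types_by c E') P')"

definition equivalent_oriented :: "nat oriented_node list \<Rightarrow> nat oriented_node list \<Rightarrow> bool" where
  "equivalent_oriented E E' \<longleftrightarrow> (\<exists>f g.
     graph_equivalence f g (labels (map fst E)) (link_relation (map fst E))
       (labels (map fst E')) (link_relation (map fst E')) \<and>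
     transported f E (bracket (map fst E)) E' (bracket (map fst E')))"

lemma crossing_types_by_append [simp]:
  "crossing_types_by c (E @ E') = crossing_types_by c E + crossing_types_by c E'"
  by (simp add: crossing_types_by_def)

lemma set_ins_subset: "set_mset (ins e) \<subseteq> set (ends (fst e))"
  by (cases e rule: ins.cases) auto

lemma set_outs_subset: "set_mset (outs e) \<subseteq> set (ends (fst e))"
  using set_ins_subset[of "reverse_node e"] by (simp add: outs_def)

lemma crossing_type_cong:
  "(\<And>x. x \<in> set (ends (fst e)) \<Longrightarrow> c x = c' x) \<Longrightarrow> crossing_type c e = crossing_type c' e"
  by (cases e rule: ins.cases) auto

lemma crossing_types_by_cong:
  "(\<And>x. x \<in> labels (map fst E) \<Longrightarrow> c x = c' x) \<Longrightarrow> crossing_types_by c E = crossing_types_by c' E"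
  unfolding crossing_types_by_def
  by (intro arg_cong[of _ _ sum_list] map_cong refl crossing_type_cong) (auto simp: labels_def)

text \<open>An edge without ends outside the tangle is already balanced inside. This is what
  determines the relations between the flags of the crossings that a move involves.\<close>

lemma balanced_internal:
  assumes "balanced (E @ E')" "x \<notin> labels (map fst E')"
  shows "count (sum_list (map ins E)) x = count (sum_list (map outs E)) x"
proof -
  have "count (sum_list (map ins E')) x = 0 \<and> count (sum_list (map outs E')) x = 0"
    using assms(2)
  proof (induction E')
    case (Cons e E')
    then have "x \<notin># ins e" "x \<notin># outs e"
      using set_ins_subset[of e] set_outs_subset[of e] by auto
    with Cons show ?case
      by (simp add: not_in_iff)
  qed simp
  then show ?thesis
    using arg_cong[OF assms(1)[unfolded balanced_def], of "\<lambda>M. count M x"] by simp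
qed

text \<open>Both ends of \<open>x\<close> are used up by the tangle. This supplies all disequalities
  for internal edges, which the moves themselves do not require.\<close>

lemma two_ends_internal:
  assumes "every_edge_has_two_ends (T @ D)" "mset (concat (map ends T)) = {#x, x#} + M"
  shows "x \<notin># M" "x \<notin> labels D"
proof -
  have "x \<in> set_mset (mset (concat (map ends T)))"
    unfolding assms(2) by simp
  then have "x \<in> labels (T @ D)"
    by (auto simp: labels_def)
  then have "count_list (concat (map ends (T @ D))) x = 2"
    using assms(1) unfolding every_edge_has_two_ends_def by blast
  moreover have "count_list (concat (map ends (T @ D))) x
      = count (mset (concat (map ends T)) + mset (concat (map ends D))) x"
    unfolding count_union count_mset by simp
  ultimately have "count M x = 0" "count (mset (concat (map ends D))) x = 0"
    unfolding assms(2) by simp_all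
  then show "x \<notin># M" "x \<notin> labels D"
    by (simp_all only: count_eq_zero_iff) (auto simp: labels_def)
qed

text \<open>The rest of the diagram only notices the net flow through the boundary of the tangle.
  The fourth hypothesis says that this is unchanged, written with sums because subtraction of
  multisets truncates.\<close>

lemma equivalent_oriented_local:
  assumes "map fst E = T" "map fst E' = T'" "balanced (E @ E0)"
    and "sum_list (map ins E') + sum_list (map outs E) = sum_list (map ins E) + sum_list (map outs E')"
    and "graph_equivalence f g (labels T) (link_relation T) (labels T') (link_relation T')"
    and id: "\<And>x. x \<in> labels (map fst E0) \<Longrightarrow> f x = x \<and> g x = x"
    and "transported f E (bracket (T @ map fst E0)) E' (bracket (T' @ map fst E0))"
  shows "\<exists>E''. map fst E'' = T' @ map fst E0 \<and> balanced E'' \<and> equivalent_oriented (E @ E0) E''"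
proof (intro exI conjI)
  show "map fst (E' @ E0) = T' @ map fst E0"
    using assms(2) by simp
  show "balanced (E' @ E0)"
  proof -
    have "sum_list (map ins E) + sum_list (map ins E0) = sum_list (map outs E) + sum_list (map outs E0)"
      using assms(3) by (simp add: balanced_def)
    then have "(sum_list (map ins E') + sum_list (map outs E)) + (sum_list (map ins E) + sum_list (map ins E0))
      = (sum_list (map ins E) + sum_list (map outs E')) + (sum_list (map outs E) + sum_list (map outs E0))"
      using assms(4) by simp
    then show ?thesis
      by (simp add: balanced_def ac_simps)
  qed
  have "crossing_types_by (c \<circ> f) E0 = crossing_types_by c E0" for c :: "nat \<Rightarrow> nat set"
    by (rule crossing_types_by_cong) (simp add: id)
  then have "transported f (E @ E0) (bracket (T @ map fst E0)) (E' @ E0) (bracket (T' @ map fst E0))"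
    using assms(7) unfolding transported_def by (auto simp: reidemeister_change_add)
  with graph_equivalence_append[OF assms(5) id] show "equivalent_oriented (E @ E0) (E' @ E0)"
    unfolding equivalent_oriented_def using assms(1,2) by auto
qed

lemma transported_no_change:
  assumes "P = P'"
    and "\<And>c :: nat \<Rightarrow> nat set. (\<And>x y. (x, y) \<in> link_relation (map fst E') \<Longrightarrow> c x = c y)
      \<Longrightarrow> crossing_types_by (c \<circ> f) E = crossing_types_by c E'"
  shows "transported f E P E' P'"
  unfolding transported_def assms(1)
proof (intro allI impI)
  fix c :: "nat \<Rightarrow> nat set" assume "\<forall>(x, y)\<in>link_relation (map fst E'). c x = c y"
  then have "crossing_types_by (c \<circ> f) E = crossing_types_by c E'"
    by (intro assms(2)) auto
  then show "reidemeister_change (crossing_types_by (c \<circ> f) E) P' (crossing_types_by c E') P'"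
    by (simp add: reidemeister_change.no_change)
qed

text \<open>The path from \<open>a\<close> over \<open>b\<close> to \<open>c\<close> is shortened.
  The relation is fixed only up to the direction of its edges because the moves list their strands
  in different directions.\<close>

lemma one_joint_equivalence:
  assumes "R \<union> R\<inverse> = {(b, a), (b, c)} \<union> {(b, a), (b, c)}\<inverse>" "b \<noteq> a" "b \<noteq> c"
  shows "graph_equivalence (id(b := a)) id {a, b, c} R {a, c} {(a, c)}"
proof (rule graph_equivalence_sym_cong[OF _ assms(1)[symmetric] refl])
  have "(b, a) \<in> connectivity {(b, a), (b, c)}" "(b, c) \<in> connectivity {(b, a), (b, c)}"
    by (auto intro: connectivity_edge)
  then have "(a, b) \<in> connectivity {(b, a), (b, c)}" "(a, c) \<in> connectivity {(b, a), (b, c)}"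
    by (meson connectivity_sym connectivity_trans)+
  then show "graph_equivalence (id(b := a)) id {a, b, c} {(b, a), (b, c)} {a, c} {(a, c)}"
    using assms(2,3) by (auto simp: graph_equivalence_def intro: connectivity_edge)
qed

lemma map_fst_singleton:
  assumes "map fst E = [n]" obtains u v where "E = [(n, u, v)]"
  using assms by (cases E) auto

lemma map_fst_pair:
  assumes "map fst E = [n, m]" obtains u v u' v' where "E = [(n, u, v), (m, u', v')]"
  using assms by (cases E; cases "tl E") auto

lemma map_fst_triple:
  assumes "map fst E = [n, m, k]"
  obtains u v u' v' u'' v'' where "E = [(n, u, v), (m, u', v'), (k, u'', v'')]"
  using assms by (cases E; cases "tl E"; cases "tl (tl E)") auto

section \<open>The local moves one by one\<close>

lemma rotate_Cross_equivalent:
  assumes "map fst E = [Cross a b c d]" "balanced (E @ E0)"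
  shows "\<exists>E''. map fst E'' = [Cross c d a b] @ map fst E0 \<and> balanced E'' \<and> equivalent_oriented (E @ E0) E''"
proof -
  obtain u v where E: "E = [(Cross a b c d, u, v)]"
    using assms(1) by (rule map_fst_singleton)
  show ?thesis
  proof (rule equivalent_oriented_local[where E' = "[(Cross c d a b, \<not> u, \<not> v)]" and f = id and g = id])
    show "graph_equivalence id id (labels [Cross a b c d]) (link_relation [Cross a b c d])
      (labels [Cross c d a b]) (link_relation [Cross c d a b])"
      using graph_equivalence_id[of "link_relation [Cross a b c d]" "link_relation [Cross c d a b]"]
      by (auto simp: insert_commute)
    show "transported id E (bracket ([Cross a b c d] @ map fst E0))
       [(Cross c d a b, \<not> u, \<not> v)] (bracket ([Cross c d a b] @ map fst E0))"
      by (rule transported_no_change) (auto simp: E crossing_types_by_def bracket_Cross_rotate[of a])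
  qed (use assms(2) in \<open>auto simp: E add_mset_commute\<close>)
qed

lemma rotate_Virt_equivalent:
  assumes "map fst E = [Virt a b c d]" "balanced (E @ E0)"
  shows "\<exists>E''. map fst E'' = [Virt b c d a] @ map fst E0 \<and> balanced E'' \<and> equivalent_oriented (E @ E0) E''"
proof -
  obtain u v where E: "E = [(Virt a b c d, u, v)]"
    using assms(1) by (rule map_fst_singleton)
  show ?thesis
  \<comment> \<open>A quarter turn makes the old second strand the first one and lists the old first
    strand from its other end.\<close>
  proof (rule equivalent_oriented_local[where E' = "[(Virt b c d a, v, \<not> u)]" and f = id and g = id])
    have "{b, c, d, a} = {a, b, c, d}"
      by auto
    moreover have "{(a, c), (b, d)} \<union> {(a, c), (b, d)}\<inverse> = {(b, d), (c, a)} \<union> {(b, d), (c, a)}\<inverse>"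
      by auto
    ultimately show "graph_equivalence id id (labels [Virt a b c d]) (link_relation [Virt a b c d])
      (labels [Virt b c d a]) (link_relation [Virt b c d a])"
      using graph_equivalence_id[of "{(a, c), (b, d)}" "{(b, d), (c, a)}" "{a, b, c, d}"] by simp
    have "bracket (Virt a b c d # D) = bracket (Virt b c d a # D)" for D
      unfolding bracket_Virt by (rule bracket_rearrange) (simp add: insert_commute add_mset_commute)
    then show "transported id E (bracket ([Virt a b c d] @ map fst E0))
       [(Virt b c d a, v, \<not> u)] (bracket ([Virt b c d a] @ map fst E0))"
      by (intro transported_no_change) (auto simp: E crossing_types_by_def)
  qed (use assms(2) in \<open>auto simp: E add_mset_commute\<close>)
qed

lemma rotate_Joint_equivalent:
  assumes "map fst E = [Joint a b]" "balanced (E @ E0)"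
  shows "\<exists>E''. map fst E'' = [Joint b a] @ map fst E0 \<and> balanced E'' \<and> equivalent_oriented (E @ E0) E''"
proof -
  obtain u v where E: "E = [(Joint a b, u, v)]"
    using assms(1) by (rule map_fst_singleton)
  show ?thesis
  proof (rule equivalent_oriented_local[where E' = "[(Joint b a, \<not> u, v)]" and f = id and g = id])
    show "graph_equivalence id id (labels [Joint a b]) (link_relation [Joint a b])
      (labels [Joint b a]) (link_relation [Joint b a])"
      using graph_equivalence_id[of "{(a, b)}" "{(b, a)}" "{a, b}"] by (auto simp: insert_commute)
    have "bracket (Joint a b # D) = bracket (Joint b a # D)" for D
      by (rule bracket_rearrange) (simp add: insert_commute)
    then show "transported id E (bracket ([Joint a b] @ map fst E0))
       [(Joint b a, \<not> u, v)] (bracket ([Joint b a] @ map fst E0))"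
      by (intro transported_no_change) (auto simp: E crossing_types_by_def)
  qed (use assms(2) in \<open>auto simp: E add_mset_commute\<close>)
qed

lemma R1_equivalent:
  assumes "map fst E = [Cross b b a c]" "balanced (E @ E0)"
    and "every_edge_has_two_ends ([Cross b b a c] @ map fst E0)"
  shows "\<exists>E''. map fst E'' = [Joint a c] @ map fst E0 \<and> balanced E'' \<and> equivalent_oriented (E @ E0) E''"
proof -
  obtain u v where E: "E = [(Cross b b a c, u, v)]"
    using assms(1) by (rule map_fst_singleton)
  have b: "b \<noteq> a" "b \<noteq> c" "b \<notin> labels (map fst E0)"
    using two_ends_internal[OF assms(3), of b "{#a, c#}"] by auto
  \<comment> \<open>The loop \<open>b\<close> joins the first ends of both strands, so exactly one
    of them is an entrance. Hence the crossing is positive in every orientation.\<close>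
  have v: "v = (\<not> u)"
    using balanced_internal[OF assms(2) b(3)] b(1,2) by (auto simp: E split: if_splits)
  show ?thesis
  proof (rule equivalent_oriented_local[where E' = "[(Joint a c, \<not> u, v)]" and f = "id(b := a)" and g = id])
    show "graph_equivalence (id(b := a)) id (labels [Cross b b a c]) (link_relation [Cross b b a c])
      (labels [Joint a c]) (link_relation [Joint a c])"
      using one_joint_equivalence[of "{(b, a), (b, c)}" b a c] b by (simp add: insert_commute)
    show "transported (id(b := a)) E (bracket ([Cross b b a c] @ map fst E0))
       [(Joint a c, \<not> u, v)] (bracket ([Joint a c] @ map fst E0))"
      using reidemeister_change.remove_positive[of _ "{#}"] b
      by (auto simp: transported_def E v crossing_types_by_def bracket_R1)
  qed (use assms(2) b in \<open>auto simp: E v add_mset_commute\<close>)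
qed

lemma R1'_equivalent:
  assumes "map fst E = [Cross a b b c]" "balanced (E @ E0)"
    and "every_edge_has_two_ends ([Cross a b b c] @ map fst E0)"
  shows "\<exists>E''. map fst E'' = [Joint a c] @ map fst E0 \<and> balanced E'' \<and> equivalent_oriented (E @ E0) E''"
proof -
  obtain u v where E: "E = [(Cross a b b c, u, v)]"
    using assms(1) by (rule map_fst_singleton)
  have b: "b \<noteq> a" "b \<noteq> c" "b \<notin> labels (map fst E0)"
    using two_ends_internal[OF assms(3), of b "{#a, c#}"] by auto
  \<comment> \<open>Here the loop joins the last end of one strand to the first end of the other, so
    the crossing is negative in every orientation.\<close>
  have v: "v = u"
    using balanced_internal[OF assms(2) b(3)] b(1,2) by (auto simp: E split: if_splits)
  show ?thesis
  proof (rule equivalent_oriented_local[where E' = "[(Joint a c, u, v)]" and f = "id(b := a)" and g = id])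
    have "{(a, b), (b, c)} \<union> {(a, b), (b, c)}\<inverse> = {(b, a), (b, c)} \<union> {(b, a), (b, c)}\<inverse>"
      by auto
    from one_joint_equivalence[OF this b(1,2)]
    show "graph_equivalence (id(b := a)) id (labels [Cross a b b c]) (link_relation [Cross a b b c])
      (labels [Joint a c]) (link_relation [Joint a c])"
      by simp
    show "transported (id(b := a)) E (bracket ([Cross a b b c] @ map fst E0))
       [(Joint a c, u, v)] (bracket ([Joint a c] @ map fst E0))"
      using reidemeister_change.remove_negative[of _ "{#}"] b
      by (auto simp: transported_def E v crossing_types_by_def bracket_R1')
  qed (use assms(2) b in \<open>auto simp: E v add_mset_commute\<close>)
qed

lemma virtual_R1_equivalent:
  assumes "map fst E = [Virt b b a c]" "balanced (E @ E0)"
    and "every_edge_has_two_ends ([Virt b b a c] @ map fst E0)"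
  shows "\<exists>E''. map fst E'' = [Joint a c] @ map fst E0 \<and> balanced E'' \<and> equivalent_oriented (E @ E0) E''"
proof -
  obtain u v where E: "E = [(Virt b b a c, u, v)]"
    using assms(1) by (rule map_fst_singleton)
  have b: "b \<noteq> a" "b \<noteq> c" "b \<notin> labels (map fst E0)"
    using two_ends_internal[OF assms(3), of b "{#a, c#}"] by auto
  have v: "v = (\<not> u)"
    using balanced_internal[OF assms(2) b(3)] b(1,2) by (auto simp: E split: if_splits)
  show ?thesis
  proof (rule equivalent_oriented_local[where E' = "[(Joint a c, \<not> u, v)]" and f = "id(b := a)" and g = id])
    show "graph_equivalence (id(b := a)) id (labels [Virt b b a c]) (link_relation [Virt b b a c])
      (labels [Joint a c]) (link_relation [Joint a c])"
      using one_joint_equivalence[of "{(b, a), (b, c)}" b a c] b by (simp add: insert_commute)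
    show "transported (id(b := a)) E (bracket ([Virt b b a c] @ map fst E0))
       [(Joint a c, \<not> u, v)] (bracket ([Joint a c] @ map fst E0))"
      by (rule transported_no_change) (use b in \<open>auto simp: E crossing_types_by_def bracket_virtual_R1\<close>)
  qed (use assms(2) b in \<open>auto simp: E v add_mset_commute\<close>)
qed

lemma two_joints_equivalence:
  assumes R: "R \<union> R\<inverse> = {(a, e), (e, c), (b, f), (f, d)} \<union> {(a, e), (e, c), (b, f), (f, d)}\<inverse>"
    and "e \<noteq> f" "{e, f} \<inter> {a, b, c, d} = {}"
  shows "graph_equivalence (id(e := a, f := b)) id {a, b, c, d, e, f} R {a, b, c, d} {(a, c), (b, d)}"
proof (rule graph_equivalence_sym_cong[OF _ R[symmetric] refl])
  let ?R = "{(a, e), (e, c), (b, f), (f, d)}"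
  have "(a, e) \<in> connectivity ?R" "(e, c) \<in> connectivity ?R" "(b, f) \<in> connectivity ?R" "(f, d) \<in> connectivity ?R"
    by (auto intro: connectivity_edge)
  then have "(a, e) \<in> connectivity ?R" "(a, c) \<in> connectivity ?R" "(b, f) \<in> connectivity ?R" "(b, d) \<in> connectivity ?R"
    by (meson connectivity_trans)+
  then show "graph_equivalence (id(e := a, f := b)) id {a, b, c, d, e, f} ?R {a, b, c, d} {(a, c), (b, d)}"
    using assms(2,3) by (auto simp: graph_equivalence_def intro: connectivity_edge)
qed

text \<open>The internal edges force \<open>u' = u\<close> and \<open>v' = (\<not> v)\<close>. So
  exactly one of the two crossings has equal flags, and the signs are opposite whichever way the
  strands run.\<close>

lemma R2_equivalent:
  assumes "map fst E = [slash a b e f, backslash f e d c]" "balanced (E @ E0)"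
    and "every_edge_has_two_ends ([slash a b e f, backslash f e d c] @ map fst E0)"
  shows "\<exists>E''. map fst E'' = [Joint a c, Joint b d] @ map fst E0 \<and> balanced E'' \<and> equivalent_oriented (E @ E0) E''"
proof -
  obtain u v u' v' where E: "E = [(Cross b e f a, u, v), (Cross f e d c, u', v')]"
    using assms(1) by (auto elim: map_fst_pair)
  have e: "e \<notin># {#f, f, a, b, c, d#}" "e \<notin> labels (map fst E0)"
    using two_ends_internal[OF assms(3), of e "{#f, f, a, b, c, d#}"] by simp_all
  have f: "f \<notin># {#e, e, a, b, c, d#}" "f \<notin> labels (map fst E0)"
    using two_ends_internal[OF assms(3), of f "{#e, e, a, b, c, d#}"] by simp_all
  have ef: "e \<noteq> f" "{e, f} \<inter> ({a, b, c, d} \<union> labels (map fst E0)) = {}"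
    using e f by auto
  have ne: "e \<noteq> f" "e \<noteq> a" "e \<noteq> b" "e \<noteq> c" "e \<noteq> d" "f \<noteq> a" "f \<noteq> b" "f \<noteq> c" "f \<noteq> d"
    using e f by auto
  have u': "u' = u"
    using balanced_internal[OF assms(2) f(2)] ne ne[symmetric] unfolding E
    by (cases u; cases v; cases u'; cases v'; simp)
  have v': "v' = (\<not> v)"
    using balanced_internal[OF assms(2) e(2)] ne ne[symmetric] unfolding E
    by (cases u; cases v; cases u'; cases v'; simp)
  show ?thesis
  proof (rule equivalent_oriented_local[where E' = "[(Joint a c, \<not> v, v), (Joint b d, u, v)]"
        and f = "id(e := a, f := b)" and g = id])
    have R: "link_relation [slash a b e f, backslash f e d c] \<union> (link_relation [slash a b e f, backslash f e d c])\<inverse>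
        = {(a, e), (e, c), (b, f), (f, d)} \<union> {(a, e), (e, c), (b, f), (f, d)}\<inverse>"
      by auto
    have "labels [slash a b e f, backslash f e d c] = {a, b, c, d, e, f}"
      "labels [Joint a c, Joint b d] = {a, b, c, d}" "link_relation [Joint a c, Joint b d] = {(a, c), (b, d)}"
      by auto
    then show "graph_equivalence (id(e := a, f := b)) id
      (labels [slash a b e f, backslash f e d c]) (link_relation [slash a b e f, backslash f e d c])
      (labels [Joint a c, Joint b d]) (link_relation [Joint a c, Joint b d])"
      using two_joints_equivalence[OF R ef(1)] ef(2) by (simp only:) blast
    have types: "crossing_types_by (k \<circ> id(e := a, f := b)) E = {#({k b, k a}, 1), ({k b, k a}, -1)#}" for k :: "nat \<Rightarrow> nat set"
      using ne by (cases u; cases v) (simp_all add: E u' v' crossing_types_by_def add_mset_commute)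
    have "bracket ([slash a b e f, backslash f e d c] @ map fst E0)
      = - (q_powi 1 * bracket ([Joint a c, Joint b d] @ map fst E0))"
      using bracket_R2[OF ef] by simp
    then show "transported (id(e := a, f := b)) E (bracket ([slash a b e f, backslash f e d c] @ map fst E0))
       [(Joint a c, \<not> v, v), (Joint b d, u, v)] (bracket ([Joint a c, Joint b d] @ map fst E0))"
      unfolding transported_def types
      by (simp add: crossing_types_by_def reidemeister_change.remove_pair[where X = "{#}"])
    show "sum_list (map ins [(Joint a c, \<not> v, v), (Joint b d, u, v)]) + sum_list (map outs E) =
      sum_list (map ins E) + sum_list (map outs [(Joint a c, \<not> v, v), (Joint b d, u, v)])"
      by (cases u; cases v) (simp_all add: E u' v')
  qed (use assms(2) ef in \<open>auto simp: E\<close>)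
qed

lemma virtual_R2_equivalent:
  assumes "map fst E = [Virt a b e f, Virt f e d c]" "balanced (E @ E0)"
    and "every_edge_has_two_ends ([Virt a b e f, Virt f e d c] @ map fst E0)"
  shows "\<exists>E''. map fst E'' = [Joint a c, Joint b d] @ map fst E0 \<and> balanced E'' \<and> equivalent_oriented (E @ E0) E''"
proof -
  obtain u v u' v' where E: "E = [(Virt a b e f, u, v), (Virt f e d c, u', v')]"
    using assms(1) by (rule map_fst_pair)
  have e: "e \<notin># {#f, f, a, b, c, d#}" "e \<notin> labels (map fst E0)"
    using two_ends_internal[OF assms(3), of e "{#f, f, a, b, c, d#}"] by simp_all
  have f: "f \<notin># {#e, e, a, b, c, d#}" "f \<notin> labels (map fst E0)"
    using two_ends_internal[OF assms(3), of f "{#e, e, a, b, c, d#}"] by simp_all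
  have ef: "e \<noteq> f" "{e, f} \<inter> ({a, b, c, d} \<union> labels (map fst E0)) = {}"
    using e f by auto
  have ne: "e \<noteq> f" "e \<noteq> a" "e \<noteq> b" "e \<noteq> c" "e \<noteq> d" "f \<noteq> a" "f \<noteq> b" "f \<noteq> c" "f \<noteq> d"
    using e f by auto
  have u': "u' = v"
    using balanced_internal[OF assms(2) f(2)] ne ne[symmetric] unfolding E
    by (cases u; cases v; cases u'; cases v'; simp)
  have v': "v' = u"
    using balanced_internal[OF assms(2) e(2)] ne ne[symmetric] unfolding E
    by (cases u; cases v; cases u'; cases v'; simp)
  show ?thesis
  proof (rule equivalent_oriented_local[where E' = "[(Joint a c, u, v), (Joint b d, v, v)]"
        and f = "id(e := a, f := b)" and g = id])
    have R: "link_relation [Virt a b e f, Virt f e d c] \<union> (link_relation [Virt a b e f, Virt f e d c])\<inverse>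
        = {(a, e), (e, c), (b, f), (f, d)} \<union> {(a, e), (e, c), (b, f), (f, d)}\<inverse>"
      by auto
    have "labels [Virt a b e f, Virt f e d c] = {a, b, c, d, e, f}"
      "labels [Joint a c, Joint b d] = {a, b, c, d}" "link_relation [Joint a c, Joint b d] = {(a, c), (b, d)}"
      by auto
    then show "graph_equivalence (id(e := a, f := b)) id
      (labels [Virt a b e f, Virt f e d c]) (link_relation [Virt a b e f, Virt f e d c])
      (labels [Joint a c, Joint b d]) (link_relation [Joint a c, Joint b d])"
      using two_joints_equivalence[OF R ef(1)] ef(2) by (simp only:) blast
    show "transported (id(e := a, f := b)) E (bracket ([Virt a b e f, Virt f e d c] @ map fst E0))
       [(Joint a c, u, v), (Joint b d, v, v)] (bracket ([Joint a c, Joint b d] @ map fst E0))"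
      by (rule transported_no_change) (use bracket_virtual_R2[OF ef] in \<open>simp_all add: E crossing_types_by_def\<close>)
    show "sum_list (map ins [(Joint a c, u, v), (Joint b d, v, v)]) + sum_list (map outs E) =
      sum_list (map ins E) + sum_list (map outs [(Joint a c, u, v), (Joint b d, v, v)])"
      by (cases u; cases v) (simp_all add: E u' v')
  qed (use assms(2) ef in \<open>auto simp: E\<close>)
qed

text \<open>Each map collapses the internal edges of its tangle to the lower ends of their strands.
  The maps are separate since the internal labels of the two tangles are unrelated and may
  overlap.\<close>

lemma three_strands_equivalence:
  assumes R: "R \<union> R\<inverse> = {(a1, x), (x, b3), (a2, y), (y, b2), (a3, z), (z, b1)}
      \<union> {(a1, x), (x, b3), (a2, y), (y, b2), (a3, z), (z, b1)}\<inverse>"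
    and R': "R' \<union> R'\<inverse> = {(a1, w), (w, b3), (a2, u), (u, b2), (a3, v), (v, b1)}
      \<union> {(a1, w), (w, b3), (a2, u), (u, b2), (a3, v), (v, b1)}\<inverse>"
    and xyz: "distinct [x, y, z]" "{x, y, z} \<inter> {a1, a2, a3, b1, b2, b3} = {}"
    and uvw: "distinct [u, v, w]" "{u, v, w} \<inter> {a1, a2, a3, b1, b2, b3} = {}"
  shows "graph_equivalence (id(x := a1, y := a2, z := a3)) (id(u := a2, v := a3, w := a1))
    {a1, a2, a3, b1, b2, b3, x, y, z} R {a1, a2, a3, b1, b2, b3, u, v, w} R'"
proof (rule graph_equivalence_sym_cong[OF _ R[symmetric] R'[symmetric]])
  let ?R = "{(a1, x), (x, b3), (a2, y), (y, b2), (a3, z), (z, b1)}"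
  let ?R' = "{(a1, w), (w, b3), (a2, u), (u, b2), (a3, v), (v, b1)}"
  have "(a1, x) \<in> connectivity ?R" "(x, b3) \<in> connectivity ?R" "(a2, y) \<in> connectivity ?R"
    "(y, b2) \<in> connectivity ?R" "(a3, z) \<in> connectivity ?R" "(z, b1) \<in> connectivity ?R"
    by (auto intro: connectivity_edge)
  then have 1: "(a1, x) \<in> connectivity ?R" "(a1, b3) \<in> connectivity ?R" "(a2, y) \<in> connectivity ?R"
    "(a2, b2) \<in> connectivity ?R" "(a3, z) \<in> connectivity ?R" "(a3, b1) \<in> connectivity ?R"
    by (blast intro: connectivity_trans)+
  have "(a1, w) \<in> connectivity ?R'" "(w, b3) \<in> connectivity ?R'" "(a2, u) \<in> connectivity ?R'"
    "(u, b2) \<in> connectivity ?R'" "(a3, v) \<in> connectivity ?R'" "(v, b1) \<in> connectivity ?R'"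
    by (auto intro: connectivity_edge)
  then have 2: "(a1, w) \<in> connectivity ?R'" "(a1, b3) \<in> connectivity ?R'" "(a2, u) \<in> connectivity ?R'"
    "(a2, b2) \<in> connectivity ?R'" "(a3, v) \<in> connectivity ?R'" "(a3, b1) \<in> connectivity ?R'"
    by (blast intro: connectivity_trans)+
  have ne: "x \<noteq> a1" "x \<noteq> a2" "x \<noteq> a3" "x \<noteq> b1" "x \<noteq> b2" "x \<noteq> b3" "x \<noteq> y" "x \<noteq> z"
    "y \<noteq> a1" "y \<noteq> a2" "y \<noteq> a3" "y \<noteq> b1" "y \<noteq> b2" "y \<noteq> b3" "y \<noteq> z"
    "z \<noteq> a1" "z \<noteq> a2" "z \<noteq> a3" "z \<noteq> b1" "z \<noteq> b2" "z \<noteq> b3"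
    "u \<noteq> a1" "u \<noteq> a2" "u \<noteq> a3" "u \<noteq> b1" "u \<noteq> b2" "u \<noteq> b3" "u \<noteq> v" "u \<noteq> w"
    "v \<noteq> a1" "v \<noteq> a2" "v \<noteq> a3" "v \<noteq> b1" "v \<noteq> b2" "v \<noteq> b3" "v \<noteq> w"
    "w \<noteq> a1" "w \<noteq> a2" "w \<noteq> a3" "w \<noteq> b1" "w \<noteq> b2" "w \<noteq> b3"
    using xyz uvw by auto
  show "graph_equivalence (id(x := a1, y := a2, z := a3)) (id(u := a2, v := a3, w := a1))
    {a1, a2, a3, b1, b2, b3, x, y, z} ?R {a1, a2, a3, b1, b2, b3, u, v, w} ?R'"
    unfolding graph_equivalence_def using 1 2 ne ne[symmetric] by simp
qed

lemma count_ins_outs: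
  "count (ins (Cross a b c d, u, v)) i = of_bool (if u then a = i else c = i) + of_bool (if v then b = i else d = i)"
  "count (ins (Virt a b c d, u, v)) i = of_bool (if u then a = i else c = i) + of_bool (if v then b = i else d = i)"
  "count (outs (Cross a b c d, u, v)) i = of_bool (if u then c = i else a = i) + of_bool (if v then d = i else b = i)"
  "count (outs (Virt a b c d, u, v)) i = of_bool (if u then c = i else a = i) + of_bool (if v then d = i else b = i)"
  by auto

text \<open>Every strand keeps its direction, and each crossing lists its strands in the same way on
  both sides, so the flags are carried over crossing by crossing. The three internal edges reduce
  the six flags to three independent directions.\<close>

lemma R3_flags:
  fixes x y z :: 'e
  assumes X: "(X12, X13, X23) \<in> {(slash, slash, slash), (backslash, backslash, backslash),
      (Virt, Virt, Virt), (slash, Virt, Virt), (backslash, Virt, Virt)}"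
    and E: "E = [(X12 a1 a2 x y, h1, k1), (X13 x a3 b3 z, h2, k2), (X23 y z b2 b1, h3, k3)]"
    and xyz: "distinct [x, y, z]" "{x, y, z} \<inter> {a1, a2, a3, b1, b2, b3} = {}"
    and count: "\<And>i. i \<in> {x, y, z} \<Longrightarrow> count (sum_list (map ins E)) i = count (sum_list (map outs E)) i"
    and E': "E' = [(X23 a2 a3 u v, h3, k3), (X13 a1 v w b1, h2, k2), (X12 w u b3 b2, h1, k1)]"
  shows "sum_list (map ins E') + sum_list (map outs E) = sum_list (map ins E) + sum_list (map outs E')"
proof -
  have ne: "x \<noteq> a1" "x \<noteq> a2" "x \<noteq> a3" "x \<noteq> b1" "x \<noteq> b2" "x \<noteq> b3" "x \<noteq> y" "x \<noteq> z"
    "y \<noteq> a1" "y \<noteq> a2" "y \<noteq> a3" "y \<noteq> b1" "y \<noteq> b2" "y \<noteq> b3" "y \<noteq> z"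
    "z \<noteq> a1" "z \<noteq> a2" "z \<noteq> a3" "z \<noteq> b1" "z \<noteq> b2" "z \<noteq> b3"
    using xyz by auto
  have cx: "count (sum_list (map ins E)) x = count (sum_list (map outs E)) x"
    and cy: "count (sum_list (map ins E)) y = count (sum_list (map outs E)) y"
    and cz: "count (sum_list (map ins E)) z = count (sum_list (map outs E)) z"
    by (simp_all add: count)
  consider "X12 = slash" "X13 = slash" "X23 = slash"
    | "X12 = backslash" "X13 = backslash" "X23 = backslash"
    | "X12 = Virt" "X13 = Virt" "X23 = Virt"
    | "X12 = slash" "X13 = Virt" "X23 = Virt"
    | "X12 = backslash" "X13 = Virt" "X23 = Virt"
    using X by auto
  then show ?thesis
  proof cases
    case 1
    \<comment> \<open>\<open>slash\<close> starts its list at the south-east, so its second flag is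
      true when the other strand runs downwards. This causes the negation here and in the fourth
      case.\<close>
    have "k2 = k1" "h3 = h2" "k3 = (\<not> h1)"
      using cx cy cz ne ne[symmetric] unfolding E 1
      by (simp_all add: count_ins_outs del: ins.simps outs_simps split: if_splits)
    then show ?thesis
      unfolding E E' 1 by (cases h1; cases k1; cases h2) simp_all
  next
    case 2
    have "h2 = h1" "h3 = k1" "k3 = k2"
      using cx cy cz ne ne[symmetric] unfolding E 2
      by (simp_all add: count_ins_outs del: ins.simps outs_simps split: if_splits)
    then show ?thesis
      unfolding E E' 2 by (cases h1; cases k1; cases k2) simp_all
  next
    case 3
    have "h2 = h1" "h3 = k1" "k3 = k2"
      using cx cy cz ne ne[symmetric] unfolding E 3
      by (simp_all add: count_ins_outs del: ins.simps outs_simps split: if_splits)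
    then show ?thesis
      unfolding E E' 3 by (cases h1; cases k1; cases k2) simp_all
  next
    case 4
    have "h2 = (\<not> k1)" "h3 = h1" "k3 = k2"
      using cx cy cz ne ne[symmetric] unfolding E 4
      by (simp_all add: count_ins_outs del: ins.simps outs_simps split: if_splits)
    then show ?thesis
      unfolding E E' 4 by (cases h1; cases k1; cases k2) simp_all
  next
    case 5
    have "h2 = h1" "h3 = k1" "k3 = k2"
      using cx cy cz ne ne[symmetric] unfolding E 5
      by (simp_all add: count_ins_outs del: ins.simps outs_simps split: if_splits)
    then show ?thesis
      unfolding E E' 5 by (cases h1; cases k1; cases k2) simp_all
  qed
qed

lemma R3_equivalent:
  assumes X: "(X12, X13, X23) \<in> {(slash, slash, slash), (backslash, backslash, backslash),
      (Virt, Virt, Virt), (slash, Virt, Virt), (backslash, Virt, Virt)}"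
    and T: "T = [X12 a1 a2 x y, X13 x a3 b3 z, X23 y z b2 b1]"
    and T': "T' = [X23 a2 a3 u v, X13 a1 v w b1, X12 w u b3 b2]"
    and "map fst E = T" "balanced (E @ E0)"
    and two_ends: "every_edge_has_two_ends (T @ map fst E0)" "every_edge_has_two_ends (T' @ map fst E0)"
  shows "\<exists>E''. map fst E'' = T' @ map fst E0 \<and> balanced E'' \<and> equivalent_oriented (E @ E0) E''"
proof -
  consider "X12 = slash" "X13 = slash" "X23 = slash"
    | "X12 = backslash" "X13 = backslash" "X23 = backslash"
    | "X12 = Virt" "X13 = Virt" "X23 = Virt"
    | "X12 = slash" "X13 = Virt" "X23 = Virt"
    | "X12 = backslash" "X13 = Virt" "X23 = Virt"
    using X by auto
  note types = this
  have ends: "mset (concat (map ends T)) = {#x, x, y, y, z, z, a1, a2, a3, b1, b2, b3#}"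
    "mset (concat (map ends T')) = {#u, u, v, v, w, w, a1, a2, a3, b1, b2, b3#}"
    by (cases rule: types; simp add: T T')+
  have xyz: "distinct [x, y, z]" "{x, y, z} \<inter> ({a1, a2, a3, b1, b2, b3} \<union> labels (map fst E0)) = {}"
    using two_ends_internal[OF two_ends(1), of x "{#y, y, z, z, a1, a2, a3, b1, b2, b3#}"]
      two_ends_internal[OF two_ends(1), of y "{#x, x, z, z, a1, a2, a3, b1, b2, b3#}"]
      two_ends_internal[OF two_ends(1), of z "{#x, x, y, y, a1, a2, a3, b1, b2, b3#}"]
    unfolding ends by auto
  have uvw: "distinct [u, v, w]" "{u, v, w} \<inter> ({a1, a2, a3, b1, b2, b3} \<union> labels (map fst E0)) = {}"
    using two_ends_internal[OF two_ends(2), of u "{#v, v, w, w, a1, a2, a3, b1, b2, b3#}"]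
      two_ends_internal[OF two_ends(2), of v "{#u, u, w, w, a1, a2, a3, b1, b2, b3#}"]
      two_ends_internal[OF two_ends(2), of w "{#u, u, v, v, a1, a2, a3, b1, b2, b3#}"]
    unfolding ends by auto
  note disjoint = xyz(2)[unfolded Int_Un_distrib Un_empty, THEN conjunct1]
    xyz(2)[unfolded Int_Un_distrib Un_empty, THEN conjunct2]
    uvw(2)[unfolded Int_Un_distrib Un_empty, THEN conjunct1]
    uvw(2)[unfolded Int_Un_distrib Un_empty, THEN conjunct2]
  obtain h1 k1 h2 k2 h3 k3 where
    E: "E = [(X12 a1 a2 x y, h1, k1), (X13 x a3 b3 z, h2, k2), (X23 y z b2 b1, h3, k3)]"
    using assms(4) unfolding T by (rule map_fst_triple)
  define E' where "E' = [(X23 a2 a3 u v, h3, k3), (X13 a1 v w b1, h2, k2), (X12 w u b3 b2, h1, k1)]"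
  let ?f = "id(x := a1, y := a2, z := a3)" and ?g = "id(u := a2, v := a3, w := a1)"
  let ?S = "{(a1, x), (x, b3), (a2, y), (y, b2), (a3, z), (z, b1)}"
  let ?S' = "{(a1, w), (w, b3), (a2, u), (u, b2), (a3, v), (v, b1)}"
  have links: "link_relation T \<union> (link_relation T)\<inverse> = ?S \<union> ?S\<inverse>"
    "link_relation T' \<union> (link_relation T')\<inverse> = ?S' \<union> ?S'\<inverse>"
    by (cases rule: types; auto simp: T T')+
  show ?thesis
  proof (rule equivalent_oriented_local[where f = ?f and g = ?g, OF assms(4) _ assms(5)])
    show "map fst E' = T'"
      by (simp add: E'_def T')
    show "sum_list (map ins E') + sum_list (map outs E) = sum_list (map ins E) + sum_list (map outs E')"
    proof (rule R3_flags[where ?X12.0 = X12 and ?X13.0 = X13 and ?X23.0 = X23, OF X E xyz(1) disjoint(1) _ E'_def])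
      show "count (sum_list (map ins E)) i = count (sum_list (map outs E)) i" if "i \<in> {x, y, z}" for i
        using disjoint(2) that by (intro balanced_internal[OF assms(5)]) (unfold disjoint_iff, blast)
    qed
    have "labels T = {a1, a2, a3, b1, b2, b3, x, y, z}" "labels T' = {a1, a2, a3, b1, b2, b3, u, v, w}"
      by (cases rule: types; auto simp: T T')+
    then show "graph_equivalence ?f ?g (labels T) (link_relation T) (labels T') (link_relation T')"
      using three_strands_equivalence[OF links xyz(1) disjoint(1) uvw(1) disjoint(3)] by (simp only:)
    show "?f i = i \<and> ?g i = i" if "i \<in> labels (map fst E0)" for i
      using disjoint(2,4) that by auto
    show "transported ?f E (bracket (T @ map fst E0)) E' (bracket (T' @ map fst E0))"
    proof (rule transported_no_change)
      show "bracket (T @ map fst E0) = bracket (T' @ map fst E0)"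
        using bracket_R3[where ?X12.0 = X12 and ?X13.0 = X13 and ?X23.0 = X23, OF X xyz uvw] by (simp add: T T')
    next
      fix c :: "nat \<Rightarrow> nat set"
      assume c: "c i = c j" if "(i, j) \<in> link_relation (map fst E')" for i j
      have c': "c i = c j" if "(i, j) \<in> ?S'" for i j
      proof -
        have "(i, j) \<in> link_relation T' \<or> (j, i) \<in> link_relation T'"
          by (rule connectivity_edge_sym_cong[OF links(2)[symmetric]]) (use that in blast)
        then show ?thesis
          using c[of i j] c[of j i] \<open>map fst E' = T'\<close> by auto
      qed
      \<comment> \<open>The two sides read the colours of a crossing at different points of the same
        strands; constancy along the new strands identifies them.\<close>
      have "c w = c a1" "c u = c a2" "c v = c a3"
        using c'[of a1 w] c'[of a2 u] c'[of a3 v] by simp_all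
      moreover have "c b3 = c w" "c b2 = c u" "c b1 = c v"
        using c'[of w b3] c'[of u b2] c'[of v b1] by simp_all
      moreover have "x \<noteq> y" "x \<noteq> z" "y \<noteq> z"
        and "?f a1 = a1" "?f a2 = a2" "?f a3 = a3" "?f b1 = b1" "?f b2 = b2" "?f b3 = b3"
        using xyz by auto
      ultimately show "crossing_types_by (c \<circ> ?f) E = crossing_types_by c E'"
        unfolding crossing_types_by_def E E'_def
        by (cases rule: types; simp add: insert_commute del: fun_upd_apply add: fun_upd_same fun_upd_other)
    qed
  qed
qed

section \<open>Reordering, relabelling and erasing joints\<close>

lemma sum_list_map_mset_cong:
  fixes h :: "'a \<Rightarrow> 'b :: comm_monoid_add"
  shows "mset xs = mset ys \<Longrightarrow> sum_list (map h xs) = sum_list (map h ys)"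
  by (metis mset_map sum_mset_sum_list)

lemma reorder_equivalent:
  assumes "mset (map fst E) = mset D'" "balanced E"
  shows "\<exists>E'. map fst E' = D' \<and> balanced E' \<and> equivalent_oriented E E'"
proof -
  have "\<exists>E'. map fst E' = D' \<and> mset E' = mset E"
    using assms(1)
  proof (induction D' arbitrary: E)
    case (Cons n D')
    then have "n \<in> fst ` set E"
      by (metis list.set_intros(1) mset_eq_setD set_map)
    then obtain e where "e \<in> set E" "fst e = n"
      by auto
    then obtain E1 E2 where E: "E = E1 @ e # E2"
      by (meson split_list)
    then have "mset (map fst (E1 @ E2)) = mset D'"
      using Cons.prems \<open>fst e = n\<close> by simp
    then obtain E' where "map fst E' = D'" "mset E' = mset (E1 @ E2)"
      using Cons.IH by blast
    then show ?case
      using \<open>fst e = n\<close> by (intro exI[of _ "e # E'"]) (simp add: E)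
  qed simp
  then obtain E' where E': "map fst E' = D'" "mset E' = mset E"
    by blast
  note sums = sum_list_map_mset_cong[OF E'(2)]
  have "set E' = set E"
    using E'(2) by (rule mset_eq_setD)
  then have graph: "labels (map fst E') = labels (map fst E)" "link_relation (map fst E') = link_relation (map fst E)"
    by (simp_all add: labels_def link_relation_def)
  have "equivalent_oriented E E'"
    unfolding equivalent_oriented_def graph
  proof (intro exI conjI)
    show "graph_equivalence id id (labels (map fst E)) (link_relation (map fst E))
        (labels (map fst E)) (link_relation (map fst E))"
      by (rule graph_equivalence_id) simp
    show "transported id E (bracket (map fst E)) E' (bracket (map fst E'))"
      by (rule transported_no_change)
        (use assms(1) E'(1) in \<open>auto simp: crossing_types_by_def sums intro: bracket_reorder\<close>)
  qed
  moreover have "balanced E'"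
    using assms(2) sums[of ins] sums[of outs] by (simp add: balanced_def)
  ultimately show ?thesis
    using E'(1) by blast
qed

lemma ins_map_node: "ins (map_prod (map_node f) id e) = image_mset f (ins e)"
  by (cases e rule: ins.cases) auto

lemma outs_map_node: "outs (map_prod (map_node f) id e) = image_mset f (outs e)"
  by (cases e rule: ins.cases) auto

lemma sum_list_map_node:
  "sum_list (map ins (map (map_prod (map_node f) id) E)) = image_mset f (sum_list (map ins E))"
  "sum_list (map outs (map (map_prod (map_node f) id) E)) = image_mset f (sum_list (map outs E))"
  by (induction E) (simp_all add: ins_map_node outs_map_node)

lemma crossing_types_by_map_node:
  "crossing_types_by c (map (map_prod (map_node f) id) E) = crossing_types_by (c \<circ> f) E"
proof -
  have "crossing_type c (map_prod (map_node f) id e) = crossing_type (c \<circ> f) e" for e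
    by (cases e rule: ins.cases) auto
  then show ?thesis
    by (simp add: crossing_types_by_def comp_def)
qed

lemma relabel_equivalent:
  assumes "inj_on f (labels (map fst E))" "balanced E"
  shows "\<exists>E'. map fst E' = map (map_node f) (map fst E) \<and> balanced E' \<and> equivalent_oriented E E'"
proof (intro exI conjI)
  let ?E' = "map (map_prod (map_node f) id) E"
  show E': "map fst ?E' = map (map_node f) (map fst E)"
    by simp
  show "balanced ?E'"
    using assms(2) unfolding balanced_def sum_list_map_node by simp
  have "transported f E (bracket (map fst E)) ?E' (bracket (map fst ?E'))"
    unfolding E' by (rule transported_no_change)
      (simp_all only: bracket_relabel[OF assms(1)] crossing_types_by_map_node)
  then show "equivalent_oriented E ?E'"
    using graph_equivalence_relabel[OF assms(1)] unfolding equivalent_oriented_def E' by blast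
qed

lemma erase_joint_equivalent:
  assumes "a \<noteq> b" "map fst E = Joint a b # D" "balanced E" "every_edge_has_two_ends (Joint a b # D)"
  shows "\<exists>E'. map fst E' = map (map_node (id(b := a))) D \<and> balanced E' \<and> equivalent_oriented E E'"
proof -
  define h where "h = id(b := a)"
  obtain u v E0 where E: "E = (Joint a b, u, v) # E0" "map fst E0 = D"
    using assms(2) by (cases E) auto
  \<comment> \<open>Only one end of \<open>a\<close> is at the joint, since \<open>a\<close> and
    \<open>b\<close> differ. The other end lies in \<open>D\<close>, so the contraction does not
    lose a component.\<close>
  have "count_list (concat (map ends (Joint a b # D))) a = 2"
    using assms(4) unfolding every_edge_has_two_ends_def by simp
  then have "count_list (concat (map ends D)) a \<noteq> 0"
    using assms(1) by simp
  then have aD: "a \<in> labels D \<or> b \<in> labels D"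
    using count_notin[of a "concat (map ends D)"] by (auto simp: labels_def)
  let ?E' = "map (map_prod (map_node h) id) E0"
  have E': "map fst ?E' = map (map_node h) D"
    using E(2) by auto
  have "balanced ?E'"
  proof -
    have "image_mset h (sum_list (map ins E)) = image_mset h (sum_list (map outs E))"
      using assms(3) by (simp add: balanced_def)
    moreover have "h a = a" "h b = a"
      by (simp_all add: h_def)
    ultimately show ?thesis
      unfolding balanced_def sum_list_map_node by (cases u) (simp_all add: E(1))
  qed
  moreover have "equivalent_oriented E ?E'"
    unfolding equivalent_oriented_def E' assms(2)
  proof (intro exI conjI)
    show "graph_equivalence h id (labels (Joint a b # D)) (link_relation (Joint a b # D))
      (labels (map (map_node h) D)) (link_relation (map (map_node h) D))"
      by (rule graph_equivalence_contract[OF h_def assms(1) _ _ aD]) auto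
    have "bracket (Joint a b # D) = bracket (map (map_node h) D)"
      unfolding h_def using assms(1) aD by (rule bracket_contract)
    moreover have "crossing_types_by c E = crossing_types_by c E0" for c :: "nat \<Rightarrow> nat set"
      by (simp add: E(1) crossing_types_by_def)
    ultimately show "transported h E (bracket (Joint a b # D)) ?E' (bracket (map (map_node h) D))"
      by (intro transported_no_change) (simp_all only: crossing_types_by_map_node)
  qed
  ultimately show ?thesis
    using E' unfolding h_def by blast
qed

lemma local_move_equivalent:
  assumes "local_move T T'" "map fst E = T" "balanced (E @ E0)"
    and "every_edge_has_two_ends (T @ map fst E0)" "every_edge_has_two_ends (T' @ map fst E0)"
  shows "\<exists>E''. map fst E'' = T' @ map fst E0 \<and> balanced E'' \<and> equivalent_oriented (E @ E0) E''"
  using assms(1)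
proof cases
  case (rotate_Cross a b c d)
  with assms show ?thesis using rotate_Cross_equivalent by auto
next
  case (rotate_Virt a b c d)
  with assms show ?thesis using rotate_Virt_equivalent by auto
next
  case (rotate_Joint a b)
  with assms show ?thesis using rotate_Joint_equivalent by auto
next
  case (R1 b a c)
  with assms show ?thesis using R1_equivalent by auto
next
  case (R1' a b c)
  with assms show ?thesis using R1'_equivalent by auto
next
  case (virtual_R1 b a c)
  with assms show ?thesis using virtual_R1_equivalent by auto
next
  case (R2 a b e f d c)
  with assms show ?thesis using R2_equivalent[of E a b e f d c E0] by auto
next
  case (virtual_R2 a b e f d c)
  with assms show ?thesis using virtual_R2_equivalent[of E a b e f d c E0] by auto
next
  case (R3 X12 X13 X23 a1 a2 x y a3 b3 z b2 b1 u v w)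
  then show ?thesis
    using R3_equivalent[where ?X12.0 = X12 and ?X13.0 = X13 and ?X23.0 = X23, OF R3(3,1,2) assms(2,3,4,5)] by blast
qed

lemma move_equivalent:
  assumes "move D D'" "map fst E = D" "balanced E"
    and "every_edge_has_two_ends D" "every_edge_has_two_ends D'"
  shows "\<exists>E'. map fst E' = D' \<and> balanced E' \<and> equivalent_oriented E E'"
  using assms(1)
proof cases
  case (local T T' D0)
  obtain E1 E0 where E: "E = E1 @ E0" "map fst E1 = T" "map fst E0 = D0"
    using assms(2) local(1) by (auto simp: map_eq_append_conv)
  show ?thesis
    using local_move_equivalent[OF local(3) E(2)] assms(3-5) local(1,2) E by auto
next
  case reorder
  then show ?thesis
    using reorder_equivalent assms(2,3) by blast
next
  case (relabel f)
  then show ?thesis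
    using relabel_equivalent assms(2,3) by blast
next
  case (erase_joint a b D0)
  then show ?thesis
    using erase_joint_equivalent[OF erase_joint(3), of E D0] assms(2-4)
    unfolding erase_joint(1,2) by blast
qed

section \<open>Transfer of the multi-core decomposition\<close>

definition types_between :: "'c set \<Rightarrow> ('c set \<times> int) multiset \<Rightarrow> ('c set \<times> int) multiset" where
  "types_between s X = {#p \<in># X. fst p = s#}"

definition self_count :: "int \<Rightarrow> ('c set \<times> int) multiset \<Rightarrow> nat" where
  "self_count e X = size {#p \<in># X. is_singleton (fst p) \<and> snd p = e#}"

definition mixed_count :: "('c set \<times> int) multiset \<Rightarrow> nat" where
  "mixed_count X = size {#p \<in># X. \<not> is_singleton (fst p)#}"

lemma filter_crossing_types:
  "filter_mset P (crossing_types D I)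
    = image_mset (\<lambda>i. (components_at D i, crossing_sign I i))
        (mset_set {i \<in> classical D. P (components_at D i, crossing_sign I i)})"
  by (simp add: crossing_types_def filter_mset_image_mset filter_mset_mset_set)

lemma finite_mixed_crossings [simp]: "finite (mixed_crossings D)"
  by (simp add: mixed_crossings_def)

lemma finite_mixed_between [simp]: "finite (mixed_between D K K')"
  by (rule finite_subset[OF _ finite_mixed_crossings[of D]]) (auto simp: mixed_between_def)

lemma s_pos_eq: "s_pos D I = self_count 1 (crossing_types D I)"
  unfolding s_pos_def self_count_def filter_crossing_types self_crossings_def
  by (simp add: is_singleton_def conj_assoc)

lemma s_neg_eq: "s_neg D I = self_count (-1) (crossing_types D I)"
  unfolding s_neg_def self_count_def filter_crossing_types self_crossings_def
  by (simp add: is_singleton_def conj_assoc)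

lemma card_mixed_crossings_eq: "card (mixed_crossings D) = mixed_count (crossing_types D I)"
proof -
  have "mixed_crossings D = {i \<in> classical D. \<not> is_singleton (components_at D i)}"
    by (auto simp: mixed_crossings_def self_crossings_def is_singleton_def)
  then show ?thesis
    unfolding mixed_count_def filter_crossing_types by simp
qed

lemma mixed_between_eq:
  assumes "K \<noteq> K'"
  shows "mixed_between D K K' = {i \<in> classical D. components_at D i = {K, K'}}"
  using assms by (auto simp: mixed_between_def mixed_crossings_def self_crossings_def doubleton_eq_iff)

lemma mixed_between_self: "mixed_between D K K = {}"
  by (auto simp: mixed_between_def mixed_crossings_def self_crossings_def)

lemma mixed_between_commute: "mixed_between D K K' = mixed_between D K' K"
  by (simp add: mixed_between_def insert_commute)

lemma card_mixed_between_eq: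
  "K \<noteq> K' \<Longrightarrow> card (mixed_between D K K') = size (types_between {K, K'} (crossing_types D I))"
  by (simp add: types_between_def filter_crossing_types mixed_between_eq)

definition linking :: "diagram \<Rightarrow> (nat \<times> nat) set \<Rightarrow> nat set \<Rightarrow> nat set \<Rightarrow> int" where
  "linking D I K K' = (\<Sum>i\<in>mixed_between D K K'. crossing_sign I i)"

lemma linking_eq:
  "K \<noteq> K' \<Longrightarrow> linking D I K K'
    = sum_mset (image_mset snd (types_between {K, K'} (crossing_types D I)))"
  by (simp add: linking_def types_between_def filter_crossing_types mixed_between_eq
      image_mset.compositionality comp_def sum_unfold_sum_mset)

lemma finite_components [simp]: "finite (components D)"
  by (simp add: components_def pieces_def quotient_def)

lemma component_of_in_components: "x \<in> labels D \<Longrightarrow> component_of D x \<in> components D"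
  by (simp add: component_of_def components_def pieces_def quotientI)

lemma components_at_subset:
  assumes "i \<in> classical D"
  shows "components_at D i \<subseteq> components D" "components_at D i \<noteq> {}"
proof -
  have "(i, 0) \<in> darts D" "(i, 1) \<in> darts D"
    using assms by (auto simp: classical_def darts_def)
  then show "components_at D i \<subseteq> components D"
    by (auto simp: components_at_def intro!: component_of_in_components label_at_in_labels)
  show "components_at D i \<noteq> {}"
    by (simp add: components_at_def)
qed

lemma odd_sum_cong:
  fixes f g :: "'a \<Rightarrow> nat"
  shows "(\<And>x. x \<in> A \<Longrightarrow> even (f x) \<longleftrightarrow> even (g x)) \<Longrightarrow> even (sum f A) \<longleftrightarrow> even (sum g A)"
  by (induction A rule: infinite_finite_induct) auto

text \<open>The union is disjoint because a crossing and one of its components determine the other;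
  the term for \<open>K' = K\<close> vanishes.\<close>

lemma odd_in_iff:
  assumes "finite S"
  shows "odd_in D S K \<longleftrightarrow> odd (\<Sum>K'\<in>S. card (mixed_between D K K'))"
proof -
  have "card (\<Union>K'\<in>S. mixed_between D K K') = (\<Sum>K'\<in>S. card (mixed_between D K K'))"
    by (rule card_UN_disjoint) (use assms in \<open>auto simp: mixed_between_def doubleton_eq_iff\<close>)
  then show ?thesis
    by (simp add: odd_in_def)
qed

lemma delete_odd_funpow_subset: "(delete_odd D ^^ n) S \<subseteq> S"
  by (induction n) (auto simp: delete_odd_def)

lemma core_subset: "core D S \<subseteq> S"
  unfolding core_def using INT_lower[of 0 UNIV "\<lambda>n. (delete_odd D ^^ n) S"] by simp

lemma mantle_subset: "mantle D r \<subseteq> components D"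
  by (induction r) auto

text \<open>Cores depend on crossing numbers only through their parities. Equal numbers could not be
  asked for, since the second Reidemeister move changes them by two.\<close>

locale component_bijection =
  fixes D D' :: diagram and \<Phi> :: "nat set \<Rightarrow> nat set"
  assumes bij: "bij_betw \<Phi> (components D) (components D')"
    and parity: "\<And>K K'. K \<in> components D \<Longrightarrow> K' \<in> components D \<Longrightarrow> K \<noteq> K' \<Longrightarrow>
      even (card (mixed_between D' (\<Phi> K) (\<Phi> K'))) \<longleftrightarrow> even (card (mixed_between D K K'))"
begin

lemma inj: "inj_on \<Phi> (components D)"
  using bij by (simp add: bij_betw_def)

lemma odd_in_transfer:
  assumes "S \<subseteq> components D" "K \<in> components D"
  shows "odd_in D' (\<Phi> ` S) (\<Phi> K) \<longleftrightarrow> odd_in D S K"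
proof -
  have "finite S"
    using assms(1) finite_components by (rule finite_subset)
  have "(\<Sum>K'\<in>\<Phi> ` S. card (mixed_between D' (\<Phi> K) K')) = (\<Sum>K'\<in>S. card (mixed_between D' (\<Phi> K) (\<Phi> K')))"
    by (subst sum.reindex) (use inj_on_subset[OF inj assms(1)] in auto)
  moreover have "even (\<Sum>K'\<in>S. card (mixed_between D' (\<Phi> K) (\<Phi> K'))) \<longleftrightarrow> even (\<Sum>K'\<in>S. card (mixed_between D K K'))"
  proof (rule odd_sum_cong)
    fix K' assume "K' \<in> S"
    then show "even (card (mixed_between D' (\<Phi> K) (\<Phi> K'))) \<longleftrightarrow> even (card (mixed_between D K K'))"
      using parity[of K K'] assms by (cases "K = K'") (auto simp: mixed_between_self)
  qed
  ultimately show ?thesis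
    using \<open>finite S\<close> by (simp add: odd_in_iff)
qed

lemma delete_odd_transfer:
  "S \<subseteq> components D \<Longrightarrow> delete_odd D' (\<Phi> ` S) = \<Phi> ` delete_odd D S"
  using odd_in_transfer by (auto simp: delete_odd_def)

lemma delete_odd_funpow_transfer:
  assumes "S \<subseteq> components D"
  shows "(delete_odd D' ^^ n) (\<Phi> ` S) = \<Phi> ` (delete_odd D ^^ n) S"
proof (induction n)
  case (Suc n)
  then show ?case
    using delete_odd_transfer[of "(delete_odd D ^^ n) S"] delete_odd_funpow_subset[of n D S] assms
    by simp
qed simp

lemma core_transfer:
  assumes "S \<subseteq> components D"
  shows "core D' (\<Phi> ` S) = \<Phi> ` core D S"
  unfolding core_def delete_odd_funpow_transfer[OF assms]
  by (rule image_INT[symmetric, OF inj]) (use delete_odd_funpow_subset assms in blast)+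

lemma mantle_transfer: "mantle D' r = \<Phi> ` mantle D r"
proof (induction r)
  case 0
  then show ?case using bij by (simp add: bij_betw_def)
next
  case (Suc r)
  have "mantle D r - core D (mantle D r) \<subseteq> components D" "core D (mantle D r) \<subseteq> components D"
    using mantle_subset[of D r] core_subset[of D "mantle D r"] by auto
  from inj_on_image_set_diff[OF inj this] Suc show ?case
    by (simp add: core_transfer mantle_subset)
qed

lemma core_separation_transfer:
  assumes "K \<in> components D" "K' \<in> components D"
  shows "core_separation D' (\<Phi> K) (\<Phi> K') = core_separation D K K'"
proof -
  have "\<Phi> L \<in> core D' (mantle D' r) \<longleftrightarrow> L \<in> core D (mantle D r)" if "L \<in> components D" for L r
    unfolding mantle_transfer core_transfer[OF mantle_subset]
    using inj that by (rule inj_on_image_mem_iff) (use core_subset mantle_subset in blast)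
  with assms show ?thesis
    by (simp add: core_separation_def)
qed

lemma lambda_tilde_transfer:
  assumes "\<And>K K'. K \<in> components D \<Longrightarrow> K' \<in> components D \<Longrightarrow> K \<noteq> K' \<Longrightarrow>
    linking D' I' (\<Phi> K) (\<Phi> K') = linking D I K K'"
  shows "lambda_tilde D' I' = lambda_tilde D I"
proof -
  have "modified_lk D' I' (\<Phi> K) (\<Phi> K') = modified_lk D I K K'"
    if "K \<in> components D" "K' \<in> components D" "K \<noteq> K'" for K K'
  proof -
    have "pair_parity D' (\<Phi> K) (\<Phi> K') = pair_parity D K K'"
      using parity[OF that] by (simp add: pair_parity_def mod2_eq_if)
    moreover have "lk D' I' (\<Phi> K) (\<Phi> K') = lk D I K K'"
      using assms[OF that] by (simp add: lk_def linking_def)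
    ultimately show ?thesis
      using core_separation_transfer[OF that(1,2)] by (simp add: modified_lk_def)
  qed
  moreover have "(\<Sum>K'\<in>components D' - {\<Phi> K}. modified_lk D' I' (\<Phi> K) K')
      = (\<Sum>K'\<in>components D - {K}. modified_lk D' I' (\<Phi> K) (\<Phi> K'))" if "K \<in> components D" for K
  proof -
    have "bij_betw \<Phi> (components D - {K}) (components D' - {\<Phi> K})"
      using that bij_betwE[OF bij] by (intro bij_betw_DiffI[OF bij]) (auto simp: bij_betw_def)
    then show ?thesis
      by (simp add: sum.reindex_bij_betw[symmetric])
  qed
  ultimately have "(\<Sum>K'\<in>components D' - {\<Phi> K}. modified_lk D' I' (\<Phi> K) K')
      = (\<Sum>K'\<in>components D - {K}. modified_lk D I K K')" if "K \<in> components D" for K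
    using that by (auto intro!: sum.cong)
  then show ?thesis
    unfolding lambda_tilde_def sum.reindex_bij_betw[OF bij, symmetric] by simp
qed

end

section \<open>Invariance under the moves\<close>

text \<open>The formula with its ingredients as free parameters, so that the effect of a move
  becomes a calculation with these numbers.\<close>

definition jones_value :: "complex \<Rightarrow> nat \<Rightarrow> nat \<Rightarrow> nat \<Rightarrow> laurent \<Rightarrow> laurent" where
  "jones_value l p n m B =
     Poly_Mapping.single 0 ((-1) powr (l - of_nat n - of_nat m / 2))
     * q_half_powi (2 * int p - 4 * int n - int m) * B"

lemma unoriented_jones_eq:
  "unoriented_jones D I = jones_value (lambda_tilde D I) (self_count 1 (crossing_types D I))
     (self_count (-1) (crossing_types D I)) (mixed_count (crossing_types D I)) (bracket D)"
  by (simp add: unoriented_jones_def jones_value_def Let_def s_pos_eq s_neg_eq card_mixed_crossings_eq[of D I])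

lemma minus_one_powr_diff_1: "(-1 :: complex) powr (z - 1) = - ((-1) powr z)"
  by (simp add: powr_diff)

text \<open>The cases are a positive self-crossing, a negative one, a cancelling pair within one
  component, and one between two components. In the last three \<open>s_neg\<close> or half of
  \<open>m\<close> grows by one, which flips the sign and compensates the minus in the
  bracket.\<close>

lemma jones_value_shift:
  "jones_value l (Suc p) n m (q_powi (-1) * B) = jones_value l p n m B"
  "jones_value l p (Suc n) m (- (q_powi 2 * B)) = jones_value l p n m B"
  "jones_value l (Suc p) (Suc n) m (- (q_powi 1 * B)) = jones_value l p n m B"
  "jones_value l p n (Suc (Suc m)) (- (q_powi 1 * B)) = jones_value l p n m B"
proof -
  have single: "Poly_Mapping.single 0 x * Poly_Mapping.single i 1 * (Poly_Mapping.single j 1 * B)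
      = Poly_Mapping.single (i + j) x * B" for i j :: int and x :: complex
    by (simp add: mult_single mult.assoc[symmetric])
  have exponent: "l - of_nat (Suc n) - of_nat m / 2 = (l - of_nat n - of_nat m / 2) - 1"
    "l - of_nat n - of_nat (Suc (Suc m)) / 2 = (l - of_nat n - of_nat m / 2) - 1"
    by (simp_all add: field_simps)
  show "jones_value l (Suc p) n m (q_powi (-1) * B) = jones_value l p n m B"
    by (simp add: jones_value_def q_powi_def q_half_powi_def single mult_single algebra_simps)
  show "jones_value l p (Suc n) m (- (q_powi 2 * B)) = jones_value l p n m B"
    unfolding jones_value_def exponent minus_one_powr_diff_1
    by (simp add: q_powi_def q_half_powi_def single mult_single single_uminus algebra_simps)
  show "jones_value l (Suc p) (Suc n) m (- (q_powi 1 * B)) = jones_value l p n m B"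
    unfolding jones_value_def exponent minus_one_powr_diff_1
    by (simp add: q_powi_def q_half_powi_def single mult_single single_uminus algebra_simps)
  show "jones_value l p n (Suc (Suc m)) (- (q_powi 1 * B)) = jones_value l p n m B"
    unfolding jones_value_def exponent minus_one_powr_diff_1
    by (simp add: q_powi_def q_half_powi_def single mult_single single_uminus algebra_simps)
qed

lemma reidemeister_change_jones_value:
  assumes "reidemeister_change X B Y B'"
  shows "jones_value l (self_count 1 X) (self_count (-1) X) (mixed_count X) B
    = jones_value l (self_count 1 Y) (self_count (-1) Y) (mixed_count Y) B'"
  using assms
proof cases
  case (remove_pair k k')
  then show ?thesis
    \<comment> \<open>The pair consists of self-crossings or of mixed crossings; both give the same
      power of \<open>q\<close> and the same sign.\<close>
    by (cases "k = k'") (simp_all add: self_count_def mixed_count_def jones_value_shift is_singleton_def doubleton_eq_iff)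
qed (simp_all add: self_count_def mixed_count_def jones_value_shift)

text \<open>A removed self-crossing does not lie between two components, and a removed pair has
  total sign 0 and even size.\<close>

lemma reidemeister_change_types_between:
  assumes "reidemeister_change X B Y B'" "\<not> is_singleton s"
  shows "sum_mset (image_mset snd (types_between s X)) = sum_mset (image_mset snd (types_between s Y))"
    and "even (size (types_between s X)) \<longleftrightarrow> even (size (types_between s Y))"
  using assms by (cases; auto simp: types_between_def)+

lemma crossing_types_by_image:
  "crossing_types_by (h \<circ> c) E = image_mset (map_prod (image h) id) (crossing_types_by c E)"
proof -
  have "crossing_type (h \<circ> c) e = image_mset (map_prod (image h) id) (crossing_type c e)" for e
    by (cases e rule: ins.cases) auto
  then show ?thesis
    unfolding crossing_types_by_def by (induction E) simp_all
qed

lemma equivalent_oriented_jones: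
  assumes "equivalent_oriented E E'"
  shows "unoriented_jones (map fst E) (in_darts E) = unoriented_jones (map fst E') (in_darts E')"
proof -
  let ?D = "map fst E" and ?D' = "map fst E'" and ?I = "in_darts E" and ?I' = "in_darts E'"
  obtain f g where graph: "graph_equivalence f g (labels ?D) (link_relation ?D) (labels ?D') (link_relation ?D')"
    and transported: "transported f E (bracket ?D) E' (bracket ?D')"
    using assms unfolding equivalent_oriented_def by blast
  define \<Phi> where "\<Phi> K = connectivity (link_relation ?D') `` (f ` K)" for K
  have bij: "bij_betw \<Phi> (components ?D) (components ?D')"
    unfolding \<Phi>_def components_def by (rule graph_equivalence_bij_betw[OF graph])
  define X where "X = crossing_types ?D ?I"
  define Z where "Z = image_mset (map_prod (image \<Phi>) id) X"
  define Y where "Y = crossing_types ?D' ?I'"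
  \<comment> \<open>The new components, pulled back along \<open>f\<close>, colour the old edges by
    the images of their own components. Thus the change of types compares \<open>Z\<close>, the old
    types renamed by \<Phi>, with \<open>Y\<close>.\<close>
  have "component_of ?D' \<circ> f = \<Phi> \<circ> component_of ?D"
    by (simp add: fun_eq_iff \<Phi>_def component_of_def graph_equivalence_Image[OF graph])
  moreover have "crossing_types_by (component_of ?D) E = X"
    by (simp add: X_def crossing_types_in_darts crossing_types_by_def)
  ultimately have Z: "crossing_types_by (component_of ?D' \<circ> f) E = Z"
    by (simp only: crossing_types_by_image Z_def)
  have Y: "crossing_types_by (component_of ?D') E' = Y"
    by (simp add: Y_def crossing_types_in_darts crossing_types_by_def)
  have change: "reidemeister_change Z (bracket ?D) Y (bracket ?D')"
    unfolding Z[symmetric] Y[symmetric]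
    using transported unfolding transported_def
    by (elim allE[of _ "component_of ?D'"] impE)
      (auto simp: component_of_def connectivity_Image_eq_iff intro: connectivity_edge)
  have inj: "inj_on \<Phi> (components ?D)"
    using bij by (simp add: bij_betw_def)
  have X: "fst p \<subseteq> components ?D \<and> fst p \<noteq> {}" if p: "p \<in># X" for p
  proof -
    obtain i where "i \<in> classical ?D" "fst p = components_at ?D i"
      using p by (auto simp: X_def crossing_types_def)
    then show ?thesis
      using components_at_subset by simp
  qed
  have filter_Z: "size (filter_mset P Z) = size (filter_mset (\<lambda>p. P (map_prod (image \<Phi>) id p)) X)" for P
    by (simp add: Z_def filter_mset_image_mset)
  \<comment> \<open>Injectivity on components keeps self-crossings and mixed crossings apart under
    the renaming.\<close>
  have singleton: "is_singleton (\<Phi> ` s) \<longleftrightarrow> is_singleton s" if "s \<subseteq> components ?D" for s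
    using card_image[OF inj_on_subset[OF inj that]] by (simp add: is_singleton_altdef)
  have counts: "self_count e Z = self_count e X" "mixed_count Z = mixed_count X" for e
    unfolding self_count_def mixed_count_def filter_Z
    using X singleton by (auto intro!: arg_cong[of _ _ size] filter_mset_cong)
  have between: "types_between {\<Phi> K, \<Phi> K'} Z = image_mset (map_prod (image \<Phi>) id) (types_between {K, K'} X)"
    if "K \<in> components ?D" "K' \<in> components ?D" for K K'
  proof -
    have "\<Phi> ` fst p = {\<Phi> K, \<Phi> K'} \<longleftrightarrow> fst p = {K, K'}" if "p \<in># X" for p
      using inj_on_image_eq_iff[OF inj, of "fst p" "{K, K'}"] X[OF that] \<open>K \<in> _\<close> \<open>K' \<in> _\<close> by simp
    then show ?thesis
      unfolding types_between_def Z_def filter_mset_image_mset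
      by (auto intro!: arg_cong[of _ _ "image_mset _"] filter_mset_cong)
  qed
  have between_Y: "linking ?D' ?I' (\<Phi> K) (\<Phi> K') = linking ?D ?I K K'"
    "even (card (mixed_between ?D' (\<Phi> K) (\<Phi> K'))) \<longleftrightarrow> even (card (mixed_between ?D K K'))"
    if "K \<in> components ?D" "K' \<in> components ?D" "K \<noteq> K'" for K K'
  proof -
    have ne: "\<Phi> K \<noteq> \<Phi> K'"
      using inj that by (auto dest: inj_onD)
    then have "\<not> is_singleton {\<Phi> K, \<Phi> K'}"
      by (auto simp: is_singleton_def doubleton_eq_iff)
    note eq = reidemeister_change_types_between[OF change this]
    show "linking ?D' ?I' (\<Phi> K) (\<Phi> K') = linking ?D ?I K K'"
      using eq(1) unfolding linking_eq[OF ne] linking_eq[OF that(3)] between[OF that(1,2)]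
      by (simp add: X_def Y_def image_mset.compositionality comp_def)
    show "even (card (mixed_between ?D' (\<Phi> K) (\<Phi> K'))) \<longleftrightarrow> even (card (mixed_between ?D K K'))"
      using eq(2) unfolding card_mixed_between_eq[OF ne, of _ ?I'] card_mixed_between_eq[OF that(3), of _ ?I]
        between[OF that(1,2)] by (simp add: X_def Y_def)
  qed
  interpret component_bijection ?D ?D' \<Phi>
    by unfold_locales (fact bij, rule between_Y(2))
  have "lambda_tilde ?D' ?I' = lambda_tilde ?D ?I"
    by (rule lambda_tilde_transfer) (rule between_Y(1))
  then show ?thesis
    using reidemeister_change_jones_value[OF change, of "lambda_tilde ?D ?I"]
    by (simp add: unoriented_jones_eq counts X_def[symmetric] Y_def[symmetric])
qed

section \<open>Independence of the orientation\<close>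

text \<open>Each unordered pair is counted twice.\<close>

lemma even_symmetric_sum:
  fixes h :: "'a \<Rightarrow> 'a \<Rightarrow> int"
  assumes "finite V" "\<And>x y. h x y = h y x"
  shows "even (\<Sum>x\<in>V. \<Sum>y\<in>V - {x}. h x y)"
  using assms(1)
proof (induction V)
  case (insert a V)
  have "(\<Sum>y\<in>insert a V - {x}. h x y) = h x a + (\<Sum>y\<in>V - {x}. h x y)" if "x \<in> V" for x
  proof -
    have "insert a V - {x} = insert a (V - {x})"
      using that insert.hyps(2) by auto
    then show ?thesis
      using insert.hyps by simp
  qed
  then have "(\<Sum>x\<in>V. \<Sum>y\<in>insert a V - {x}. h x y) = (\<Sum>x\<in>V. h x a) + (\<Sum>x\<in>V. \<Sum>y\<in>V - {x}. h x y)"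
    by (simp add: sum.distrib)
  moreover have "insert a V - {a} = V"
    using insert.hyps(2) by auto
  ultimately have "(\<Sum>x\<in>insert a V. \<Sum>y\<in>insert a V - {x}. h x y)
      = 2 * (\<Sum>x\<in>V. h a x) + (\<Sum>x\<in>V. \<Sum>y\<in>V - {x}. h x y)"
    using insert.hyps assms(2)[of a] by simp
  with insert.IH show ?case
    by simp
qed simp

lemma sum_off_diagonal_commute:
  fixes h :: "'a \<Rightarrow> 'a \<Rightarrow> int"
  assumes "finite V"
  shows "(\<Sum>x\<in>V. \<Sum>y\<in>V - {x}. h x y) = (\<Sum>x\<in>V. \<Sum>y\<in>V - {x}. h y x)"
proof -
  have off: "(\<Sum>y\<in>V - {x}. k x y) = (\<Sum>y\<in>V. if x = y then 0 else k x y)" for x and k :: "'a \<Rightarrow> 'a \<Rightarrow> int"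
    using assms by (intro sum.mono_neutral_cong_left) auto
  show ?thesis
    unfolding off[where k = h] off[where k = "\<lambda>x y. h y x"] by (subst sum.swap) (auto intro!: sum.cong)
qed

text \<open>The sum will be the change of \<open>4 * lambda_tilde\<close> when the components with \<open>\<delta> = 1\<close> are reversed.\<close>

lemma sum_reversal_dvd:
  fixes h w :: "'a \<Rightarrow> 'a \<Rightarrow> int" and \<delta> :: "'a \<Rightarrow> int"
  assumes "finite V" "\<And>x y. h x y = h y x" "\<And>x y. w x y = w y x"
    and "\<And>x. x \<in> V \<Longrightarrow> even (\<Sum>y\<in>V - {x}. w x y)"
  shows "8 dvd (\<Sum>x\<in>V. \<Sum>y\<in>V - {x}. 4 * h x y - 2 * (\<delta> x + \<delta> y) * w x y)"
proof -
  have "even (\<Sum>x\<in>V. \<Sum>y\<in>V - {x}. h x y)"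
    using assms(1,2) by (rule even_symmetric_sum)
  then obtain j where j: "(\<Sum>x\<in>V. \<Sum>y\<in>V - {x}. h x y) = 2 * j"
    by (elim evenE)
  \<comment> \<open>The even row sums give one factor 2. Another comes from collecting the terms
    with \<open>\<delta> x\<close> and \<open>\<delta> y\<close>, which have equal sums by
    symmetry.\<close>
  have "even (\<Sum>x\<in>V. \<delta> x * (\<Sum>y\<in>V - {x}. w x y))"
    by (rule dvd_sum) (simp add: assms(4))
  then obtain k where k: "(\<Sum>x\<in>V. \<delta> x * (\<Sum>y\<in>V - {x}. w x y)) = 2 * k"
    by (elim evenE)
  have "(\<Sum>x\<in>V. \<Sum>y\<in>V - {x}. \<delta> y * w x y) = (\<Sum>x\<in>V. \<delta> x * (\<Sum>y\<in>V - {x}. w x y))"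
    by (subst sum_off_diagonal_commute[OF assms(1)]) (simp add: sum_distrib_left assms(3))
  moreover have "(\<Sum>x\<in>V. \<Sum>y\<in>V - {x}. \<delta> x * w x y) = (\<Sum>x\<in>V. \<delta> x * (\<Sum>y\<in>V - {x}. w x y))"
    by (simp add: sum_distrib_left)
  ultimately have "(\<Sum>x\<in>V. \<Sum>y\<in>V - {x}. 4 * h x y - 2 * (\<delta> x + \<delta> y) * w x y)
      = 4 * (2 * j) - 2 * (2 * k + 2 * k)"
    unfolding j[symmetric] k[symmetric]
    by (simp add: sum_subtractf sum.distrib sum_distrib_left[symmetric] distrib_right mult.assoc)
  then show ?thesis
    by simp
qed

section \<open>Cores and parities of linking numbers\<close>

text \<open>A core is defined as an infinite intersection; finiteness makes it a member of the
  decreasing sequence, so that one more deletion removes nothing.\<close>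

lemma core_stationary:
  assumes "finite S"
  shows "delete_odd D (core D S) = core D S"
proof -
  have antitone: "(delete_odd D ^^ n) S \<subseteq> (delete_odd D ^^ m) S" if "m \<le> n" for m n
    using delete_odd_funpow_subset[of "n - m" D "(delete_odd D ^^ m) S"] that
    by (simp add: funpow_add[symmetric, unfolded comp_def fun_eq_iff, rule_format])
  have "\<forall>K\<in>S - core D S. \<exists>n. K \<notin> (delete_odd D ^^ n) S"
    by (auto simp: core_def)
  then obtain n where n: "\<And>K. K \<in> S - core D S \<Longrightarrow> K \<notin> (delete_odd D ^^ n K) S"
    by metis
  \<comment> \<open>The sum bounds every stage \<open>n K\<close> at which a component is known to
    be gone, and it also makes sense when nothing is deleted.\<close>
  define N where "N = (\<Sum>K\<in>S - core D S. n K)"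
  have "(delete_odd D ^^ N) S \<subseteq> core D S"
  proof
    fix K assume K: "K \<in> (delete_odd D ^^ N) S"
    show "K \<in> core D S"
    proof (rule ccontr)
      assume "K \<notin> core D S"
      with K delete_odd_funpow_subset have "K \<in> S - core D S"
        by blast
      moreover from this assms have "n K \<le> N"
        unfolding N_def by (intro member_le_sum) auto
      ultimately show False
        using antitone K n by blast
    qed
  qed
  then have N: "core D S = (delete_odd D ^^ N) S"
    by (auto simp: core_def)
  have "core D S \<subseteq> (delete_odd D ^^ Suc N) S"
    unfolding core_def by blast
  then show ?thesis
    by (auto simp: N delete_odd_def)
qed

text \<open>A core is removed from all later mantles. Hence the components not separated from a
  member of a core are exactly those of this one core.\<close>

lemma core_disjoint:
  assumes "K \<in> core D (mantle D r)" "K \<in> core D (mantle D r')"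
  shows "r = r'"
proof -
  have antitone: "mantle D n \<subseteq> mantle D m" if "m \<le> n" for m n
    using that by (induction rule: dec_induct) auto
  have False if "K \<in> core D (mantle D a)" "K \<in> core D (mantle D b)" "a < b" for a b
  proof -
    have "K \<in> mantle D (Suc a)"
      using that(2) core_subset antitone[of "Suc a" b] that(3) by fastforce
    with that(1) show False by simp
  qed
  with assms show ?thesis
    by (metis linorder_neqE_nat)
qed

lemma core_separation_commute: "core_separation D K K' = core_separation D K' K"
  by (auto simp: core_separation_def)

lemma crossing_sign_cases: "crossing_sign I i = 1 \<or> crossing_sign I i = -1"
  by (simp add: crossing_sign_def)

lemma even_linking: "even (linking D I K K') \<longleftrightarrow> even (card (mixed_between D K K'))"
proof -
  have "even (sum (crossing_sign I) A) \<longleftrightarrow> even (card A)" if "finite A" for A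
    using that
  proof (induction A)
    case (insert i A)
    then show ?case
      using crossing_sign_cases[of I i] by auto
  qed simp
  then show ?thesis
    by (simp add: linking_def)
qed

lemma linking_commute: "linking D I K K' = linking D I K' K"
  by (simp add: linking_def mixed_between_commute)

text \<open>This provides the even rows for \<open>sum_reversal_dvd\<close>. Signs are odd, so a sum
  of them has the parity of the number of crossings; a component in no core has a zero row.\<close>

lemma even_core_row:
  assumes "K \<in> components D"
  shows "even (\<Sum>K'\<in>components D - {K}. if core_separation D K K' = 0 then linking D I K K' else 0)"
proof (cases "\<exists>r. K \<in> core D (mantle D r)")
  case True
  then obtain r where r: "K \<in> core D (mantle D r)" ..
  let ?C = "core D (mantle D r)"
  have C: "?C \<subseteq> components D"
    using core_subset mantle_subset by blast
  then have "finite ?C"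
    using finite_components by (rule finite_subset)
  have "finite (mantle D r)"
    using mantle_subset finite_components by (rule finite_subset)
  then have "K \<in> delete_odd D ?C"
    using core_stationary r by blast
  then have row: "even (\<Sum>K'\<in>?C. card (mixed_between D K K'))"
    using \<open>finite ?C\<close> by (simp add: delete_odd_def odd_in_iff)
  have "core_separation D K K' = 0 \<longleftrightarrow> K' \<in> ?C" for K'
    using r core_disjoint by (auto simp: core_separation_def)
  then have "(\<Sum>K'\<in>components D - {K}. if core_separation D K K' = 0 then linking D I K K' else 0)
      = (\<Sum>K'\<in>?C - {K}. linking D I K K')"
    using C by (intro sum.mono_neutral_cong_right) auto
  also have "\<dots> = (\<Sum>K'\<in>?C. linking D I K K')"
    using \<open>finite ?C\<close> r by (simp add: sum.remove[of ?C K] linking_def mixed_between_self)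
  finally have "(\<Sum>K'\<in>components D - {K}. if core_separation D K K' = 0 then linking D I K K' else 0)
      = (\<Sum>K'\<in>?C. linking D I K K')" .
  moreover have "even (\<Sum>K'\<in>?C. linking D I K K') \<longleftrightarrow> even (\<Sum>K'\<in>?C. card (mixed_between D K K'))"
    using \<open>finite ?C\<close> by (induction rule: finite_induct) (simp_all add: even_linking)
  ultimately show ?thesis
    using row by simp
next
  case False
  then have "core_separation D K K' \<noteq> 0" for K'
    by (auto simp: core_separation_def)
  then show ?thesis
    by (simp only: if_False sum.neutral_const even_zero)
qed

lemma minus_one_powr_of_int: "(-1 :: complex) powr of_int k = (if even k then 1 else -1)"
proof -
  have "(-1 :: complex) powr of_int k = (-1) powi k"
    by (rule complex_powr_of_int) simp
  then show ?thesis
    by (auto simp: power_int_minus_one_minus)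
qed

section \<open>The integer form of the modified linking numbers\<close>

text \<open>Twice the modified linking number. As \<open>w\<close> is twice the linking number and
  \<open>w mod 2\<close> the parity of the pair, \<open>(w + w mod 2) div 2\<close> is the exponent
  of -1 for separated components; it is always an integer.\<close>

definition modified_linking :: "diagram \<Rightarrow> (nat \<times> nat) set \<Rightarrow> nat set \<Rightarrow> nat set \<Rightarrow> int" where
  "modified_linking D I K K' = (let w = linking D I K K' in
     if core_separation D K K' = 0 \<or> even ((w + w mod 2) div 2) then w else - w)"

lemma modified_lk_eq: "modified_lk D I K K' = of_int (modified_linking D I K K') / 2"
proof -
  let ?w = "linking D I K K'"
  have "int (pair_parity D K K') = ?w mod 2"
    using even_linking[of D I K K'] by (auto simp: pair_parity_def mod2_eq_if)
  then have pair: "of_nat (pair_parity D K K') = (of_int (?w mod 2) :: complex)"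
    by (metis of_int_of_nat_eq)
  have "?w + ?w mod 2 = 2 * ((?w + ?w mod 2) div 2)"
    by (rule dvd_mult_div_cancel[symmetric]) (simp add: mod2_eq_if)
  then have "(of_int ?w + of_int (?w mod 2) :: complex) = 2 * of_int ((?w + ?w mod 2) div 2)"
    by (metis of_int_add of_int_mult of_int_numeral)
  then have "lk D I K K' + of_nat (pair_parity D K K') / 2 = of_int ((?w + ?w mod 2) div 2)"
    unfolding lk_def pair linking_def[symmetric] by (simp add: add_divide_distrib[symmetric])
  moreover have "core_separation D K K' = 0 \<or> core_separation D K K' = 1"
    by (simp add: core_separation_def)
  ultimately show ?thesis
    by (auto simp: modified_lk_def modified_linking_def minus_one_powr_of_int Let_def
        lk_def linking_def[symmetric])
qed

definition linking_sum :: "diagram \<Rightarrow> (nat \<times> nat) set \<Rightarrow> int" where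
  "linking_sum D I = (\<Sum>K\<in>components D. \<Sum>K'\<in>components D - {K}. modified_linking D I K K')"

lemma lambda_tilde_eq: "lambda_tilde D I = of_int (linking_sum D I) / 4"
  by (simp add: lambda_tilde_def modified_lk_eq linking_sum_def sum_divide_distrib[symmetric])

lemma modified_linking_commute: "modified_linking D I K K' = modified_linking D I K' K"
  by (simp add: modified_linking_def linking_commute[of _ _ K] core_separation_commute[of _ K])

text \<open>For even \<open>w\<close> the exponents \<open>w/2\<close> and \<open>-w/2\<close> have
  the same parity, so the value is negated and changes by \<open>2 w\<close>. For
  \<open>w = 2 k + 1\<close> the exponents are \<open>k + 1\<close> and \<open>-k\<close>, of
  opposite parity, so the two sign changes cancel.\<close>

lemma modified_linking_uminus:
  assumes "core_separation D K K' \<noteq> 0" "linking D I' K K' = - linking D I K K'"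
  shows "4 dvd modified_linking D I' K K' - modified_linking D I K K'"
proof (cases "even (linking D I K K')")
  case True
  then obtain k where "linking D I K K' = 2 * k" ..
  with assms show ?thesis
    by (auto simp: modified_linking_def Let_def)
next
  case False
  then obtain k where "linking D I K K' = 2 * k + 1" ..
  moreover have "- (2 * k) div 2 = - k"
    using nonzero_mult_div_cancel_left[of 2 "- k"] by simp
  ultimately show ?thesis
    using assms
    by (auto simp: modified_linking_def Let_def mod2_eq_if)
qed

lemma linking_sum_reversal:
  assumes sign: "\<And>K. \<epsilon> K = 1 \<or> \<epsilon> K = (-1 :: int)"
    and linking: "\<And>K K'. K \<noteq> K' \<Longrightarrow> linking D I' K K' = \<epsilon> K * \<epsilon> K' * linking D I K K'"
  shows "8 dvd linking_sum D I' - linking_sum D I"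
proof -
  let ?V = "components D"
  define w where "w K K' = (if core_separation D K K' = 0 then linking D I K K' else 0)" for K K'
  \<comment> \<open>With \<open>\<epsilon> = 1 - 2 \<delta>\<close>, the factor
    \<open>\<epsilon> K * \<epsilon> K' - 1\<close> equals
    \<open>4 \<delta> K \<delta> K' - 2 (\<delta> K + \<delta> K')\<close>. This is the origin of
    \<open>h\<close> and \<open>w\<close> within a core; elsewhere \<open>w\<close> is 0 and
    \<open>h\<close> is a quarter of the change.\<close>
  define \<delta> where "\<delta> K = (if \<epsilon> K = 1 then 0 else 1 :: int)" for K
  define h where "h K K' = (if core_separation D K K' = 0 then \<delta> K * \<delta> K' * linking D I K K'
      else (modified_linking D I' K K' - modified_linking D I K K') div 4)" for K K'
  have "modified_linking D I' K K' - modified_linking D I K K'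
      = 4 * h K K' - 2 * (\<delta> K + \<delta> K') * w K K'" if "K \<noteq> K'" for K K'
  proof (cases "core_separation D K K' = 0")
    case True
    then show ?thesis
      using linking[OF that] sign[of K] sign[of K']
      by (auto simp: modified_linking_def h_def w_def \<delta>_def)
  next
    case False
    have "linking D I' K K' = linking D I K K' \<or> linking D I' K K' = - linking D I K K'"
      using linking[OF that] sign[of K] sign[of K'] by auto
    then have "4 dvd modified_linking D I' K K' - modified_linking D I K K'"
      using modified_linking_uminus[OF False] by (auto simp: modified_linking_def)
    with False show ?thesis
      by (simp add: h_def w_def)
  qed
  then have "linking_sum D I' - linking_sum D I
      = (\<Sum>K\<in>?V. \<Sum>K'\<in>?V - {K}. 4 * h K K' - 2 * (\<delta> K + \<delta> K') * w K K')"
    unfolding linking_sum_def sum_subtractf[symmetric] by (intro sum.cong) auto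
  also have "8 dvd \<dots>"
  proof (rule sum_reversal_dvd)
    show "h K K' = h K' K" for K K'
      by (simp add: h_def core_separation_commute[of _ K] linking_commute[of _ _ K]
          modified_linking_commute[of _ _ K] mult.commute)
    show "w K K' = w K' K" for K K'
      by (simp add: w_def core_separation_commute[of _ K] linking_commute[of _ _ K])
    show "even (\<Sum>K'\<in>?V - {K}. w K K')" if "K \<in> ?V" for K
      using even_core_row[OF that] by (simp add: w_def)
  qed simp
  finally show ?thesis .
qed

lemma strands_label_at:
  assumes "i < length D" "(x, y) \<in> strands (D ! i)"
  shows "\<exists>s < length (ends (D ! i)) div 2.
    x = label_at D (i, s) \<and> y = label_at D (i, s + length (ends (D ! i)) div 2)"
proof (cases "D ! i")
  case (Cross a b c d)
  with assms(2) consider "x = a" "y = c" | "x = b" "y = d"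
    by auto
  then show ?thesis
    by cases (rule exI[of _ 0], simp add: Cross label_at_def, rule exI[of _ 1], simp add: Cross label_at_def)
next
  case (Virt a b c d)
  with assms(2) consider "x = a" "y = c" | "x = b" "y = d"
    by auto
  then show ?thesis
    by cases (rule exI[of _ 0], simp add: Virt label_at_def, rule exI[of _ 1], simp add: Virt label_at_def)
next
  case (Joint a b)
  with assms(2) show ?thesis
    by (intro exI[of _ 0]) (simp add: label_at_def)
qed

text \<open>Whether two orientations agree at a dart does not change along edges or strands, so each
  component is either kept or reversed as a whole. A sign changes when exactly one of the strands at
  the crossing is reversed.\<close>

lemma orientation_reversal:
  assumes I: "orientation D I" and I': "orientation D I'"
  obtains \<epsilon> where "\<And>K. \<epsilon> K = 1 \<or> \<epsilon> K = (-1 :: int)"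
    and "\<And>i. i \<in> classical D \<Longrightarrow> crossing_sign I' i
      = \<epsilon> (component_of D (label_at D (i, 0))) * \<epsilon> (component_of D (label_at D (i, 1))) * crossing_sign I i"
proof -
  define agree where "agree d \<longleftrightarrow> (d \<in> I \<longleftrightarrow> d \<in> I')" for d
  define A where "A = {x. \<exists>d\<in>darts D. label_at D d = x \<and> agree d}"
  have edge: "agree d \<longleftrightarrow> agree e" if "d \<in> darts D" "e \<in> darts D" "label_at D d = label_at D e" for d e
  proof (cases "d = e")
    case False
    with that I I' have "d \<in> I \<longleftrightarrow> e \<notin> I" "d \<in> I' \<longleftrightarrow> e \<notin> I'"
      unfolding orientation_def by blast+
    then show ?thesis
      by (auto simp: agree_def)
  qed simp
  have label: "label_at D d \<in> A \<longleftrightarrow> agree d" if "d \<in> darts D" for d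
  proof
    assume "label_at D d \<in> A"
    then obtain e where "e \<in> darts D" "label_at D e = label_at D d" "agree e"
      unfolding A_def by blast
    then show "agree d"
      using edge[OF \<open>e \<in> darts D\<close> that] by simp
  qed (use that in \<open>auto simp: A_def\<close>)
  have opposite: "(i, s) \<in> J \<longleftrightarrow> (i, s + length (ends (D ! i)) div 2) \<notin> J"
    if "orientation D J" "i < length D" "s < length (ends (D ! i)) div 2" for J i s
    using that unfolding orientation_def by blast
  have strand: "x \<in> A \<longleftrightarrow> y \<in> A" if xy: "(x, y) \<in> link_relation D" for x y
  proof -
    obtain i where "i < length D" "(x, y) \<in> strands (D ! i)"
      using xy by (auto simp: link_relation_def in_set_conv_nth)
    then obtain s where s: "s < length (ends (D ! i)) div 2" "x = label_at D (i, s)"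
      "y = label_at D (i, s + length (ends (D ! i)) div 2)"
      using strands_label_at by blast
    have "(i, s) \<in> darts D" "(i, s + length (ends (D ! i)) div 2) \<in> darts D"
      using s(1) \<open>i < length D\<close> by (auto simp: darts_def)
    moreover have "agree (i, s) \<longleftrightarrow> agree (i, s + length (ends (D ! i)) div 2)"
      using opposite[OF I \<open>i < length D\<close> s(1)] opposite[OF I' \<open>i < length D\<close> s(1)] by (simp add: agree_def)
    ultimately show ?thesis
      by (simp add: s label)
  qed
  \<comment> \<open>A component lies inside \<open>A\<close> or is disjoint from it, so testing for
    a common element is enough; sets that are no components also receive a sign.\<close>
  define \<epsilon> where "\<epsilon> K = (if K \<inter> A = {} then -1 else 1 :: int)" for K
  have component: "component_of D x \<inter> A = {} \<longleftrightarrow> x \<notin> A" for x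
  proof -
    have "y \<in> A \<longleftrightarrow> x \<in> A" if "y \<in> component_of D x" for y
      using connectivity_invariant[of x y "link_relation D" "\<lambda>z. z \<in> A"] strand that
      by (auto simp: component_of_def)
    moreover have "x \<in> component_of D x"
      by (simp add: component_of_def)
    ultimately show ?thesis by blast
  qed
  show ?thesis
  proof
    show "\<epsilon> K = 1 \<or> \<epsilon> K = -1" for K
      by (simp add: \<epsilon>_def)
  next
    fix i assume i: "i \<in> classical D"
    then have len: "i < length D" "length (ends (D ! i)) = 4"
      by (auto simp: classical_def)
    then have darts: "(i, 0) \<in> darts D" "(i, 1) \<in> darts D"
      by (auto simp: darts_def)
    have "(i, 3) \<in> J \<longleftrightarrow> (i, 1) \<notin> J" if "orientation D J" for J
      using opposite[OF that len(1), of 1] len(2) by (simp add: numeral_3_eq_3)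
    then have sign: "crossing_sign J i = (if (i, 0) \<in> J \<longleftrightarrow> (i, 1) \<notin> J then 1 else -1)"
      if "orientation D J" for J
      using that by (simp add: crossing_sign_def)
    have \<epsilon>: "\<epsilon> (component_of D (label_at D d)) = (if agree d then 1 else -1)" if "d \<in> darts D" for d
      using that by (simp add: \<epsilon>_def component label)
    show "crossing_sign I' i
      = \<epsilon> (component_of D (label_at D (i, 0))) * \<epsilon> (component_of D (label_at D (i, 1))) * crossing_sign I i"
      unfolding sign[OF I] sign[OF I'] \<epsilon>[OF darts(1)] \<epsilon>[OF darts(2)] by (auto simp: agree_def)
  qed
qed

lemma minus_one_powr_add_even: "(-1 :: complex) powr (z + 2 * of_int k) = (-1) powr z"
proof -
  have "(-1 :: complex) powr (2 * of_int k) = 1"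
    using minus_one_powr_of_int[of "2 * k"] by simp
  then show ?thesis
    by (simp add: powr_add)
qed

lemma unoriented_jones_orientation:
  assumes "orientation D I" "orientation D I'"
  shows "unoriented_jones D I' = unoriented_jones D I"
proof -
  obtain \<epsilon> where \<epsilon>: "\<And>K. \<epsilon> K = 1 \<or> \<epsilon> K = (-1 :: int)"
    and sign: "\<And>i. i \<in> classical D \<Longrightarrow> crossing_sign I' i
      = \<epsilon> (component_of D (label_at D (i, 0))) * \<epsilon> (component_of D (label_at D (i, 1))) * crossing_sign I i"
    using orientation_reversal[OF assms] by blast
  have "crossing_sign I' i = crossing_sign I i" if "i \<in> self_crossings D" for i
  proof -
    have "component_of D (label_at D (i, 0)) = component_of D (label_at D (i, 1))"
      using that by (auto simp: self_crossings_def components_at_def)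
    moreover have "\<epsilon> K * \<epsilon> K = 1" for K
      using \<epsilon>[of K] by auto
    ultimately show ?thesis
      using sign[of i] that by (simp add: self_crossings_def)
  qed
  then have self: "s_pos D I' = s_pos D I" "s_neg D I' = s_neg D I"
    unfolding s_pos_def s_neg_def by (auto intro!: arg_cong[of _ _ card])
  have "linking D I' K K' = \<epsilon> K * \<epsilon> K' * linking D I K K'" if "K \<noteq> K'" for K K'
  proof -
    have "crossing_sign I' i = \<epsilon> K * \<epsilon> K' * crossing_sign I i" if "i \<in> mixed_between D K K'" for i
    proof -
      have "i \<in> classical D" "components_at D i = {K, K'}"
        using that by (auto simp: mixed_between_def mixed_crossings_def)
      then show ?thesis
        using sign[of i] by (auto simp: components_at_def doubleton_eq_iff)
    qed
    then show ?thesis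
      by (simp add: linking_def sum_distrib_left)
  qed
  with \<epsilon> have "8 dvd linking_sum D I' - linking_sum D I"
    by (rule linking_sum_reversal)
  \<comment> \<open>A change by \<open>8 k\<close> is a change of \<open>lambda_tilde\<close> by
    \<open>2 k\<close>, a multiple of the period of the power of -1.\<close>
  then obtain k where "linking_sum D I' - linking_sum D I = 8 * k" ..
  then have "linking_sum D I' = linking_sum D I + 8 * k"
    by (simp add: diff_eq_eq add.commute)
  then have "lambda_tilde D I' = lambda_tilde D I + 2 * of_int k"
    by (simp add: lambda_tilde_eq add_divide_distrib)
  then have "lambda_tilde D I' - of_nat n - of_nat m / 2
      = (lambda_tilde D I - of_nat n - of_nat m / 2) + 2 * of_int k" for n m
    by simp
  then show ?thesis
    by (simp only: unoriented_jones_def self minus_one_powr_add_even)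
qed

section \<open>Integrality\<close>

lemma lookup_single_times:
  "Poly_Mapping.lookup (Poly_Mapping.single k v * P) j = v * Poly_Mapping.lookup P (j - k :: int)"
proof -
  have "Poly_Mapping.lookup (Poly_Mapping.single k v) l * S = (v * S when k = l)" for l S
    by (simp add: lookup_single when_def)
  moreover have "j = k + q \<longleftrightarrow> q = j - k" for q
    by auto
  ultimately show ?thesis
    by (simp add: lookup_mult)
qed

lemma integer_laurent_single_times:
  "v \<in> \<int> \<Longrightarrow> P \<in> integer_laurent \<Longrightarrow> Poly_Mapping.single k v * P \<in> integer_laurent"
  by (simp add: integer_laurent_def lookup_single_times)

lemma integer_laurent_add: "P \<in> integer_laurent \<Longrightarrow> Q \<in> integer_laurent \<Longrightarrow> P + Q \<in> integer_laurent"
  by (simp add: integer_laurent_def lookup_add)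

lemma integer_laurent_diff: "P \<in> integer_laurent \<Longrightarrow> Q \<in> integer_laurent \<Longrightarrow> P - Q \<in> integer_laurent"
  by (simp add: integer_laurent_def lookup_minus)

lemma bracket_from_integer_laurent: "bracket_from S D \<in> integer_laurent"
proof (induction S D rule: bracket_from.induct)
  case (1 S)
  have "(q_powi (-1) + q_powi 1) ^ n \<in> integer_laurent" for n
  proof (induction n)
    case 0
    then show ?case
      by (auto simp: integer_laurent_def lookup_one when_def)
  next
    case (Suc n)
    then show ?case
      by (simp add: distrib_right integer_laurent_add integer_laurent_single_times q_powi_def q_half_powi_def)
  qed
  then show ?case by simp
next
  case (2 S a b c d D)
  then show ?case
    by (simp add: integer_laurent_diff integer_laurent_single_times q_powi_def q_half_powi_def)
qed simp_all

text \<open>A mixed crossing has two different components and is counted once for each of their two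
  orders.\<close>

lemma sum_card_mixed_between:
  "(\<Sum>K\<in>components D. \<Sum>K'\<in>components D - {K}. int (card (mixed_between D K K'))) = 2 * int (card (mixed_crossings D))"
proof -
  let ?V = "components D"
  have "int (card (mixed_between D K K')) = (\<Sum>i\<in>mixed_crossings D. of_bool (components_at D i = {K, K'}))" for K K'
    by (simp add: mixed_between_def sum_of_bool_eq Int_def conj_commute)
  then have "(\<Sum>K\<in>?V. \<Sum>K'\<in>?V - {K}. int (card (mixed_between D K K')))
      = (\<Sum>K\<in>?V. \<Sum>K'\<in>?V - {K}. \<Sum>i\<in>mixed_crossings D. of_bool (components_at D i = {K, K'}))"
    by simp
  also have "\<dots> = (\<Sum>i\<in>mixed_crossings D. \<Sum>K\<in>?V. \<Sum>K'\<in>?V - {K}. of_bool (components_at D i = {K, K'}))"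
  proof -
    have "(\<Sum>K'\<in>?V - {K}. \<Sum>i\<in>mixed_crossings D. of_bool (components_at D i = {K, K'}))
        = (\<Sum>i\<in>mixed_crossings D. \<Sum>K'\<in>?V - {K}. of_bool (components_at D i = {K, K'}) :: int)" for K
      by (rule sum.swap)
    then show ?thesis
      by simp (rule sum.swap)
  qed
  also have "\<dots> = (\<Sum>i\<in>mixed_crossings D. 2)"
  proof (rule sum.cong[OF refl])
    fix i assume "i \<in> mixed_crossings D"
    then have i: "i \<in> classical D" "\<nexists>K. components_at D i = {K}"
      by (auto simp: mixed_crossings_def self_crossings_def)
    then obtain L M where LM: "components_at D i = {L, M}" "L \<noteq> M"
      unfolding components_at_def by (metis insert_absorb2)
    then have V: "L \<in> ?V" "M \<in> ?V"
      using components_at_subset(1)[OF i(1)] by auto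
    have "(\<Sum>K'\<in>?V - {K}. of_bool (components_at D i = {K, K'}) :: int)
        = (if K = L then 1 else 0) + (if K = M then 1 else 0)" for K
    proof -
      have "(\<Sum>K'\<in>?V - {K}. of_bool (components_at D i = {K, K'}) :: int)
          = (\<Sum>K'\<in>?V - {K}. (if K' = M then if K = L then 1 else 0 else 0)
              + (if K' = L then if K = M then 1 else 0 else 0))"
        by (rule sum.cong) (use LM in \<open>auto simp: doubleton_eq_iff\<close>)
      then show ?thesis
        using LM(2) V by (simp add: sum.distrib)
    qed
    then show "(\<Sum>K\<in>?V. \<Sum>K'\<in>?V - {K}. of_bool (components_at D i = {K, K'})) = (2 :: int)"
      using V by (simp add: sum.distrib)
  qed
  finally show ?thesis by simp
qed

text \<open>Each term differs from its crossing number by an even integer, and the halves of these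
  differences are symmetric in the two components, so their sum is even once more.\<close>

lemma linking_sum_dvd: "4 dvd linking_sum D I - 2 * int (card (mixed_crossings D))"
proof -
  let ?V = "components D"
  define h where "h K K' = (modified_linking D I K K' - int (card (mixed_between D K K'))) div 2" for K K'
  have "modified_linking D I K K' - int (card (mixed_between D K K')) = 2 * h K K'" for K K'
  proof -
    have "even (modified_linking D I K K') \<longleftrightarrow> even (linking D I K K')"
      by (simp add: modified_linking_def Let_def)
    then show ?thesis
      by (simp add: h_def even_linking)
  qed
  then have "linking_sum D I - 2 * int (card (mixed_crossings D))
      = 2 * (\<Sum>K\<in>?V. \<Sum>K'\<in>?V - {K}. h K K')"
    unfolding linking_sum_def sum_card_mixed_between[symmetric] sum_subtractf[symmetric]
    by (simp add: sum_distrib_left)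
  moreover have "even (\<Sum>K\<in>?V. \<Sum>K'\<in>?V - {K}. h K K')"
    by (rule even_symmetric_sum)
      (simp_all add: h_def modified_linking_commute[of _ _ K K' for K K'] mixed_between_commute[of _ K K' for K K'])
  ultimately show ?thesis by auto
qed

lemma unoriented_jones_integer_laurent: "unoriented_jones D I \<in> integer_laurent"
proof -
  let ?m = "card (mixed_crossings D)"
  obtain k where "linking_sum D I - 2 * int ?m = 4 * k"
    using linking_sum_dvd[of D I] by (elim dvdE)
  then have "linking_sum D I = 4 * k + 2 * int ?m"
    by (simp add: diff_eq_eq add.commute)
  \<comment> \<open>The half-integer \<open>m / 2\<close> cancels, so the prefactor is a sign rather
    than a power of the imaginary unit.\<close>
  then have "lambda_tilde D I - of_nat (s_neg D I) - of_nat ?m / 2 = of_int (k - int (s_neg D I))"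
    by (simp add: lambda_tilde_eq add_divide_distrib)
  then have "(-1) powr (lambda_tilde D I - of_nat (s_neg D I) - of_nat ?m / 2) \<in> \<int>"
    by (simp only: minus_one_powr_of_int) simp
  then show ?thesis
    by (simp add: unoriented_jones_def Let_def q_half_powi_def mult.assoc integer_laurent_single_times
        bracket_def bracket_from_integer_laurent)
qed

text \<open>The move takes \<open>I\<close> to some orientation of \<open>D'\<close>; independence
  of the orientation closes the gap to \<open>I'\<close>.\<close>

lemma move_unoriented_jones:
  assumes "move D D'" "every_edge_has_two_ends D" "every_edge_has_two_ends D'"
    and "orientation D I" "orientation D' I'"
  shows "unoriented_jones D I = unoriented_jones D' I'"
proof -
  obtain E where E: "map fst E = D" "I = in_darts E"
    using orientation_eq_in_darts[OF assms(4)] .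
  then have "balanced E"
    using orientation_in_darts_iff[of E] assms(2,4) by simp
  then obtain E' where E': "map fst E' = D'" "balanced E'" "equivalent_oriented E E'"
    using move_equivalent[OF assms(1) E(1)] assms(2,3) by blast
  then have "orientation D' (in_darts E')"
    using orientation_in_darts_iff[of E'] assms(3) by simp
  then have "unoriented_jones D' (in_darts E') = unoriented_jones D' I'"
    using unoriented_jones_orientation assms(5) by blast
  with equivalent_oriented_jones[OF E'(3)] show ?thesis
    by (simp add: E E'(1))
qed

lemma orientation_exists:
  assumes "every_edge_has_two_ends D"
  obtains I where "orientation D I"
  using balanced_exists[OF assms] orientation_in_darts_iff assms by metis

theorem theorem4:
  fixes D D' :: diagram and I I' :: "(nat \<times> nat) set"
  assumes "virtual_link_diagram D" and "virtual_link_diagram D'"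
    and "same_virtual_link D D'"
    and "orientation D I" and "orientation D' I'"
  shows "unoriented_jones D I = unoriented_jones D' I' \<and> unoriented_jones D I \<in> integer_laurent"
proof
  \<comment> \<open>Both orientations are quantified, because intermediate diagrams come without
    one: each step chooses an orientation and may apply the move in either direction.\<close>
  have "\<forall>I I'. orientation D I \<longrightarrow> orientation D' I' \<longrightarrow> unoriented_jones D I = unoriented_jones D' I'"
    using assms(3) unfolding same_virtual_link_def
  proof (induction rule: equivclp_induct)
    case base
    then show ?case
      using unoriented_jones_orientation by blast
  next
    case (step D1 D2)
    have two_ends: "every_edge_has_two_ends D1" "every_edge_has_two_ends D2"
      using step.hyps(2) by (auto simp: virtual_link_diagram_def)
    obtain I1 where I1: "orientation D1 I1"
      using orientation_exists[OF two_ends(1)] .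
    have "unoriented_jones D1 I1 = unoriented_jones D2 I2" if "orientation D2 I2" for I2
      using step.hyps(2) move_unoriented_jones[OF _ two_ends I1 that]
        move_unoriented_jones[OF _ two_ends(2,1) that I1] by auto
    then show ?case
      using step.IH I1 by metis
  qed
  then show "unoriented_jones D I = unoriented_jones D' I'"
    using assms(4,5) by blast
  show "unoriented_jones D I \<in> integer_laurent"
    by (rule unoriented_jones_integer_laurent)
qed

end
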